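(* Let $\sigma>0$ and let $A_N$ be an arbitrary deterministic $N\times N$ real symmetric matrix of rank $1$ whose nonnull eigenvalue $\theta$ (independent of $N$) satisfies $\theta>\sigma$. Let $M_N^G=X_N^G+A_N$, where $X_N^G$ is distributed as the GOE$(N,\sigma^2/N)$. Then, as $N\to\infty$, $$\sqrt N\bigl(\lambda_1(M_N^G)-\rho_\theta\bigr)\longrightarrow\mathcal{N}(0,2\sigma_\theta^2)\quad\text{in distribution},$$ where $\rho_\theta=\theta+\frac{\sigma^2}{\theta}$ and $\sigma_\theta=\frac{\sigma}{\theta}\sqrt{\theta^2-\sigma^2}$.
   Context: $\lambda_1(B)$ denotes the largest eigenvalue of a symmetric matrix $B$. GOE$(N,\sigma^2/N)$: the law of $X_N^G=\frac1{\sqrt N}W_N^G$ where $W_N^G$ is an $N\times N$ real symmetric random matrix such that the $N(N+1)/2$ variables $\frac1{\sqrt2}(W_N^G)_{ii}$, $(W_N^G)_{ij}$, $i<j$, are i.i.d. centered Gaussian with variance $\sigma^2$. *)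

theory Defs
  imports
    "HOL-Probability.Probability"
    "Jordan_Normal_Form.DL_Rank"
    "Jordan_Normal_Form.Spectral_Radius"
begin

text \<open>Indices run over \<open>0..<N\<close>, so the entries on and above the diagonal are indexed by the pairs
  \<open>(i, j)\<close> with \<open>i \<le> j < N\<close>. The second argument of \<^const>\<open>normal_density\<close> is the standard
  deviation, so \<open>normal_density 0 \<sigma>\<close> is the centered Gaussian density with variance \<open>\<sigma>\<^sup>2\<close>.\<close>

definition gaussian_wigner :: "'a measure \<Rightarrow> nat \<Rightarrow> real \<Rightarrow> ('a \<Rightarrow> real mat) \<Rightarrow> bool" where
  "gaussian_wigner P N \<sigma> W \<longleftrightarrow>
     (\<forall>\<omega>\<in>space P. W \<omega> \<in> carrier_mat N N \<and> transpose_mat (W \<omega>) = W \<omega>) \<and>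
     (let I = {(i, j). i \<le> j \<and> j < N};
          Y = (\<lambda>(i, j) \<omega>. if i = j then 1 / sqrt 2 * W \<omega> $$ (i, i) else W \<omega> $$ (i, j))
      in prob_space.indep_vars P (\<lambda>_. borel) Y I \<and>
         (\<forall>p\<in>I. distributed P lborel (Y p) (normal_density 0 \<sigma>)))"

text \<open>\<open>GOE_distributed P N \<sigma> X\<close>: the random matrix \<open>X\<close> on the probability space \<open>P\<close> is distributed as
  the GOE\<open>(N, \<sigma>\<^sup>2/N)\<close>. The last argument is \<open>\<sigma>\<close>, not the entry variance \<open>\<sigma>\<^sup>2/N\<close>.\<close>

definition GOE_distributed :: "'a measure \<Rightarrow> nat \<Rightarrow> real \<Rightarrow> ('a \<Rightarrow> real mat) \<Rightarrow> bool" where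
  "GOE_distributed P N \<sigma> X \<longleftrightarrow>
     prob_space P \<and>
     (\<exists>W. gaussian_wigner P N \<sigma> W \<and> (\<forall>\<omega>\<in>space P. X \<omega> = (1 / sqrt (real N)) \<cdot>\<^sub>m W \<omega>))"

text \<open>Meaningful for symmetric matrices of positive dimension, whose real spectrum is finite and
  nonempty.\<close>

definition lambda1 :: "real mat \<Rightarrow> real" where
  "lambda1 B = Max (spectrum B)"

definition rho :: "real \<Rightarrow> real \<Rightarrow> real" where
  "rho \<sigma> \<theta> = \<theta> + \<sigma>\<^sup>2 / \<theta>"

definition sigma_theta :: "real \<Rightarrow> real \<Rightarrow> real" where
  "sigma_theta \<sigma> \<theta> = \<sigma> / \<theta> * sqrt (\<theta>\<^sup>2 - \<sigma>\<^sup>2)"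

text \<open>The Gaussian law with mean \<open>m\<close> and variance \<open>v > 0\<close>.\<close>

definition gaussian_law :: "real \<Rightarrow> real \<Rightarrow> real measure" where
  "gaussian_law m v = density lborel (normal_density m (sqrt v))"

end

theory Submission
  imports Defs "HOL-Real_Asymp.Real_Asymp"
begin

text \<open>Write \<open>A = \<theta> u u\<^sup>T\<close>. The event \<open>\<lambda>\<^sub>1(X + A) \<le> t\<close> says that \<open>t - X - \<theta> u u\<^sup>T\<close> is positive semidefinite.
  By orthogonal invariance of the GOE its probability depends only on the norm of the perturbing vector, so
  that vector may be rotated onto a coordinate axis; completing the square in this coordinate leaves the
  same event for the remaining minor, with the squared norm \<open>d\<close> of the perturbation replaced by
  \<open>b / (t - a - d)\<close>, where \<open>a\<close> is the diagonal entry and \<open>b\<close> the squared norm of the rest of the row.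
  Hence the event has the same probability as the survival of a Markov chain started in \<open>\<theta>\<close> and
  driven by the entries of \<open>X\<close>.

  Read backwards, survival means \<open>\<theta> < D\<^sub>0\<close> for the continued fraction \<open>D\<^sub>m = t - a\<^sub>m - b\<^sub>m / D\<^bsub>m+1\<^esub>\<close>.
  With high probability all \<open>a\<^sub>m\<close> are small and \<open>b\<^sub>m\<close> is close to \<open>\<sigma>\<^sup>2 (1 - m / N)\<close>, which keeps
  \<open>D\<^sub>m \<ge> \<sigma>\<close>, and near \<open>t = \<rho>\<^sub>\<theta>\<close> the recursion contracts to its fixed point \<open>\<theta>\<close> with rate
  \<open>r = \<sigma>\<^sup>2 / \<theta>\<^sup>2\<close>. For \<open>t = \<rho>\<^sub>\<theta> + s / sqrt N\<close> linearisation shows that \<open>sqrt N (D\<^sub>0 - \<theta>)\<close> is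
  \<open>s / (1 - r)\<close> minus a geometrically weighted sum of the independent variables
  \<open>sqrt N (a\<^sub>m + (b\<^sub>m - \<sigma>\<^sup>2) / \<theta>)\<close>, up to \<open>o(1)\<close>. By characteristic functions this sum converges to
  a centered Gaussian of variance \<open>2 \<sigma>\<^sup>2 / (1 - r)\<close>, and \<open>(1 - r)\<^sup>2 \<cdot> 2 \<sigma>\<^sup>2 / (1 - r) = 2 \<sigma>\<^sub>\<theta>\<^sup>2\<close>.\<close>

section \<open>Orthogonal invariance of Gaussian matrices\<close>

text \<open>The chain is read backwards because \<theta> is a repelling fixed point of the forward
  step d -> \<sigma>^2 / (t - d): for t = rho its slope there is \<theta>^2 / \<sigma>^2 > 1. The
  inverse step contracts at the reciprocal rate, so survival is decided, up to a negligible error,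
  by a slowly growing number of top rows. All other rows enter only through the crude bound D_m >=
  \<sigma>, which persists because t stays above 2 \<sigma>, the edge of the unperturbed spectrum;
  this replaces any knowledge of the limiting spectral density.

  The rotation used at each elimination depends on the row just removed. The chain therefore agrees
  with the eigenvalue event in probability only, by conditioning on that row. Once the chain is
  reached, the comparison with the linear statistic is pathwise outside an event of small
  probability.

  The event is handled as an inequality between quadratic forms: this is stable under rotations and
  Schur complements, and measurable by testing on rational vectors.\<close>

abbreviation gauss :: "real \<Rightarrow> real measure" where
  "gauss \<sigma> \<equiv> density lborel (normal_density 0 \<sigma>)"

section \<open>Plane rotations of a product of equal Gaussian measures\<close>

lemma nn_integral_lborel_translate:
  fixes f :: "real \<Rightarrow> ennreal"
  assumes [measurable]: "f \<in> borel_measurable borel"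
  shows "(\<integral>\<^sup>+x. f (x + a) \<partial>lborel) = (\<integral>\<^sup>+x. f x \<partial>lborel)"
  using nn_integral_real_affine[of f 1 a] by (simp add: add.commute)

lemma nn_integral_shear_snd:
  fixes h :: "real \<times> real \<Rightarrow> ennreal"
  assumes [measurable]: "h \<in> borel_measurable (borel \<Otimes>\<^sub>M borel)"
  shows "(\<integral>\<^sup>+x. \<integral>\<^sup>+y. h (x, y + a * x) \<partial>lborel \<partial>lborel) = (\<integral>\<^sup>+x. \<integral>\<^sup>+y. h (x, y) \<partial>lborel \<partial>lborel)"
  by (intro nn_integral_cong nn_integral_lborel_translate[where f = "\<lambda>y. h (_, y)"]) simp

lemma nn_integral_shear_fst:
  fixes h :: "real \<times> real \<Rightarrow> ennreal"
  assumes [measurable]: "h \<in> borel_measurable (borel \<Otimes>\<^sub>M borel)"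
  shows "(\<integral>\<^sup>+x. \<integral>\<^sup>+y. h (x + a * y, y) \<partial>lborel \<partial>lborel) = (\<integral>\<^sup>+x. \<integral>\<^sup>+y. h (x, y) \<partial>lborel \<partial>lborel)"
proof -
  have swap: "(\<integral>\<^sup>+x. \<integral>\<^sup>+y. g (x, y) \<partial>lborel \<partial>lborel) = (\<integral>\<^sup>+y. \<integral>\<^sup>+x. g (x, y) \<partial>lborel \<partial>lborel)"
    if [measurable]: "g \<in> borel_measurable (borel \<Otimes>\<^sub>M borel)" for g :: "real \<times> real \<Rightarrow> ennreal"
    by (rule lborel_pair.Fubini') simp
  have "(\<integral>\<^sup>+x. \<integral>\<^sup>+y. h (x + a * y, y) \<partial>lborel \<partial>lborel) = (\<integral>\<^sup>+y. \<integral>\<^sup>+x. h (x + a * y, y) \<partial>lborel \<partial>lborel)"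
    using swap[of "\<lambda>(x, y). h (x + a * y, y)"] by simp
  also have "\<dots> = (\<integral>\<^sup>+y. \<integral>\<^sup>+x. h (x, y) \<partial>lborel \<partial>lborel)"
    by (intro nn_integral_cong nn_integral_lborel_translate[where f = "\<lambda>x. h (x, _)"]) simp
  finally show ?thesis using swap[of h] by simp
qed

text \<open>A plane rotation of angle different from \<open>\<pi>\<close> is a product of three shears.\<close>

lemma nn_integral_lborel_rotate:
  fixes h :: "real \<times> real \<Rightarrow> ennreal"
  assumes [measurable]: "h \<in> borel_measurable (borel \<Otimes>\<^sub>M borel)"
    and cs: "c\<^sup>2 + s\<^sup>2 = 1" and c: "c \<noteq> -1"
  shows "(\<integral>\<^sup>+x. \<integral>\<^sup>+y. h (c * x - s * y, s * x + c * y) \<partial>lborel \<partial>lborel) = (\<integral>\<^sup>+x. \<integral>\<^sup>+y. h (x, y) \<partial>lborel \<partial>lborel)"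
proof -
  \<comment> \<open>The rotation by an angle phi is a product of shears with coefficients -tan (phi
    / 2), sin phi, -tan (phi / 2), and s / (1 + c) is this tangent; its pole is at c = -1.\<close>
  define a where "a = - s / (1 + c)"
  have c1: "1 + c \<noteq> 0" using c by (simp add: add_eq_0_iff)
  have a1: "a * (1 + c) = - s" using c1 by (simp add: a_def)
  have "(1 + c) * (1 + a * s) = (1 + c) * c"
  proof -
    have "(1 + c) * (1 + a * s) = 1 + c + s * (a * (1 + c))" by (simp add: algebra_simps)
    also have "\<dots> = 1 + c - s\<^sup>2" by (simp add: a1 power2_eq_square)
    also have "\<dots> = (1 + c) * c" using cs by (simp add: algebra_simps power2_eq_square)
    finally show ?thesis .
  qed
  then have a2: "1 + a * s = c" using c1 by simp
  define K1 where "K1 = (\<lambda>(x, y). h (x + a * y, y))"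
  define K2 where "K2 = (\<lambda>(x, y). K1 (x, y + s * x))"
  have [measurable]: "K1 \<in> borel_measurable (borel \<Otimes>\<^sub>M borel)" unfolding K1_def by measurable
  have [measurable]: "K2 \<in> borel_measurable (borel \<Otimes>\<^sub>M borel)" unfolding K2_def by measurable
  have eq: "h (c * x - s * y, s * x + c * y) = K2 (x + a * y, y)" for x y
  proof -
    have e1: "y + s * (x + a * y) = s * x + c * y"
      using a2 by (simp add: algebra_simps flip: distrib_left) (metis add.commute mult.commute mult.left_commute distrib_left mult.right_neutral)
    have "x + a * y + a * (s * x + c * y) = (1 + a * s) * x + (a * (1 + c)) * y"
      by (simp add: algebra_simps)
    then have e2: "x + a * y + a * (s * x + c * y) = c * x - s * y" using a1 a2 by simp
    show ?thesis by (simp add: K2_def K1_def e1 e2)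
  qed
  have "(\<integral>\<^sup>+x. \<integral>\<^sup>+y. h (c * x - s * y, s * x + c * y) \<partial>lborel \<partial>lborel) = (\<integral>\<^sup>+x. \<integral>\<^sup>+y. K2 (x, y) \<partial>lborel \<partial>lborel)"
    unfolding eq by (rule nn_integral_shear_fst) simp
  also have "\<dots> = (\<integral>\<^sup>+x. \<integral>\<^sup>+y. K1 (x, y) \<partial>lborel \<partial>lborel)"
    unfolding K2_def prod.case by (rule nn_integral_shear_snd) simp
  also have "\<dots> = (\<integral>\<^sup>+x. \<integral>\<^sup>+y. h (x, y) \<partial>lborel \<partial>lborel)"
    unfolding K1_def prod.case by (rule nn_integral_shear_fst) simp
  finally show ?thesis .
qed

lemma normal_density_rotate:
  assumes cs: "c\<^sup>2 + s\<^sup>2 = (1::real)"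
  shows "normal_density 0 \<sigma> (c * x - s * y) * normal_density 0 \<sigma> (s * x + c * y)
       = normal_density 0 \<sigma> x * normal_density 0 \<sigma> y"
proof -
  have "(c * x - s * y)\<^sup>2 + (s * x + c * y)\<^sup>2 = (c\<^sup>2 + s\<^sup>2) * (x\<^sup>2 + y\<^sup>2)"
    by (simp add: power2_eq_square algebra_simps)
  then have "(c * x - s * y)\<^sup>2 + (s * x + c * y)\<^sup>2 = x\<^sup>2 + y\<^sup>2" using cs by simp
  then have "(c * x - s * y)\<^sup>2 / (2 * \<sigma>\<^sup>2) + (s * x + c * y)\<^sup>2 / (2 * \<sigma>\<^sup>2) = x\<^sup>2 / (2 * \<sigma>\<^sup>2) + y\<^sup>2 / (2 * \<sigma>\<^sup>2)"
    by (simp flip: add_divide_distrib)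
  then have "exp (- (c * x - s * y)\<^sup>2 / (2 * \<sigma>\<^sup>2)) * exp (- (s * x + c * y)\<^sup>2 / (2 * \<sigma>\<^sup>2))
      = exp (- x\<^sup>2 / (2 * \<sigma>\<^sup>2)) * exp (- y\<^sup>2 / (2 * \<sigma>\<^sup>2))"
    unfolding exp_add[symmetric] by simp
  then show ?thesis
    unfolding normal_density_def by (simp add: mult.left_commute mult.assoc)
qed

lemma nn_integral_gauss_rotate:
  fixes h :: "real \<times> real \<Rightarrow> ennreal"
  assumes [measurable]: "h \<in> borel_measurable (borel \<Otimes>\<^sub>M borel)"
    and cs: "c\<^sup>2 + s\<^sup>2 = 1" and c: "c \<noteq> -1"
  shows "(\<integral>\<^sup>+x. \<integral>\<^sup>+y. h (c * x - s * y, s * x + c * y) \<partial>gauss \<sigma> \<partial>gauss \<sigma>) = (\<integral>\<^sup>+x. \<integral>\<^sup>+y. h (x, y) \<partial>gauss \<sigma> \<partial>gauss \<sigma>)"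
proof -
  have dens: "(\<integral>\<^sup>+x. \<integral>\<^sup>+y. g (x, y) \<partial>gauss \<sigma> \<partial>gauss \<sigma>)
      = (\<integral>\<^sup>+x. \<integral>\<^sup>+y. ennreal (normal_density 0 \<sigma> x * normal_density 0 \<sigma> y) * g (x, y) \<partial>lborel \<partial>lborel)"
    if [measurable]: "g \<in> borel_measurable (borel \<Otimes>\<^sub>M borel)" for g :: "real \<times> real \<Rightarrow> ennreal"
    by (simp add: nn_integral_density ennreal_mult' nn_integral_cmult mult.assoc
             flip: nn_integral_cmult cong: nn_integral_cong)
  define H where "H = (\<lambda>(x, y). ennreal (normal_density 0 \<sigma> x * normal_density 0 \<sigma> y) * h (x, y))"
  have [measurable]: "H \<in> borel_measurable (borel \<Otimes>\<^sub>M borel)" unfolding H_def by measurable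
  have "(\<integral>\<^sup>+x. \<integral>\<^sup>+y. h (c * x - s * y, s * x + c * y) \<partial>gauss \<sigma> \<partial>gauss \<sigma>)
     = (\<integral>\<^sup>+x. \<integral>\<^sup>+y. H (c * x - s * y, s * x + c * y) \<partial>lborel \<partial>lborel)"
    using dens[of "\<lambda>(x, y). h (c * x - s * y, s * x + c * y)"]
    by (simp add: H_def normal_density_rotate[OF cs])
  also have "\<dots> = (\<integral>\<^sup>+x. \<integral>\<^sup>+y. H (x, y) \<partial>lborel \<partial>lborel)"
    by (rule nn_integral_lborel_rotate) (use cs c in auto)
  also have "\<dots> = (\<integral>\<^sup>+x. \<integral>\<^sup>+y. h (x, y) \<partial>gauss \<sigma> \<partial>gauss \<sigma>)"
    using dens[of h] by (simp add: H_def)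
  finally show ?thesis .
qed

text \<open>The index type stays open because the same map acts on vectors and on pairs of matrix
  entries.\<close>

definition pair_rot :: "real \<Rightarrow> real \<Rightarrow> 'i \<Rightarrow> 'i \<Rightarrow> ('i \<Rightarrow> real) \<Rightarrow> 'i \<Rightarrow> real" where
  "pair_rot c s p q w = w(p := c * w p - s * w q, q := s * w p + c * w q)"

lemma distr_pair_rot:
  fixes I :: "'i set"
  assumes \<sigma>: "\<sigma> > 0" and I: "finite I" and pq: "p \<in> I" "q \<in> I" "p \<noteq> q"
    and cs: "c\<^sup>2 + s\<^sup>2 = 1" and c: "c \<noteq> -1"
  shows "pair_rot c s p q \<in> measurable (\<Pi>\<^sub>M i\<in>I. gauss \<sigma>) (\<Pi>\<^sub>M i\<in>I. gauss \<sigma>)" (is ?meas)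
    and "distr (\<Pi>\<^sub>M i\<in>I. gauss \<sigma>) (\<Pi>\<^sub>M i\<in>I. gauss \<sigma>) (pair_rot c s p q) = (\<Pi>\<^sub>M i\<in>I. gauss \<sigma>)" (is ?distr)
proof -
  let ?M = "\<Pi>\<^sub>M i\<in>I. gauss \<sigma>"
  interpret g: prob_space "gauss \<sigma>" by (rule prob_space_normal_density[OF \<sigma>])
  interpret product_sigma_finite "\<lambda>_::'i. gauss \<sigma>" by standard
  have [measurable]: "(\<lambda>w. w p) \<in> borel_measurable ?M" "(\<lambda>w. w q) \<in> borel_measurable ?M"
    using pq by (auto intro!: measurable_component_singleton[THEN measurable_compose] simp: measurable_ident_sets)
  show meas [measurable]: ?meas
  proof (rule measurable_PiM_single')
    fix i assume "i \<in> I"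
    then have "(\<lambda>w. w i) \<in> borel_measurable ?M"
      by (auto intro!: measurable_component_singleton[THEN measurable_compose] simp: measurable_ident_sets)
    then show "(\<lambda>w. pair_rot c s p q w i) \<in> measurable ?M (gauss \<sigma>)"
      unfolding pair_rot_def by (cases "i = p"; cases "i = q") (auto intro!: borel_measurable_add borel_measurable_diff borel_measurable_times)
  qed (use pq in \<open>auto simp: pair_rot_def space_PiM extensional_def PiE_def\<close>)
  define J where "J = I - {p, q}"
  have J: "finite J" "q \<notin> J" "p \<notin> insert q J" "I = insert p (insert q J)"
    using I pq by (auto simp: J_def)
  \<comment> \<open>The coordinates p and q are integrated innermost, so that the two-dimensional
    statement applies for every fixed choice of the others.\<close>
  have split: "integral\<^sup>N ?M f = (\<integral>\<^sup>+w. \<integral>\<^sup>+x. \<integral>\<^sup>+y. f (w(q := y, p := x)) \<partial>gauss \<sigma> \<partial>gauss \<sigma> \<partial>(\<Pi>\<^sub>M i\<in>J. gauss \<sigma>))"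
    if f: "f \<in> borel_measurable ?M" for f
  proof -
    have fp: "(\<lambda>w. f (w(p := x))) \<in> borel_measurable (\<Pi>\<^sub>M i\<in>insert q J. gauss \<sigma>)" for x
    proof -
      have "(\<lambda>w. w(p := x)) \<in> measurable (\<Pi>\<^sub>M i\<in>insert q J. gauss \<sigma>) ?M"
        unfolding J(4) by (rule measurable_fun_upd[where J="insert q J"]) auto
      then show ?thesis using f by (rule measurable_compose)
    qed
    interpret Q: prob_space "\<Pi>\<^sub>M i\<in>J. gauss \<sigma>" by (intro prob_space_PiM) unfold_locales
    interpret PQ: pair_sigma_finite "gauss \<sigma>" "\<Pi>\<^sub>M i\<in>J. gauss \<sigma>" by unfold_locales
    have m2: "(\<lambda>z. f ((snd (snd z))(q := fst (snd z), p := fst z))) \<in> borel_measurable (gauss \<sigma> \<Otimes>\<^sub>M gauss \<sigma> \<Otimes>\<^sub>M (\<Pi>\<^sub>M i\<in>J. gauss \<sigma>))"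
    proof -
      have "(\<lambda>z. (snd (snd z))(q := fst (snd z), p := fst z)) \<in> measurable (gauss \<sigma> \<Otimes>\<^sub>M gauss \<sigma> \<Otimes>\<^sub>M (\<Pi>\<^sub>M i\<in>J. gauss \<sigma>)) ?M"
        unfolding J(4)
        by (intro measurable_fun_upd[where J="insert q J"] measurable_fun_upd[where J=J]) auto
      from measurable_compose[OF this f] show ?thesis .
    qed
    have "integral\<^sup>N ?M f = (\<integral>\<^sup>+x. \<integral>\<^sup>+w. f (w(p := x)) \<partial>(\<Pi>\<^sub>M i\<in>insert q J. gauss \<sigma>) \<partial>gauss \<sigma>)"
      unfolding J(4) by (rule product_nn_integral_insert_rev) (use J f in auto)
    also have "\<dots> = (\<integral>\<^sup>+x. \<integral>\<^sup>+w. \<integral>\<^sup>+y. f (w(q := y, p := x)) \<partial>gauss \<sigma> \<partial>(\<Pi>\<^sub>M i\<in>J. gauss \<sigma>) \<partial>gauss \<sigma>)"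
      by (intro nn_integral_cong product_nn_integral_insert fp) (use J in auto)
    also have "\<dots> = (\<integral>\<^sup>+w. \<integral>\<^sup>+x. \<integral>\<^sup>+y. f (w(q := y, p := x)) \<partial>gauss \<sigma> \<partial>gauss \<sigma> \<partial>(\<Pi>\<^sub>M i\<in>J. gauss \<sigma>))"
    proof (rule PQ.Fubini'[symmetric])
      have "(\<lambda>z. (fst (fst z), snd z, snd (fst z))) \<in> measurable ((gauss \<sigma> \<Otimes>\<^sub>M (\<Pi>\<^sub>M i\<in>J. gauss \<sigma>)) \<Otimes>\<^sub>M gauss \<sigma>) (gauss \<sigma> \<Otimes>\<^sub>M gauss \<sigma> \<Otimes>\<^sub>M (\<Pi>\<^sub>M i\<in>J. gauss \<sigma>))"
        by (intro measurable_Pair measurable_fst measurable_snd measurable_compose[OF measurable_fst measurable_fst] measurable_compose[OF measurable_fst measurable_snd])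
      from measurable_compose[OF this m2]
      show "(\<lambda>(x, w). \<integral>\<^sup>+y. f (w(q := y, p := x)) \<partial>gauss \<sigma>) \<in> borel_measurable (gauss \<sigma> \<Otimes>\<^sub>M (\<Pi>\<^sub>M i\<in>J. gauss \<sigma>))"
        unfolding split_beta
        by (intro sigma_finite_measure.borel_measurable_nn_integral) (auto simp: split_beta sigma_finite_measures)
    qed
    finally show ?thesis .
  qed
  show ?distr
  proof (rule measure_eqI)
    fix A assume "A \<in> sets (distr ?M ?M (pair_rot c s p q))"
    then have A[measurable]: "A \<in> sets ?M" by simp
    have "emeasure (distr ?M ?M (pair_rot c s p q)) A = (\<integral>\<^sup>+w. indicator A w \<partial>distr ?M ?M (pair_rot c s p q))"
      by simp
    also have "\<dots> = (\<integral>\<^sup>+w. indicator A (pair_rot c s p q w) \<partial>?M)"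
      by (rule nn_integral_distr) auto
    also have "\<dots> = (\<integral>\<^sup>+w. \<integral>\<^sup>+x. \<integral>\<^sup>+y. indicator A (pair_rot c s p q (w(q := y, p := x))) \<partial>gauss \<sigma> \<partial>gauss \<sigma> \<partial>(\<Pi>\<^sub>M i\<in>J. gauss \<sigma>))"
      by (rule split) measurable
    also have "\<dots> = (\<integral>\<^sup>+w. \<integral>\<^sup>+x. \<integral>\<^sup>+y. indicator A (w(q := s * x + c * y, p := c * x - s * y)) \<partial>gauss \<sigma> \<partial>gauss \<sigma> \<partial>(\<Pi>\<^sub>M i\<in>J. gauss \<sigma>))"
      using pq by (simp add: pair_rot_def fun_upd_twist)
    also have "\<dots> = (\<integral>\<^sup>+w. \<integral>\<^sup>+x. \<integral>\<^sup>+y. indicator A (w(q := y, p := x)) \<partial>gauss \<sigma> \<partial>gauss \<sigma> \<partial>(\<Pi>\<^sub>M i\<in>J. gauss \<sigma>))"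
    proof (rule nn_integral_cong)
      fix w assume w: "w \<in> space (\<Pi>\<^sub>M i\<in>J. gauss \<sigma>)"
      have "(\<lambda>z. w(q := snd z, p := fst z)) \<in> measurable (borel \<Otimes>\<^sub>M borel) ?M"
        unfolding J(4)
        by (intro measurable_fun_upd[where J="insert q J"] measurable_fun_upd[where J=J]) (use w in auto)
      from measurable_compose[OF this borel_measurable_indicator[OF A]]
      show "(\<integral>\<^sup>+x. \<integral>\<^sup>+y. indicator A (w(q := s * x + c * y, p := c * x - s * y)) \<partial>gauss \<sigma> \<partial>gauss \<sigma>)
         = (\<integral>\<^sup>+x. \<integral>\<^sup>+y. indicator A (w(q := y, p := x)) \<partial>gauss \<sigma> \<partial>gauss \<sigma>)"
        using nn_integral_gauss_rotate[OF _ cs c, of "\<lambda>z. indicator A (w(q := snd z, p := fst z))" \<sigma>] by simp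
    qed
    also have "\<dots> = (\<integral>\<^sup>+w. indicator A w \<partial>?M)"
      by (rule split[symmetric]) simp
    finally show "emeasure (distr ?M ?M (pair_rot c s p q)) A = emeasure ?M A" by simp
  qed simp
qed

abbreviation gprod :: "real \<Rightarrow> 'i set \<Rightarrow> ('i \<Rightarrow> real) measure" where
  "gprod \<sigma> I \<equiv> \<Pi>\<^sub>M i\<in>I. gauss \<sigma>"

text \<open>Rotates by one common angle all pairs {x, \<tau> x} with x in A, where \<tau> is an
  involution and A holds one member of each pair. Taking \<tau> to exchange the two indices, two
  rows or two columns covers the symmetrisation and both halves of a conjugation.\<close>

definition involution_rot :: "real \<Rightarrow> real \<Rightarrow> ('i \<Rightarrow> 'i) \<Rightarrow> 'i set \<Rightarrow> ('i \<Rightarrow> real) \<Rightarrow> 'i \<Rightarrow> real" where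
  "involution_rot c s \<tau> A w x =
     (if x \<in> A then c * w x - s * w (\<tau> x) else if \<tau> x \<in> A then s * w (\<tau> x) + c * w x else w x)"

text \<open>The pairs are disjoint, so the plane rotations can be composed one after another, and
  each of them preserves the product measure.\<close>

lemma distr_involution_rot:
  fixes I :: "'i set"
  assumes \<sigma>: "\<sigma> > 0" and I: "finite I" and cs: "c\<^sup>2 + s\<^sup>2 = 1" "c \<noteq> -1"
    and \<tau>: "\<And>x. \<tau> (\<tau> x) = x"
    and A: "finite A" "A \<subseteq> I" "\<tau> ` A \<subseteq> I" "A \<inter> \<tau> ` A = {}"
  shows "involution_rot c s \<tau> A \<in> measurable (gprod \<sigma> I) (gprod \<sigma> I) \<and>
    distr (gprod \<sigma> I) (gprod \<sigma> I) (involution_rot c s \<tau> A) = gprod \<sigma> I"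
  using A
proof (induction A rule: finite_induct)
  case empty
  have "involution_rot c s \<tau> {} = (\<lambda>w. w)"
    by (auto simp: involution_rot_def fun_eq_iff)
  then show ?case by (simp add: distr_id)
next
  case (insert a A)
  have na: "a \<notin> A" "\<tau> a \<notin> A" "\<tau> a \<noteq> a" "a \<notin> \<tau> ` A" using insert by auto
  have eq: "involution_rot c s \<tau> (insert a A) = pair_rot c s a (\<tau> a) \<circ> involution_rot c s \<tau> A"
  proof (intro ext)
    fix w x
    show "involution_rot c s \<tau> (insert a A) w x = (pair_rot c s a (\<tau> a) \<circ> involution_rot c s \<tau> A) w x"
      using na \<tau> by (cases "x = a"; cases "x = \<tau> a") (auto simp: involution_rot_def pair_rot_def; metis \<tau>)+
  qed
  have IH: "involution_rot c s \<tau> A \<in> measurable (gprod \<sigma> I) (gprod \<sigma> I)"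
    "distr (gprod \<sigma> I) (gprod \<sigma> I) (involution_rot c s \<tau> A) = gprod \<sigma> I"
    using insert by auto
  have pr: "pair_rot c s a (\<tau> a) \<in> measurable (gprod \<sigma> I) (gprod \<sigma> I)"
    "distr (gprod \<sigma> I) (gprod \<sigma> I) (pair_rot c s a (\<tau> a)) = gprod \<sigma> I"
    using distr_pair_rot[OF \<sigma> I, of a "\<tau> a" c s] insert.prems cs na by auto
  show ?case
    unfolding eq using measurable_comp[OF IH(1) pr(1)] distr_distr[OF pr(1) IH(1)] IH(2) pr(2) by (simp add: comp_def)
qed

section \<open>Symmetric Gaussian matrices and measurability of the eigenvalue event\<close>

text \<open>The factor sqrt 2 undoes the normalisation of the diagonal, so that all coordinates of
  \<open>Y\<close> on the upper triangle can be i.i.d.\<close>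

definition wigner_entry :: "(nat \<times> nat \<Rightarrow> real) \<Rightarrow> nat \<Rightarrow> nat \<Rightarrow> real" where
  "wigner_entry Y i j = (if i = j then sqrt 2 * Y (i, i) else Y (min i j, max i j))"

definition upper_tri :: "nat set \<Rightarrow> (nat \<times> nat) set" where
  "upper_tri S = {(i, j). i \<in> S \<and> j \<in> S \<and> i \<le> j}"

definition bform :: "nat set \<Rightarrow> (nat \<Rightarrow> nat \<Rightarrow> real) \<Rightarrow> (nat \<Rightarrow> real) \<Rightarrow> real" where
  "bform S B v = (\<Sum>i\<in>S. \<Sum>j\<in>S. B i j * v i * v j)"

text \<open>The largest eigenvalue of \<open>B + y y\<^sup>T\<close>, restricted to the coordinates in \<open>S\<close>, is at most \<open>t\<close>.\<close>

definition dominated :: "real \<Rightarrow> nat set \<Rightarrow> (nat \<Rightarrow> nat \<Rightarrow> real) \<Rightarrow> (nat \<Rightarrow> real) \<Rightarrow> bool" where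
  "dominated t S B y \<longleftrightarrow> (\<forall>v. bform S B v + (\<Sum>i\<in>S. y i * v i)\<^sup>2 \<le> t * (\<Sum>i\<in>S. (v i)\<^sup>2))"

lemma finite_upper_tri [simp]: "finite S \<Longrightarrow> finite (upper_tri S)"
  by (rule finite_subset[of _ "S \<times> S"]) (auto simp: upper_tri_def)

lemma dominated_cong:
  assumes "\<And>i j. i \<in> S \<Longrightarrow> j \<in> S \<Longrightarrow> B i j = B' i j" "\<And>i. i \<in> S \<Longrightarrow> y i = y' i"
  shows "dominated t S B y \<longleftrightarrow> dominated t S B' y'"
  unfolding dominated_def bform_def using assms by (simp cong: sum.cong)

text \<open>Both sides of the inequality are continuous in v, and rational vectors are dense. What
  remains is a countable intersection, which makes the event measurable.\<close>

lemma dominated_iff_rational: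
  assumes S: "finite S"
  shows "dominated t S B y \<longleftrightarrow>
    (\<forall>v\<in>S \<rightarrow>\<^sub>E \<rat>. bform S B v + (\<Sum>i\<in>S. y i * v i)\<^sup>2 \<le> t * (\<Sum>i\<in>S. (v i)\<^sup>2))"
proof
  assume *: "\<forall>v\<in>S \<rightarrow>\<^sub>E \<rat>. bform S B v + (\<Sum>i\<in>S. y i * v i)\<^sup>2 \<le> t * (\<Sum>i\<in>S. (v i)\<^sup>2)"
  show "dominated t S B y"
    unfolding dominated_def
  proof
    fix v :: "nat \<Rightarrow> real"
    have "\<exists>q\<in>\<rat>. x - 1 / real (Suc n) < q \<and> q < x" for x n
      by (rule Rats_dense_in_real) simp
    then obtain q where q: "\<And>x n. q x n \<in> \<rat>" "\<And>x n. x - 1 / real (Suc n) < q x n" "\<And>x n. q x n < x"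
      by metis
    have lim: "q x \<longlonglongrightarrow> x" for x
    proof (rule tendsto_sandwich)
      show "(\<lambda>n. x - 1 / real (Suc n)) \<longlonglongrightarrow> x"
        using tendsto_diff[OF tendsto_const LIMSEQ_inverse_real_of_nat, of x] by (simp add: inverse_eq_divide)
      show "\<forall>\<^sub>F n in sequentially. x - 1 / real (Suc n) \<le> q x n" "\<forall>\<^sub>F n in sequentially. q x n \<le> x"
        by (intro always_eventually allI less_imp_le q)+
    qed simp
    define u where "u n = restrict (\<lambda>i. q (v i) n) S" for n
    have u: "u n i = q (v i) n" if "i \<in> S" for i n using that by (simp add: u_def)
    have "bform S B (u n) + (\<Sum>i\<in>S. y i * u n i)\<^sup>2 \<le> t * (\<Sum>i\<in>S. (u n i)\<^sup>2)" for n
    proof -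
      have "u n \<in> S \<rightarrow>\<^sub>E \<rat>" by (auto simp: u_def q)
      then show ?thesis using * by blast
    qed
    then have le: "(\<Sum>i\<in>S. \<Sum>j\<in>S. B i j * q (v i) n * q (v j) n) + (\<Sum>i\<in>S. y i * q (v i) n)\<^sup>2 \<le> t * (\<Sum>i\<in>S. (q (v i) n)\<^sup>2)" for n
      by (simp add: bform_def u cong: sum.cong)
    show "bform S B v + (\<Sum>i\<in>S. y i * v i)\<^sup>2 \<le> t * (\<Sum>i\<in>S. (v i)\<^sup>2)"
      unfolding bform_def
      by (rule LIMSEQ_le[rotated 2]) (auto intro!: tendsto_intros lim exI[of _ 0] le)
  qed
qed (auto simp: dominated_def)

lemma sets_dominated:
  assumes S: "finite S" and B: "\<And>i j. i \<in> S \<Longrightarrow> j \<in> S \<Longrightarrow> (\<lambda>w. B w i j) \<in> borel_measurable M"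
  shows "{w \<in> space M. dominated t S (B w) y} \<in> sets M"
proof -
  have c: "countable (S \<rightarrow>\<^sub>E (\<rat> :: real set))"
    by (intro countable_PiE S countable_rat)
  have m: "{w \<in> space M. bform S (B w) v + (\<Sum>i\<in>S. y i * v i)\<^sup>2 \<le> t * (\<Sum>i\<in>S. (v i)\<^sup>2)} \<in> sets M" for v
  proof -
    have [measurable]: "(\<lambda>w. bform S (B w) v) \<in> borel_measurable M"
      unfolding bform_def by (intro borel_measurable_sum borel_measurable_times B) auto
    show ?thesis by measurable
  qed
  show ?thesis
    unfolding dominated_iff_rational[OF S] by (rule sets.sets_Collect_countable_All'[OF m c])
qed

lemma measurable_gprod_component:
  assumes "i \<in> I"
  shows "(\<lambda>w. w i) \<in> borel_measurable (gprod \<sigma> I)"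
  using measurable_component_singleton[OF assms, of "\<lambda>_. gauss \<sigma>"] by (simp cong: measurable_cong_sets)

lemma sets_dominated_wigner:
  assumes "finite S"
  shows "{Y \<in> space (gprod \<sigma> (upper_tri S)). dominated t S (wigner_entry Y) y} \<in> sets (gprod \<sigma> (upper_tri S))"
proof (rule sets_dominated[OF assms])
  fix i j assume "i \<in> S" "j \<in> S"
  then show "(\<lambda>Y. wigner_entry Y i j) \<in> borel_measurable (gprod \<sigma> (upper_tri S))"
    unfolding wigner_entry_def
    by (cases "i = j") (simp_all add: upper_tri_def min_def max_def measurable_gprod_component borel_measurable_times)
qed

text \<open>This is (Z + Z^T) / sqrt 2. For a full array of i.i.d. entries of variance \<sigma>^2 it
  has variance \<sigma>^2 off the diagonal and 2 \<sigma>^2 on it, as required of a Wigner matrix.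
  The full array is easier to rotate because all its entries have the same law.\<close>

definition symmetrize :: "(nat \<times> nat \<Rightarrow> real) \<Rightarrow> nat \<Rightarrow> nat \<Rightarrow> real" where
  "symmetrize Z i j = (Z (i, j) + Z (j, i)) / sqrt 2"

lemma sets_dominated_symmetrize:
  assumes "finite S"
  shows "{Z \<in> space (gprod \<sigma> (S \<times> S)). dominated t S (symmetrize Z) y} \<in> sets (gprod \<sigma> (S \<times> S))"
  unfolding symmetrize_def[abs_def]
  by (intro sets_dominated[OF assms] borel_measurable_divide borel_measurable_add measurable_gprod_component borel_measurable_const) auto

lemma emeasure_distr_vimage:
  assumes f: "f \<in> measurable M M'" and "distr M M' f = M'" and "{x \<in> space M'. P x} \<in> sets M'"
  shows "emeasure M' {x \<in> space M'. P x} = emeasure M {x \<in> space M. P (f x)}"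
proof -
  have "emeasure M' {x \<in> space M'. P x} = emeasure (distr M M' f) {x \<in> space M'. P x}" using assms by simp
  also have "\<dots> = emeasure M (f -` {x \<in> space M'. P x} \<inter> space M)" by (rule emeasure_distr[OF f assms(3)])
  also have "f -` {x \<in> space M'. P x} \<inter> space M = {x \<in> space M. P (f x)}"
    using measurable_space[OF f] by auto
  finally show ?thesis .
qed

text \<open>Rotating each pair (Z (i, j), Z (j, i)) with i < j by an eighth of a full turn makes its
  first member the symmetrised entry and preserves the law of Z; afterwards only the upper triangle
  is kept.\<close>

lemma emeasure_wigner_symmetrize:
  assumes \<sigma>: "\<sigma> > 0" and S: "finite S"
  shows "emeasure (gprod \<sigma> (upper_tri S)) {Y \<in> space (gprod \<sigma> (upper_tri S)). dominated t S (wigner_entry Y) y}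
       = emeasure (gprod \<sigma> (S \<times> S)) {Z \<in> space (gprod \<sigma> (S \<times> S)). dominated t S (symmetrize Z) y}"
proof -
  let ?F = "involution_rot (1 / sqrt 2) (- 1 / sqrt 2) prod.swap {(i, j). i \<in> S \<and> j \<in> S \<and> i < j}"
  let ?R = "\<lambda>Z. restrict Z (upper_tri S)"
  have sub: "upper_tri S \<subseteq> S \<times> S" by (auto simp: upper_tri_def)
  interpret g: prob_space "gauss \<sigma>" by (rule prob_space_normal_density[OF \<sigma>])
  interpret product_prob_space "\<lambda>_::nat \<times> nat. gauss \<sigma>" "S \<times> S" by standard
  let ?L = "{(i, j). i \<in> S \<and> j \<in> S \<and> i < j}"
  have cs: "(1 / sqrt 2)\<^sup>2 + (- 1 / sqrt 2)\<^sup>2 = (1::real)" "1 / sqrt 2 \<noteq> (-1::real)"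
  proof -
    have "0 \<le> 1 / sqrt (2::real)" by simp
    then show "1 / sqrt 2 \<noteq> (-1::real)" by linarith
  qed (simp add: power_divide)
  have tau: "prod.swap (prod.swap x) = x" for x :: "nat \<times> nat" by simp
  have L: "?L \<subseteq> S \<times> S" "prod.swap ` ?L \<subseteq> S \<times> S" "?L \<inter> prod.swap ` ?L = {}" by auto
  have fin: "finite (S \<times> S)" "finite ?L"
    using S L(1) by (auto intro: finite_subset)
  note F = distr_involution_rot[OF \<sigma> fin(1) cs tau fin(2) L, THEN conjunct1]
    distr_involution_rot[OF \<sigma> fin(1) cs tau fin(2) L, THEN conjunct2]
  have R: "?R \<in> measurable (gprod \<sigma> (S \<times> S)) (gprod \<sigma> (upper_tri S))"
    "distr (gprod \<sigma> (S \<times> S)) (gprod \<sigma> (upper_tri S)) ?R = gprod \<sigma> (upper_tri S)"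
    using distr_restrict[OF sub] S by (auto intro!: measurable_restrict_subset sub)
  have RF: "distr (gprod \<sigma> (S \<times> S)) (gprod \<sigma> (upper_tri S)) (?R \<circ> ?F) = gprod \<sigma> (upper_tri S)"
    using distr_distr[OF R(1) F(1)] F(2) R(2) by simp
  have eq: "dominated t S (wigner_entry ((?R \<circ> ?F) Z)) y = dominated t S (symmetrize Z) y" for Z
  proof (rule dominated_cong)
    fix i j assume ij: "i \<in> S" "j \<in> S"
    have d: "sqrt 2 * a = (a + a) / sqrt 2" for a :: real
      by (simp add: field_simps)
    show "wigner_entry ((?R \<circ> ?F) Z) i j = symmetrize Z i j"
      using ij d[of "Z (i, i)"]
      by (cases i j rule: linorder_cases)
         (auto simp: wigner_entry_def symmetrize_def involution_rot_def upper_tri_def add_divide_distrib)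
  qed simp
  show ?thesis
    using emeasure_distr_vimage[OF measurable_comp[OF F(1) R(1)] RF sets_dominated_wigner[OF S, of \<sigma> t y]]
    unfolding eq .
qed

section \<open>Conjugation by plane rotations\<close>

lemma sum_pair_rot_adjoint:
  assumes "finite S" "p \<in> S" "q \<in> S" "p \<noteq> q"
  shows "(\<Sum>i\<in>S. pair_rot c s p q z i * v i) = (\<Sum>i\<in>S. z i * pair_rot c (- s) p q v i)"
proof -
  have split: "(\<Sum>i\<in>S. f i) = f p + f q + (\<Sum>i\<in>S - {p, q}. f i)" for f :: "'a \<Rightarrow> real"
  proof -
    have "S = insert p (insert q (S - {p, q}))" using assms by auto
    then have "(\<Sum>i\<in>S. f i) = (\<Sum>i\<in>insert p (insert q (S - {p, q})). f i)" by simp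
    also have "\<dots> = f p + f q + (\<Sum>i\<in>S - {p, q}. f i)"
      using assms by (simp add: add.assoc)
    finally show ?thesis .
  qed
  have "(\<Sum>i\<in>S - {p, q}. pair_rot c s p q z i * v i) = (\<Sum>i\<in>S - {p, q}. z i * pair_rot c (- s) p q v i)"
    by (rule sum.cong) (auto simp: pair_rot_def)
  then show ?thesis
    unfolding split using assms(4) by (simp add: pair_rot_def algebra_simps)
qed

lemma pair_rot_inverse:
  assumes "c\<^sup>2 + s\<^sup>2 = 1" "p \<noteq> q"
  shows "pair_rot c (- s) p q (pair_rot c s p q v) = v"
proof -
  have cc: "c * c + s * s = 1" using assms by (simp add: power2_eq_square)
  have "c * (c * a - s * b) + s * (s * a + c * b) = a" "c * (s * a + c * b) - s * (c * a - s * b) = b" for a b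
  proof -
    have "c * (c * a - s * b) + s * (s * a + c * b) = (c * c + s * s) * a" by (simp add: algebra_simps)
    then show "c * (c * a - s * b) + s * (s * a + c * b) = a" using cc by simp
    have "c * (s * a + c * b) - s * (c * a - s * b) = (c * c + s * s) * b" by (simp add: algebra_simps)
    then show "c * (s * a + c * b) - s * (c * a - s * b) = b" using cc by simp
  qed
  then show ?thesis using assms(2) by (auto simp: pair_rot_def fun_eq_iff)
qed

text \<open>The antisymmetric part of Z does not contribute to the quadratic form. A conjugation can
  therefore be computed on Z itself, where rows and columns are rotated separately.\<close>

lemma bform_symmetrize: "bform S (symmetrize Z) v = sqrt 2 * bform S (\<lambda>i j. Z (i, j)) v"
proof -
  have "bform S (symmetrize Z) v = (\<Sum>i\<in>S. \<Sum>j\<in>S. Z (i, j) * v i * v j) / sqrt 2 + (\<Sum>i\<in>S. \<Sum>j\<in>S. Z (j, i) * v i * v j) / sqrt 2"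
    unfolding bform_def symmetrize_def
    by (simp add: add_divide_distrib distrib_right sum.distrib sum_divide_distrib)
  also have "(\<Sum>i\<in>S. \<Sum>j\<in>S. Z (j, i) * v i * v j) = (\<Sum>i\<in>S. \<Sum>j\<in>S. Z (i, j) * v i * v j)"
    by (subst sum.swap) (simp add: mult_ac)
  also have "x / sqrt 2 + x / sqrt 2 = sqrt 2 * x" for x :: real
    by (simp add: field_simps)
  finally show ?thesis by (simp add: bform_def)
qed

text \<open>Conjugating a full Gaussian matrix by a rotation in the coordinates \<open>p\<close>, \<open>q\<close> rotates first the rows and
  then the columns, each of which only mixes pairs of entries.\<close>

lemma emeasure_dominated_rotate:
  assumes \<sigma>: "\<sigma> > 0" and S: "finite S" and pq: "p \<in> S" "q \<in> S" "p \<noteq> q"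
    and cs: "c\<^sup>2 + s\<^sup>2 = 1" "c \<noteq> -1"
  shows "emeasure (gprod \<sigma> (S \<times> S)) {Z \<in> space (gprod \<sigma> (S \<times> S)). dominated t S (symmetrize Z) y}
       = emeasure (gprod \<sigma> (S \<times> S)) {Z \<in> space (gprod \<sigma> (S \<times> S)). dominated t S (symmetrize Z) (pair_rot c (- s) p q y)}"
proof -
  let ?r = "\<lambda>(i, k). (Transposition.transpose p q i, k)" and ?l = "\<lambda>(k, i). (k, Transposition.transpose p q i)"
  let ?F = "involution_rot c s ?r ({p} \<times> S)" and ?G = "involution_rot c s ?l (S \<times> {p})"
  let ?M = "gprod \<sigma> (S \<times> S)"
  have tau: "?r (?r x) = x" "?l (?l x) = x" for x by (cases x; simp)+
  have sub: "{p} \<times> S \<subseteq> S \<times> S" "S \<times> {p} \<subseteq> S \<times> S"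
    "?r ` ({p} \<times> S) \<subseteq> S \<times> S" "?l ` (S \<times> {p}) \<subseteq> S \<times> S"
    "({p} \<times> S) \<inter> ?r ` ({p} \<times> S) = {}" "(S \<times> {p}) \<inter> ?l ` (S \<times> {p}) = {}"
    using pq by auto
  have fin: "finite (S \<times> S)" "finite ({p} \<times> S)" "finite (S \<times> {p})" using S by auto
  note F = distr_involution_rot[OF \<sigma> fin(1) cs tau(1) fin(2) sub(1,3,5), THEN conjunct1]
    distr_involution_rot[OF \<sigma> fin(1) cs tau(1) fin(2) sub(1,3,5), THEN conjunct2]
  note G = distr_involution_rot[OF \<sigma> fin(1) cs tau(2) fin(3) sub(2,4,6), THEN conjunct1]
    distr_involution_rot[OF \<sigma> fin(1) cs tau(2) fin(3) sub(2,4,6), THEN conjunct2]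
  have GF: "distr ?M ?M (?G \<circ> ?F) = ?M"
    using distr_distr[OF G(1) F(1)] F(2) G(2) by simp
  have F_eq: "?F Z (i, k) = pair_rot c s p q (\<lambda>i. Z (i, k)) i" if "i \<in> S" "k \<in> S" for Z i k
    using that pq by (auto simp: involution_rot_def pair_rot_def Transposition.transpose_def)
  have G_eq: "?G Z (k, i) = pair_rot c s p q (\<lambda>i. Z (k, i)) i" if "i \<in> S" "k \<in> S" for Z i k
    using that pq by (auto simp: involution_rot_def pair_rot_def Transposition.transpose_def)
  let ?U = "pair_rot c (- s) p q"
  have adj: "(\<Sum>i\<in>S. pair_rot c s p q z i * v i) = (\<Sum>i\<in>S. z i * ?U v i)" for z v
    by (rule sum_pair_rot_adjoint[OF S pq])
  \<comment> \<open>Moving the column rotation and then the row rotation to the other side of the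
    inner product leaves the inverse rotation on both arguments of the form.\<close>
  have form: "bform S (\<lambda>i j. (?G \<circ> ?F) Z (i, j)) v = bform S (\<lambda>i j. Z (i, j)) (?U v)" for Z v
  proof -
    have "bform S (\<lambda>i j. (?G \<circ> ?F) Z (i, j)) v = (\<Sum>i\<in>S. v i * (\<Sum>j\<in>S. pair_rot c s p q (\<lambda>j. ?F Z (i, j)) j * v j))"
      unfolding bform_def sum_distrib_left o_def
      by (intro sum.cong refl) (subst G_eq, auto)
    also have "\<dots> = (\<Sum>i\<in>S. \<Sum>j\<in>S. pair_rot c s p q (\<lambda>i. Z (i, j)) i * v i * ?U v j)"
      unfolding adj sum_distrib_left
      by (intro sum.cong refl) (subst F_eq, auto)
    also have "\<dots> = (\<Sum>j\<in>S. (\<Sum>i\<in>S. pair_rot c s p q (\<lambda>i. Z (i, j)) i * v i) * ?U v j)"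
      unfolding sum_distrib_right by (rule sum.swap)
    also have "\<dots> = (\<Sum>j\<in>S. \<Sum>i\<in>S. Z (i, j) * ?U v i * ?U v j)"
      unfolding adj sum_distrib_right ..
    also have "\<dots> = bform S (\<lambda>i j. Z (i, j)) (?U v)"
      unfolding bform_def by (rule sum.swap)
    finally show ?thesis .
  qed
  have inv: "pair_rot c s p q (?U v) = v" "?U (pair_rot c s p q v) = v" for v
    using pair_rot_inverse[of c "- s" p q v] pair_rot_inverse[of c s p q v] cs pq by auto
  have inner: "(\<Sum>i\<in>S. ?U y i * ?U v i) = (\<Sum>i\<in>S. y i * v i)" for y v
    using adj[of "?U y" v] by (simp add: inv)
  have norm: "(\<Sum>i\<in>S. (?U v i)\<^sup>2) = (\<Sum>i\<in>S. (v i)\<^sup>2)" for v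
    using inner[of v v] by (simp add: power2_eq_square)
  \<comment> \<open>The rotation is a bijection of vectors, so a quantifier over its values is a
    quantifier over all vectors.\<close>
  have all: "(\<forall>v. Q (?U v)) \<longleftrightarrow> (\<forall>v. Q v)" for Q
    using inv(2) by metis
  have eq: "dominated t S (symmetrize ((?G \<circ> ?F) Z)) y = dominated t S (symmetrize Z) (?U y)" for Z
  proof -
    have "dominated t S (symmetrize ((?G \<circ> ?F) Z)) y \<longleftrightarrow>
       (\<forall>v. sqrt 2 * bform S (\<lambda>i j. Z (i, j)) (?U v) + (\<Sum>i\<in>S. ?U y i * ?U v i)\<^sup>2 \<le> t * (\<Sum>i\<in>S. (?U v i)\<^sup>2))"
      unfolding dominated_def bform_symmetrize form inner norm ..
    also have "\<dots> \<longleftrightarrow> dominated t S (symmetrize Z) (?U y)"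
      unfolding dominated_def bform_symmetrize by (rule all)
    finally show ?thesis .
  qed
  show ?thesis
    using emeasure_distr_vimage[OF measurable_comp[OF F(1) G(1)] GF sets_dominated_symmetrize[OF S, of \<sigma> t y]]
    unfolding eq .
qed

text \<open>Givens elimination: a rotation in the plane (m, q) moves the entry at q into the one at
  m, so the induction runs over the number of nonzero entries outside m.\<close>

lemma emeasure_dominated_norm:
  assumes \<sigma>: "\<sigma> > 0" and S: "finite S" and m: "m \<in> S"
  shows "emeasure (gprod \<sigma> (S \<times> S)) {Z \<in> space (gprod \<sigma> (S \<times> S)). dominated t S (symmetrize Z) y}
       = emeasure (gprod \<sigma> (S \<times> S)) {Z \<in> space (gprod \<sigma> (S \<times> S)).
           dominated t S (symmetrize Z) (\<lambda>i. if i = m then sqrt (\<Sum>i\<in>S. (y i)\<^sup>2) else 0)}"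
proof (induction "card {i \<in> S - {m}. y i \<noteq> 0}" arbitrary: y)
  case 0
  then have y0: "\<forall>i\<in>S - {m}. y i = 0" using S by auto
  have "(\<Sum>i\<in>S. (y i)\<^sup>2) = (y m)\<^sup>2 + (\<Sum>i\<in>S - {m}. (y i)\<^sup>2)" using S m by (rule sum.remove)
  \<comment> \<open>Only the square of the scalar product with y occurs, so the sign of y m is
    irrelevant.\<close>
  then have n: "sqrt (\<Sum>i\<in>S. (y i)\<^sup>2) = \<bar>y m\<bar>" using y0 by simp
  have "(\<Sum>i\<in>S. y i * v i) = y m * v m" for v
    using sum.remove[OF S m, of "\<lambda>i. y i * v i"] y0 by simp
  moreover have "(\<Sum>i\<in>S. (if i = m then sqrt (\<Sum>i\<in>S. (y i)\<^sup>2) else 0) * v i) = \<bar>y m\<bar> * v m" for v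
    using sum.remove[OF S m, of "\<lambda>i. (if i = m then sqrt (\<Sum>i\<in>S. (y i)\<^sup>2) else 0) * v i"] n by simp
  ultimately have "dominated t S B y = dominated t S B (\<lambda>i. if i = m then sqrt (\<Sum>i\<in>S. (y i)\<^sup>2) else 0)" for B
    unfolding dominated_def by (simp add: power_mult_distrib)
  then show ?case by simp
next
  case (Suc k)
  let ?N = "\<lambda>y. {i \<in> S - {m}. y i \<noteq> 0}"
  have fin: "finite (?N y)" using S by auto
  have "?N y \<noteq> {}" using Suc(2) by (metis card.empty nat.distinct(1))
  then obtain q where q: "q \<in> ?N y" by blast
  then have qm: "q \<in> S" "m \<noteq> q" "y q \<noteq> 0" by auto
  define r where "r = sqrt ((y m)\<^sup>2 + (y q)\<^sup>2)"
  have r: "r > 0" using qm by (simp add: r_def sum_power2_gt_zero_iff)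
  have r2: "r\<^sup>2 = (y m)\<^sup>2 + (y q)\<^sup>2" by (simp add: r_def)
  define c s where "c = y m / r" and "s = y q / r"
  have cs: "c\<^sup>2 + s\<^sup>2 = 1"
    unfolding c_def s_def power_divide add_divide_distrib[symmetric] r2[symmetric] using r by simp
  \<comment> \<open>As y q is nonzero, the angle is not \<pi>, the one that the shear factorisation
    excludes.\<close>
  have "s \<noteq> 0" using r qm by (simp add: s_def)
  then have c1: "c \<noteq> -1" using cs by auto
  let ?y = "pair_rot c (- s) m q y"
  have yq: "?y q = 0" using r by (simp add: pair_rot_def c_def s_def)
  have "?N ?y = ?N y - {q}"
    using yq qm by (auto simp: pair_rot_def)
  then have "card (?N ?y) = k" using Suc(2) q fin by simp
  note IH = Suc(1)[OF this[symmetric]]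
  have "(\<Sum>i\<in>S. ?y i * ?y i) = (\<Sum>i\<in>S. y i * y i)"
    using sum_pair_rot_adjoint[OF S m qm(1,2), of c "-s" y ?y] pair_rot_inverse[of c "- s" m q y] cs qm by simp
  then have norm: "(\<Sum>i\<in>S. (?y i)\<^sup>2) = (\<Sum>i\<in>S. (y i)\<^sup>2)" by (simp add: power2_eq_square)
  show ?case
    using IH[unfolded norm] emeasure_dominated_rotate[OF \<sigma> S m qm(1,2) cs c1, of t y] by simp
qed

lemma emeasure_dominated_wigner_norm:
  assumes "\<sigma> > 0" "finite S" "m \<in> S"
  shows "emeasure (gprod \<sigma> (upper_tri S)) {Y \<in> space (gprod \<sigma> (upper_tri S)). dominated t S (wigner_entry Y) y}
       = emeasure (gprod \<sigma> (upper_tri S)) {Y \<in> space (gprod \<sigma> (upper_tri S)).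
           dominated t S (wigner_entry Y) (\<lambda>i. if i = m then sqrt (\<Sum>i\<in>S. (y i)\<^sup>2) else 0)}"
  unfolding emeasure_wigner_symmetrize[OF assms(1,2)] by (rule emeasure_dominated_norm[OF assms])

section \<open>Reduction to a Markov chain\<close>

lemma bform_insert:
  assumes S: "finite S" "m \<notin> S" and sym: "\<And>j. j \<in> S \<Longrightarrow> B j m = B m j"
  shows "bform (insert m S) B v = B m m * (v m)\<^sup>2 + 2 * v m * (\<Sum>j\<in>S. B m j * v j) + bform S B v"
proof -
  have "bform (insert m S) B v = (B m m * v m * v m + (\<Sum>j\<in>S. B m j * v m * v j))
      + ((\<Sum>i\<in>S. B i m * v i * v m) + bform S B v)"
    unfolding bform_def using S by (simp add: sum.distrib)
  also have "(\<Sum>i\<in>S. B i m * v i * v m) = v m * (\<Sum>j\<in>S. B m j * v j)"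
    by (simp add: sum_distrib_left sym mult_ac cong: sum.cong)
  also have "(\<Sum>j\<in>S. B m j * v m * v j) = v m * (\<Sum>j\<in>S. B m j * v j)"
    by (simp add: sum_distrib_left mult_ac)
  finally show ?thesis by (simp add: power2_eq_square)
qed

text \<open>Completing the square in the coordinate \<open>m\<close> (Schur complement).\<close>

lemma dominated_insert_iff:
  assumes S: "finite S" "m \<notin> S" and sym: "\<And>j. j \<in> S \<Longrightarrow> B j m = B m j" and d: "d \<ge> 0"
    and c: "c = t - B m m - d" "c \<noteq> 0"
  shows "dominated t (insert m S) B (\<lambda>i. if i = m then sqrt d else 0) \<longleftrightarrow>
    c > 0 \<and> dominated t S B (\<lambda>j. B m j / sqrt c)"
proof -
  let ?s = "\<lambda>v. \<Sum>j\<in>S. B m j * v j"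
  let ?q = "\<lambda>v. t * (\<Sum>j\<in>S. (v j)\<^sup>2) - bform S B v"
  have *: "(\<Sum>i\<in>insert m S. (if i = m then sqrt d else 0) * v i) = sqrt d * v m" for v
  proof -
    have "(\<Sum>i\<in>S. (if i = m then sqrt d else 0) * v i) = 0"
      using S(2) by (intro sum.neutral) auto
    then show ?thesis using S by simp
  qed
  have lhs: "dominated t (insert m S) B (\<lambda>i. if i = m then sqrt d else 0) \<longleftrightarrow>
      (\<forall>v. 0 \<le> c * (v m)\<^sup>2 - 2 * v m * ?s v + ?q v)"
  proof -
    have "bform (insert m S) B v + (sqrt d * v m)\<^sup>2 \<le> t * (\<Sum>i\<in>insert m S. (v i)\<^sup>2) \<longleftrightarrow>
        0 \<le> c * (v m)\<^sup>2 - 2 * v m * ?s v + ?q v" for v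
    proof -
      have b: "bform (insert m S) B v = B m m * (v m)\<^sup>2 + 2 * v m * ?s v + bform S B v"
        by (rule bform_insert) (use S sym in auto)
      have s: "(\<Sum>i\<in>insert m S. (v i)\<^sup>2) = (v m)\<^sup>2 + (\<Sum>i\<in>S. (v i)\<^sup>2)" using S by simp
      show ?thesis unfolding b s c(1) using d by (simp add: power_mult_distrib algebra_simps)
    qed
    with * show ?thesis unfolding dominated_def by simp
  qed
  have rhs: "dominated t S B (\<lambda>j. B m j / sqrt c) \<longleftrightarrow> (\<forall>v. (?s v)\<^sup>2 / c \<le> ?q v)" if "c > 0"
  proof -
    have "(\<Sum>j\<in>S. B m j / sqrt c * v j)\<^sup>2 = (?s v)\<^sup>2 / c" for v
    proof -
      have "(\<Sum>j\<in>S. B m j / sqrt c * v j) = ?s v / sqrt c" by (simp add: sum_divide_distrib)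
      then show ?thesis using that by (simp add: power_divide)
    qed
    then show ?thesis unfolding dominated_def by (simp add: algebra_simps)
  qed
  show ?thesis
  proof
    assume "dominated t (insert m S) B (\<lambda>i. if i = m then sqrt d else 0)"
    then have *: "0 \<le> c * (v m)\<^sup>2 - 2 * v m * ?s v + ?q v" for v using lhs by blast
    have "0 \<le> c"
    proof -
      have "?s (\<lambda>i. if i = m then 1 else 0) = 0" "(\<Sum>j\<in>S. (if j = m then 1 else 0 :: real)\<^sup>2) = 0"
        "bform S B (\<lambda>i. if i = m then 1 else 0) = 0"
        using S(2) by (auto intro!: sum.neutral simp: bform_def)
      then show ?thesis using *[of "\<lambda>i. if i = m then 1 else 0"] by simp
    qed
    then have c0: "c > 0" using c by simp
    have "(?s v)\<^sup>2 / c \<le> ?q v" for v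
    proof -
      \<comment> \<open>The minimiser of the quadratic polynomial in the coordinate m; inserting it
        produces the Schur complement.\<close>
      let ?u = "v(m := ?s v / c)"
      have "?s ?u = ?s v" "(\<Sum>j\<in>S. (?u j)\<^sup>2) = (\<Sum>j\<in>S. (v j)\<^sup>2)" "bform S B ?u = bform S B v"
        using S(2) unfolding bform_def by (auto intro!: sum.cong)
      then have "0 \<le> c * (?s v / c)\<^sup>2 - 2 * (?s v / c) * ?s v + ?q v" using *[of ?u] by simp
      also have "c * (?s v / c)\<^sup>2 - 2 * (?s v / c) * ?s v = - ((?s v)\<^sup>2 / c)"
        using c0 by (simp add: field_simps power2_eq_square)
      finally show ?thesis by simp
    qed
    then show "c > 0 \<and> dominated t S B (\<lambda>j. B m j / sqrt c)" using c0 rhs by blast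
  next
    assume a: "c > 0 \<and> dominated t S B (\<lambda>j. B m j / sqrt c)"
    then have c0: "c > 0" and *: "(?s v)\<^sup>2 / c \<le> ?q v" for v using rhs by auto
    have "0 \<le> c * (v m)\<^sup>2 - 2 * v m * ?s v + ?q v" for v
    proof -
      have "0 \<le> (c * v m - ?s v)\<^sup>2 / c" using c0 by simp
      also have "\<dots> = c * (v m)\<^sup>2 - 2 * v m * ?s v + (?s v)\<^sup>2 / c"
        using c0 by (simp add: field_simps power2_eq_square)
      finally show ?thesis using *[of v] by simp
    qed
    then show "dominated t (insert m S) B (\<lambda>i. if i = m then sqrt d else 0)" using lhs by blast
  qed
qed

text \<open>\<open>d\<close> is the squared norm of the current rank-one perturbation; eliminating row \<open>m\<close> replaces it by
  the squared norm of the rest of that row over the pivot \<open>c\<close>.\<close>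

primrec chain :: "real \<Rightarrow> nat \<Rightarrow> (nat \<times> nat \<Rightarrow> real) \<Rightarrow> nat \<Rightarrow> real \<Rightarrow> bool" where
  "chain t N Y 0 d \<longleftrightarrow> True"
| "chain t N Y (Suc k) d \<longleftrightarrow> (let m = N - Suc k; c = t - sqrt 2 * Y (m, m) - d in
     c > 0 \<and> chain t N Y k ((\<Sum>j\<in>{Suc m..<N}. (Y (m, j))\<^sup>2) / c))"

text \<open>The starting value is a function of the sample point because each step of the recursion
  passes on a random value.\<close>

lemma pred_chain:
  assumes "k \<le> N" "\<And>i j. N - k \<le> i \<Longrightarrow> i \<le> j \<Longrightarrow> j < N \<Longrightarrow> (\<lambda>w. Y w (i, j)) \<in> borel_measurable M"
    and "f \<in> borel_measurable M"
  shows "{w \<in> space M. chain t N (Y w) k (f w)} \<in> sets M"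
  using assms
proof (induction k arbitrary: f)
  case (Suc k)
  define m where "m = N - Suc k"
  have m: "m < N" "N - k = Suc m" using Suc.prems(1) by (auto simp: m_def)
  have Y: "(\<lambda>w. Y w (m, j)) \<in> borel_measurable M" if "m \<le> j" "j < N" for j
    using Suc.prems(2)[of m j] that by (simp add: m_def)
  have [measurable]: "(\<lambda>w. Y w (m, m)) \<in> borel_measurable M" using Y m by simp
  note [measurable] = Suc.prems(3)
  have [measurable]: "(\<lambda>w. \<Sum>j\<in>{Suc m..<N}. (Y w (m, j))\<^sup>2) \<in> borel_measurable M"
    by (intro borel_measurable_sum borel_measurable_power Y) auto
  have b: "{w \<in> space M. chain t N (Y w) k ((\<Sum>j\<in>{Suc m..<N}. (Y w (m, j))\<^sup>2) / (t - sqrt 2 * Y w (m, m) - f w))} \<in> sets M"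
    by (rule Suc.IH) (use Suc.prems(1) Suc.prems(2) in auto)
  have a: "{w \<in> space M. 0 < t - sqrt 2 * Y w (m, m) - f w} \<in> sets M" by measurable
  show ?case
    unfolding chain.simps Let_def m_def[symmetric] by (rule sets.sets_Collect_conj[OF b a])
qed simp

lemma chain_cong:
  assumes "k \<le> N" "\<And>i j. N - k \<le> i \<Longrightarrow> i \<le> j \<Longrightarrow> j < N \<Longrightarrow> Y (i, j) = Y' (i, j)"
  shows "chain t N Y k d = chain t N Y' k d"
  using assms
proof (induction k arbitrary: d)
  case (Suc k)
  define m where "m = N - Suc k"
  have m: "m < N" using Suc.prems(1) by (auto simp: m_def)
  have Y: "Y (m, j) = Y' (m, j)" if "m \<le> j" "j < N" for j
    using Suc.prems(2)[of m j] that by (simp add: m_def)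
  have IH: "chain t N Y k d = chain t N Y' k d" for d
    by (rule Suc.IH) (use Suc.prems in auto)
  have "(\<Sum>j\<in>{Suc m..<N}. (Y (m, j))\<^sup>2) = (\<Sum>j\<in>{Suc m..<N}. (Y' (m, j))\<^sup>2)"
    by (rule sum.cong) (auto simp: Y)
  then show ?case
    unfolding chain.simps Let_def m_def[symmetric] using m by (simp add: Y IH)
qed simp

lemma emeasure_gprod_fold:
  fixes I J :: "'i set"
  assumes \<sigma>: "\<sigma> > 0" and IJ: "I \<inter> J = {}" "finite I" "finite J"
    and P: "{w \<in> space (gprod \<sigma> (I \<union> J)). P w} \<in> sets (gprod \<sigma> (I \<union> J))"
  shows "emeasure (gprod \<sigma> (I \<union> J)) {w \<in> space (gprod \<sigma> (I \<union> J)). P w}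
    = (\<integral>\<^sup>+x. emeasure (gprod \<sigma> J) {y \<in> space (gprod \<sigma> J). P (merge I J (x, y))} \<partial>gprod \<sigma> I)"
proof -
  interpret g: prob_space "gauss \<sigma>" by (rule prob_space_normal_density[OF \<sigma>])
  interpret product_sigma_finite "\<lambda>_::'i. gauss \<sigma>" by standard
  let ?A = "{w \<in> space (gprod \<sigma> (I \<union> J)). P w}"
  have "emeasure (gprod \<sigma> (I \<union> J)) ?A = (\<integral>\<^sup>+w. indicator ?A w \<partial>gprod \<sigma> (I \<union> J))"
    using P by simp
  also have "\<dots> = (\<integral>\<^sup>+x. (\<integral>\<^sup>+y. indicator ?A (merge I J (x, y)) \<partial>gprod \<sigma> J) \<partial>gprod \<sigma> I)"
    by (rule product_nn_integral_fold[OF IJ]) (use P in simp)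
  also have "\<dots> = (\<integral>\<^sup>+x. emeasure (gprod \<sigma> J) {y \<in> space (gprod \<sigma> J). P (merge I J (x, y))} \<partial>gprod \<sigma> I)"
  proof (rule nn_integral_cong)
    fix x assume x: "x \<in> space (gprod \<sigma> I)"
    have mg: "(\<lambda>y. merge I J (x, y)) \<in> measurable (gprod \<sigma> J) (gprod \<sigma> (I \<union> J))"
      by (rule measurable_compose[OF measurable_Pair1'[OF x] measurable_merge])
    have "{y \<in> space (gprod \<sigma> J). P (merge I J (x, y))} = (\<lambda>y. merge I J (x, y)) -` ?A \<inter> space (gprod \<sigma> J)"
      using measurable_space[OF mg] by auto
    then have "{y \<in> space (gprod \<sigma> J). P (merge I J (x, y))} \<in> sets (gprod \<sigma> J)"
      using measurable_sets[OF mg P] by simp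
    then have "emeasure (gprod \<sigma> J) {y \<in> space (gprod \<sigma> J). P (merge I J (x, y))}
       = (\<integral>\<^sup>+y. indicator {y \<in> space (gprod \<sigma> J). P (merge I J (x, y))} y \<partial>gprod \<sigma> J)" by simp
    also have "\<dots> = (\<integral>\<^sup>+y. indicator ?A (merge I J (x, y)) \<partial>gprod \<sigma> J)"
      using measurable_space[OF mg] by (intro nn_integral_cong) (auto simp: indicator_def)
    finally show "(\<integral>\<^sup>+y. indicator ?A (merge I J (x, y)) \<partial>gprod \<sigma> J)
       = emeasure (gprod \<sigma> J) {y \<in> space (gprod \<sigma> J). P (merge I J (x, y))}" by simp
  qed
  finally show ?thesis .
qed

text \<open>Makes the vanishing pivot, which \<open>dominated_insert_iff\<close> excludes, a null
  event.\<close>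

lemma AE_gprod_neq:
  assumes \<sigma>: "\<sigma> > 0" and I: "i \<in> I"
  shows "AE w in gprod \<sigma> I. w i \<noteq> a"
proof -
  interpret g: prob_space "gauss \<sigma>" by (rule prob_space_normal_density[OF \<sigma>])
  have "AE x in lborel. x \<noteq> a" by (rule AE_lborel_singleton)
  then have "AE x in gauss \<sigma>. x \<noteq> a" by (subst AE_density) auto
  then show ?thesis
    using AE_PiM_component[of I "\<lambda>_. gauss \<sigma>" i "\<lambda>x. x \<noteq> a"] I g.prob_space_axioms by simp
qed

text \<open>Peeling off one row at a time, the residual rank-one perturbation has, by rotation invariance, only its
  norm as a relevant parameter; this is the Householder tridiagonalisation in disguise.\<close>

lemma emeasure_dominated_eq_chain:
  assumes \<sigma>: "\<sigma> > 0" and "k \<le> N"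
  shows "emeasure (gprod \<sigma> (upper_tri {N - k..<N}))
           {Y \<in> space (gprod \<sigma> (upper_tri {N - k..<N})). dominated t {N - k..<N} (wigner_entry Y) y}
       = emeasure (gprod \<sigma> (upper_tri {N - k..<N}))
           {Y \<in> space (gprod \<sigma> (upper_tri {N - k..<N})). chain t N Y k (\<Sum>i\<in>{N - k..<N}. (y i)\<^sup>2)}"
  using assms(2)
proof (induction k arbitrary: y)
  case 0
  then show ?case by (simp add: dominated_def bform_def)
next
  case (Suc k)
  define m S d where "m = N - Suc k" and "S = {Suc m..<N}" and "d = (\<Sum>i\<in>{m..<N}. (y i)\<^sup>2)"
  have m: "m < N" "N - k = Suc m" using Suc.prems by (auto simp: m_def)
  have S: "{m..<N} = insert m S" "finite S" "m \<notin> S" using m by (auto simp: S_def)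
  have d0: "d \<ge> 0" by (simp add: d_def sum_nonneg)
  define R where "R = {m} \<times> {m..<N}"
  have U: "upper_tri {m..<N} = R \<union> upper_tri S" "R \<inter> upper_tri S = {}" "finite R"
    using m by (auto simp: upper_tri_def R_def S_def)
  have finU: "finite (upper_tri S)" using S by simp
  let ?y = "\<lambda>i. if i = m then sqrt d else 0"
  have "emeasure (gprod \<sigma> (upper_tri {m..<N})) {Y \<in> space (gprod \<sigma> (upper_tri {m..<N})). dominated t {m..<N} (wigner_entry Y) y}
      = emeasure (gprod \<sigma> (upper_tri {m..<N})) {Y \<in> space (gprod \<sigma> (upper_tri {m..<N})). dominated t {m..<N} (wigner_entry Y) ?y}"
    unfolding d_def by (rule emeasure_dominated_wigner_norm[OF \<sigma>]) (use m in auto)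
  also have "\<dots> = (\<integral>\<^sup>+x. emeasure (gprod \<sigma> (upper_tri S)) {Y \<in> space (gprod \<sigma> (upper_tri S)).
       dominated t {m..<N} (wigner_entry (merge R (upper_tri S) (x, Y))) ?y} \<partial>gprod \<sigma> R)"
    unfolding U(1)
    by (rule emeasure_gprod_fold[OF \<sigma> U(2,3) finU])
       (use sets_dominated_wigner[of "{m..<N}" \<sigma> t ?y] in \<open>simp add: U(1)\<close>)
  also have "\<dots> = (\<integral>\<^sup>+x. emeasure (gprod \<sigma> (upper_tri S)) {Y \<in> space (gprod \<sigma> (upper_tri S)).
       chain t N (merge R (upper_tri S) (x, Y)) (Suc k) d} \<partial>gprod \<sigma> R)"
  proof (rule nn_integral_cong_AE)
    have "AE x in gprod \<sigma> R. x (m, m) \<noteq> (t - d) / sqrt 2"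
      by (rule AE_gprod_neq[OF \<sigma>]) (use m in \<open>auto simp: R_def\<close>)
    then show "AE x in gprod \<sigma> R. emeasure (gprod \<sigma> (upper_tri S)) {Y \<in> space (gprod \<sigma> (upper_tri S)).
         dominated t {m..<N} (wigner_entry (merge R (upper_tri S) (x, Y))) ?y}
       = emeasure (gprod \<sigma> (upper_tri S)) {Y \<in> space (gprod \<sigma> (upper_tri S)).
         chain t N (merge R (upper_tri S) (x, Y)) (Suc k) d}"
    proof eventually_elim
      case (elim x)
      define c where "c = t - sqrt 2 * x (m, m) - d"
      have c: "c \<noteq> 0" using elim by (auto simp: c_def field_simps)
      have ent: "wigner_entry (merge R (upper_tri S) (x, Y)) m m = sqrt 2 * x (m, m)"
        "j \<in> S \<Longrightarrow> wigner_entry (merge R (upper_tri S) (x, Y)) m j = x (m, j)"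
        "j \<in> S \<Longrightarrow> wigner_entry (merge R (upper_tri S) (x, Y)) j m = x (m, j)"
        "i \<in> S \<Longrightarrow> j \<in> S \<Longrightarrow> wigner_entry (merge R (upper_tri S) (x, Y)) i j = wigner_entry Y i j" for Y i j
        using m by (auto simp: wigner_entry_def merge_def R_def S_def upper_tri_def min_def max_def)
      have dom: "dominated t {m..<N} (wigner_entry (merge R (upper_tri S) (x, Y))) ?y \<longleftrightarrow>
          c > 0 \<and> dominated t S (wigner_entry Y) (\<lambda>j. x (m, j) / sqrt c)" for Y
      proof -
        let ?B = "wigner_entry (merge R (upper_tri S) (x, Y))"
        have "dominated t (insert m S) ?B ?y \<longleftrightarrow> c > 0 \<and> dominated t S ?B (\<lambda>j. ?B m j / sqrt c)"
          by (rule dominated_insert_iff[OF S(2,3) _ d0 _ c]) (simp_all add: ent c_def)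
        also have "dominated t S ?B (\<lambda>j. ?B m j / sqrt c) = dominated t S (wigner_entry Y) (\<lambda>j. x (m, j) / sqrt c)"
          by (rule dominated_cong) (simp_all add: ent)
        finally show ?thesis unfolding S(1) .
      qed
      have ch: "chain t N (merge R (upper_tri S) (x, Y)) (Suc k) d \<longleftrightarrow>
          c > 0 \<and> chain t N Y k (\<Sum>j\<in>S. (x (m, j) / sqrt c)\<^sup>2)" for Y
      proof -
        let ?Z = "merge R (upper_tri S) (x, Y)"
        have z: "?Z (m, j) = x (m, j)" if "m \<le> j" "j < N" for j
          using that by (auto simp: merge_def R_def)
        have "chain t N ?Z (Suc k) d \<longleftrightarrow> c > 0 \<and> chain t N ?Z k ((\<Sum>j\<in>S. (?Z (m, j))\<^sup>2) / c)"
          using z[of m] m by (simp only: chain.simps Let_def m_def[symmetric] c_def S_def order_refl)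
        also have "(\<Sum>j\<in>S. (?Z (m, j))\<^sup>2) = (\<Sum>j\<in>S. (x (m, j))\<^sup>2)"
          by (intro sum.cong refl) (subst z, auto simp: S_def)
        also have "chain t N ?Z k ((\<Sum>j\<in>S. (x (m, j))\<^sup>2) / c) = chain t N Y k ((\<Sum>j\<in>S. (x (m, j))\<^sup>2) / c)"
          by (rule chain_cong) (use Suc.prems m in \<open>auto simp: merge_def R_def upper_tri_def S_def\<close>)
        also have "(c > 0 \<and> chain t N Y k ((\<Sum>j\<in>S. (x (m, j))\<^sup>2) / c)) \<longleftrightarrow>
            (c > 0 \<and> chain t N Y k (\<Sum>j\<in>S. (x (m, j) / sqrt c)\<^sup>2))"
          by (auto simp: power_divide sum_divide_distrib)
        finally show ?thesis .
      qed
      \<comment> \<open>With row m fixed, the vector that perturbs the minor is deterministic while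
        the minor keeps its law; this is why the induction hypothesis must hold for arbitrary
        vectors.\<close>
      have "emeasure (gprod \<sigma> (upper_tri S)) {Y \<in> space (gprod \<sigma> (upper_tri S)). dominated t S (wigner_entry Y) (\<lambda>j. x (m, j) / sqrt c)}
          = emeasure (gprod \<sigma> (upper_tri S)) {Y \<in> space (gprod \<sigma> (upper_tri S)). chain t N Y k (\<Sum>j\<in>S. (x (m, j) / sqrt c)\<^sup>2)}"
        using Suc.IH[of "\<lambda>j. x (m, j) / sqrt c"] Suc.prems unfolding m(2) S_def by simp
      then show ?case unfolding dom ch by (cases "c > 0") simp_all
    qed
  qed
  also have "\<dots> = emeasure (gprod \<sigma> (R \<union> upper_tri S)) {Y \<in> space (gprod \<sigma> (R \<union> upper_tri S)). chain t N Y (Suc k) d}"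
  proof (rule emeasure_gprod_fold[OF \<sigma> U(2,3) finU, symmetric])
    show "{Y \<in> space (gprod \<sigma> (R \<union> upper_tri S)). chain t N Y (Suc k) d} \<in> sets (gprod \<sigma> (R \<union> upper_tri S))"
      unfolding U(1)[symmetric]
      by (rule pred_chain) (use Suc.prems in \<open>auto intro!: measurable_gprod_component simp: upper_tri_def m_def\<close>)
  qed
  finally show ?case unfolding m_def[symmetric] U(1)[symmetric] d_def .
qed

section \<open>Linearisation of the continued fraction\<close>

abbreviation entry_sq_sum :: "nat \<Rightarrow> (nat \<times> nat \<Rightarrow> real) \<Rightarrow> nat \<Rightarrow> real" where
  "entry_sq_sum N Y m \<equiv> \<Sum>j\<in>{Suc m..<N}. (Y (m, j))\<^sup>2"

text \<open>The value \<open>1\<close> at \<open>0\<close> is irrelevant: it is only divided into the empty sum.\<close>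

primrec threshold :: "real \<Rightarrow> nat \<Rightarrow> (nat \<times> nat \<Rightarrow> real) \<Rightarrow> nat \<Rightarrow> real" where
  "threshold t N Y 0 = 1"
| "threshold t N Y (Suc k) = t - sqrt 2 * Y (N - Suc k, N - Suc k) - entry_sq_sum N Y (N - Suc k) / threshold t N Y k"

text \<open>Exchanges the pivot with the bound on the next state, which turns the forward recursion
  for the state into a backward recursion for its threshold. Since b / T is nonnegative, the
  inequality on the right already forces a positive pivot.\<close>

lemma divide_less_swap:
  fixes b c T :: real
  assumes "b \<ge> 0" "T > 0"
  shows "c > 0 \<and> b / c < T \<longleftrightarrow> b / T < c"
proof
  assume "c > 0 \<and> b / c < T"
  then have "b < T * c" using pos_divide_less_eq[of c b T] by blast
  then show "b / T < c" using assms by (simp add: pos_divide_less_eq mult.commute)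
next
  assume *: "b / T < c"
  moreover have "0 \<le> b / T" using assms by simp
  ultimately have "c > 0" by linarith
  moreover have "b < T * c" using * assms by (simp add: pos_divide_less_eq mult.commute)
  ultimately show "c > 0 \<and> b / c < T" by (simp add: pos_divide_less_eq)
qed

text \<open>As long as the pivot is positive, a step is increasing in d, so the surviving starting
  values form a half-line; solving for d moves its end point back through one more row.\<close>

lemma chain_iff_less_threshold:
  assumes "k < N" "\<And>i. 0 < i \<Longrightarrow> i \<le> k \<Longrightarrow> threshold t N Y i > 0"
  shows "chain t N Y (Suc k) d \<longleftrightarrow> d < threshold t N Y (Suc k)"
  using assms
proof (induction k arbitrary: d)
  case 0
  then show ?case by (auto simp: Let_def)
next
  case (Suc k)
  define m where "m = N - Suc (Suc k)"
  let ?c = "t - sqrt 2 * Y (m, m) - d" and ?b = "entry_sq_sum N Y m" and ?T = "threshold t N Y (Suc k)"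
  have T: "?T > 0" using Suc.prems(2)[of "Suc k"] by simp
  have b: "?b \<ge> 0" by (intro sum_nonneg) auto
  have IH: "chain t N Y (Suc k) d' \<longleftrightarrow> d' < ?T" for d'
    by (rule Suc.IH) (use Suc.prems in auto)
  have "chain t N Y (Suc (Suc k)) d \<longleftrightarrow> ?c > 0 \<and> ?b / ?c < ?T"
    by (simp only: chain.simps(2)[of t N Y "Suc k"] Let_def m_def[symmetric] IH)
  also have "\<dots> \<longleftrightarrow> ?b / ?T < ?c" by (rule divide_less_swap[OF b T])
  also have "\<dots> \<longleftrightarrow> d < threshold t N Y (Suc (Suc k))"
    by (simp only: threshold.simps(2)[of t N Y "Suc k"] m_def[symmetric]) linarith
  finally show ?case .
qed

text \<open>The recursion increases with the previous threshold and decreases with the entries, and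
  the hypothesis on t says exactly that the worst case does not push s below itself: t - \<epsilon>
  - (s^2 + \<epsilon>) / s >= s. The start is harmless because the last row has an empty sum of
  squares.\<close>

lemma threshold_ge:
  assumes "k < N" and s: "s > 0"
    and a: "\<And>m. m < N \<Longrightarrow> sqrt 2 * Y (m, m) \<le> \<epsilon>"
    and b: "\<And>m. m < N \<Longrightarrow> entry_sq_sum N Y m \<le> s\<^sup>2 + \<epsilon>"
    and t: "2 * s + \<epsilon> + \<epsilon> / s \<le> t" and \<epsilon>: "\<epsilon> \<ge> 0"
  shows "s \<le> threshold t N Y (Suc k)"
  using assms(1)
proof (induction k)
  case 0
  have "sqrt 2 * Y (N - 1, N - 1) \<le> \<epsilon>" using a 0 by simp
  moreover have "s \<le> t - \<epsilon>"
    using t \<epsilon> s divide_nonneg_pos[OF \<epsilon> s] by linarith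
  ultimately show ?case using 0 by simp
next
  case (Suc k)
  define m where "m = N - Suc (Suc k)"
  have m: "m < N" using Suc.prems by (simp add: m_def)
  let ?T = "threshold t N Y (Suc k)"
  have T: "s \<le> ?T" using Suc by simp
  have "entry_sq_sum N Y m / ?T \<le> (s\<^sup>2 + \<epsilon>) / s"
    using b[OF m] T s \<epsilon> by (intro frac_le) (auto intro: add_nonneg_nonneg)
  also have "\<dots> = s + \<epsilon> / s" using s by (simp add: field_simps power2_eq_square)
  finally have "s \<le> t - sqrt 2 * Y (m, m) - entry_sq_sum N Y m / ?T"
    using a[OF m] t by linarith
  then show ?case by (simp only: threshold.simps(2)[of t N Y "Suc k"] m_def[symmetric])
qed

lemma contraction_bound:
  fixes x :: "nat \<Rightarrow> real"
  assumes step: "\<And>m. m < M \<Longrightarrow> \<bar>x m\<bar> \<le> c + q * \<bar>x (Suc m)\<bar>" and q: "0 \<le> q" "q < 1" and c: "c \<ge> 0"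
    and "m + k \<le> M"
  shows "\<bar>x m\<bar> \<le> c / (1 - q) + q ^ k * \<bar>x (m + k)\<bar>"
  using assms(5)
proof (induction k arbitrary: m)
  case 0
  then show ?case using c q by simp
next
  case (Suc k)
  have IH: "\<bar>x (Suc m)\<bar> \<le> c / (1 - q) + q ^ k * \<bar>x (Suc m + k)\<bar>" using Suc.IH[of "Suc m"] Suc.prems by simp
  have "\<bar>x m\<bar> \<le> c + q * \<bar>x (Suc m)\<bar>" using step[of m] Suc.prems by simp
  also have "\<dots> \<le> c + q * (c / (1 - q) + q ^ k * \<bar>x (Suc m + k)\<bar>)"
    using IH q by (intro add_left_mono mult_left_mono) auto
  also have "\<dots> = (c + q * (c / (1 - q))) + q ^ Suc k * \<bar>x (m + Suc k)\<bar>"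
    by (simp add: algebra_simps)
  also have "c + q * (c / (1 - q)) = c / (1 - q)" using q by (simp add: field_simps)
  finally show ?case .
qed

lemma linear_recursion_unroll:
  fixes x f :: "nat \<Rightarrow> real"
  assumes "\<And>m. m < L \<Longrightarrow> x m = f m + r * x (Suc m)"
  shows "x 0 = (\<Sum>m<L. r ^ m * f m) + r ^ L * x L"
  using assms by (induction L) (simp_all add: algebra_simps)

text \<open>Linearisation of \<open>D \<mapsto> t - a - b / D\<close> at its fixed point \<open>\<theta>\<close> (for \<open>t = \<rho>\<close>, \<open>a = 0\<close>,
  \<open>b = \<sigma>\<^sup>2\<close>), where the derivative is \<open>r = \<sigma>\<^sup>2 / \<theta>\<^sup>2 < 1\<close>.\<close>

lemma threshold_linearize:
  fixes D a b :: "nat \<Rightarrow> real"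
  assumes \<sigma>: "\<sigma> > 0" and \<theta>: "\<theta> > \<sigma>" and \<eta>: "0 \<le> \<eta>"
    and D: "\<And>m. m < 2 * L \<Longrightarrow> D m = t - a m - b m / D (Suc m)"
    and D_ge: "\<And>m. m \<le> 2 * L \<Longrightarrow> \<sigma> \<le> D m" and D_le: "D (2 * L) \<le> C"
    and a: "\<And>m. m < 2 * L \<Longrightarrow> \<bar>a m\<bar> \<le> \<eta>" and b: "\<And>m. m < 2 * L \<Longrightarrow> \<bar>b m - \<sigma>\<^sup>2\<bar> \<le> \<eta>"
    and t: "\<bar>t - rho \<sigma> \<theta>\<bar> \<le> \<eta>" and q: "(\<sigma>\<^sup>2 + \<eta>) / (\<theta> * \<sigma>) \<le> q" "q < 1"
    and \<delta>: "\<delta> = \<eta> * (2 + 1 / \<theta>) / (1 - q) + q ^ L * (C + \<theta>)"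
    and r: "r = \<sigma>\<^sup>2 / \<theta>\<^sup>2"
  shows "\<bar>D 0 - \<theta> - ((t - rho \<sigma> \<theta>) / (1 - r) - (\<Sum>m<L. r ^ m * (a m + (b m - \<sigma>\<^sup>2) / \<theta>)))\<bar>
    \<le> (\<eta> * \<theta> + \<sigma>\<^sup>2 * \<delta>) / (\<theta>\<^sup>2 * \<sigma>) * \<delta> / (1 - r) + r ^ L * (\<delta> + \<eta> / (1 - r))"
proof -
  have \<theta>0: "\<theta> > 0" using \<sigma> \<theta> by simp
  have r01: "0 < r" "r < 1" using \<sigma> \<theta> by (auto simp: r power_strict_mono)
  have "0 \<le> (\<sigma>\<^sup>2 + \<eta>) / (\<theta> * \<sigma>)" using \<sigma> \<theta>0 \<eta> by simp
  then have q0: "0 \<le> q" using q(1) by linarith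
  define x where "x m = D m - \<theta>" for m
  define \<xi> where "\<xi> m = a m + (b m - \<sigma>\<^sup>2) / \<theta>" for m
  \<comment> \<open>The coefficient is the exact secant slope of D -> - b m / D between \<theta> and
    D (Suc m). It is first bounded by q, to show that x is small, and then compared with the
    derivative r.\<close>
  have rec: "x m = (t - rho \<sigma> \<theta>) - \<xi> m + b m / (\<theta> * D (Suc m)) * x (Suc m)" if m: "m < 2 * L" for m
  proof -
    have d: "D (Suc m) > 0" using D_ge[of "Suc m"] m \<sigma> by simp
    have "b m / (\<theta> * D (Suc m)) * (D (Suc m) - \<theta>) = b m / \<theta> - b m / D (Suc m)"
      using d \<theta>0 by (simp add: field_simps)
    then show ?thesis
      unfolding x_def \<xi>_def D[OF m] rho_def by (simp add: diff_divide_distrib)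
  qed
  have coef: "\<bar>b m / (\<theta> * D (Suc m))\<bar> \<le> q" if m: "m < 2 * L" for m
  proof -
    have "\<bar>b m\<bar> \<le> \<bar>b m - \<sigma>\<^sup>2\<bar> + \<bar>\<sigma>\<^sup>2\<bar>" using abs_triangle_ineq[of "b m - \<sigma>\<^sup>2" "\<sigma>\<^sup>2"] by simp
    then have "\<bar>b m\<bar> \<le> \<sigma>\<^sup>2 + \<eta>" using b[OF m] by simp
    moreover have "\<theta> * \<sigma> \<le> \<theta> * D (Suc m)" using D_ge[of "Suc m"] m \<theta>0 by simp
    ultimately have "\<bar>b m\<bar> / (\<theta> * D (Suc m)) \<le> (\<sigma>\<^sup>2 + \<eta>) / (\<theta> * \<sigma>)"
      using \<sigma> \<theta>0 \<eta> by (intro frac_le) auto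
    moreover have "D (Suc m) > 0" using D_ge[of "Suc m"] m \<sigma> by simp
    ultimately show ?thesis using q(1) \<theta>0 by (simp add: abs_mult)
  qed
  have xi: "\<bar>\<xi> m\<bar> \<le> \<eta> + \<eta> / \<theta>" if m: "m < 2 * L" for m
  proof -
    have "\<bar>(b m - \<sigma>\<^sup>2) / \<theta>\<bar> \<le> \<eta> / \<theta>" using b[OF m] \<theta>0 by (simp add: divide_right_mono)
    then show ?thesis
      unfolding \<xi>_def using a[OF m] abs_triangle_ineq[of "a m" "(b m - \<sigma>\<^sup>2) / \<theta>"] by linarith
  qed
  have step: "\<bar>x m\<bar> \<le> \<eta> * (2 + 1 / \<theta>) + q * \<bar>x (Suc m)\<bar>" if m: "m < 2 * L" for m
  proof -
    have "\<bar>b m / (\<theta> * D (Suc m)) * x (Suc m)\<bar> \<le> q * \<bar>x (Suc m)\<bar>"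
      unfolding abs_mult[of _ "x (Suc m)"] using coef[OF m] by (intro mult_right_mono) auto
    moreover have "\<eta> * (2 + 1 / \<theta>) = \<eta> + (\<eta> + \<eta> / \<theta>)" by (simp add: algebra_simps)
    ultimately show ?thesis using rec[OF m] xi[OF m] t by (smt (verit))
  qed
  have x_end: "\<bar>x (2 * L)\<bar> \<le> C + \<theta>"
    using D_ge[of "2 * L"] D_le \<sigma> \<theta>0 by (auto simp: x_def abs_le_iff)
  have C\<theta>: "0 \<le> C + \<theta>" using x_end by (meson abs_ge_zero order_trans)
  \<comment> \<open>The window has length 2 L so that every index up to L still has at least L
    contracting steps ahead of it; these shrink the end value, about which only a constant bound is
    known.\<close>
  have small: "\<bar>x m\<bar> \<le> \<delta>" if m: "m \<le> L" for m
  proof -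
    have "\<bar>x m\<bar> \<le> \<eta> * (2 + 1 / \<theta>) / (1 - q) + q ^ (2 * L - m) * \<bar>x (m + (2 * L - m))\<bar>"
      by (rule contraction_bound[of "2 * L"]) (use step q0 q \<eta> \<theta>0 m in auto)
    also have "m + (2 * L - m) = 2 * L" using m by simp
    also have "q ^ (2 * L - m) * \<bar>x (2 * L)\<bar> \<le> q ^ L * (C + \<theta>)"
      using x_end q0 q m by (intro mult_mono power_decreasing) auto
    finally show ?thesis unfolding \<delta> by simp
  qed
  have \<delta>0: "\<delta> \<ge> 0" using small[of 0] by (meson abs_ge_zero order_trans zero_le)
  \<comment> \<open>The cost of replacing the secant slope by r. It is of second order, being a
    product of two small quantities.\<close>
  define e where "e m = (b m / (\<theta> * D (Suc m)) - r) * x (Suc m)" for m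
  have e: "\<bar>e m\<bar> \<le> (\<eta> * \<theta> + \<sigma>\<^sup>2 * \<delta>) / (\<theta>\<^sup>2 * \<sigma>) * \<delta>" if m: "m < L" for m
  proof -
    have m2: "m < 2 * L" using m by simp
    have d: "D (Suc m) \<ge> \<sigma>" "D (Suc m) > 0" using D_ge[of "Suc m"] m \<sigma> by auto
    have "b m / (\<theta> * D (Suc m)) - r = ((b m - \<sigma>\<^sup>2) * \<theta> - \<sigma>\<^sup>2 * x (Suc m)) / (\<theta>\<^sup>2 * D (Suc m))"
      using d \<theta>0 by (simp add: r x_def field_simps power2_eq_square)
    moreover have "\<bar>(b m - \<sigma>\<^sup>2) * \<theta> - \<sigma>\<^sup>2 * x (Suc m)\<bar> \<le> \<eta> * \<theta> + \<sigma>\<^sup>2 * \<delta>"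
    proof -
      have "\<bar>(b m - \<sigma>\<^sup>2) * \<theta>\<bar> \<le> \<eta> * \<theta>" using b[OF m2] \<theta>0 by (simp add: abs_mult)
      moreover have "\<bar>\<sigma>\<^sup>2 * x (Suc m)\<bar> \<le> \<sigma>\<^sup>2 * \<delta>" using small[of "Suc m"] m by (simp add: abs_mult mult_left_mono)
      ultimately show ?thesis by linarith
    qed
    moreover have "\<theta>\<^sup>2 * \<sigma> \<le> \<theta>\<^sup>2 * D (Suc m)" using d by (intro mult_left_mono) auto
    ultimately have "\<bar>b m / (\<theta> * D (Suc m)) - r\<bar> \<le> (\<eta> * \<theta> + \<sigma>\<^sup>2 * \<delta>) / (\<theta>\<^sup>2 * \<sigma>)"
      using d \<sigma> \<theta>0 \<eta> \<delta>0 by (auto simp: abs_mult intro!: frac_le)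
    then show ?thesis unfolding e_def abs_mult using small[of "Suc m"] m \<eta> \<theta>0 \<sigma> \<delta>0
      by (intro mult_mono) auto
  qed
  have rec2: "x m = ((t - rho \<sigma> \<theta>) - \<xi> m + e m) + r * x (Suc m)" if "m < L" for m
    using rec[of m] that by (simp add: e_def algebra_simps)
  have gp: "(\<Sum>m<L. r ^ m) = (1 - r ^ L) / (1 - r)"
    using r01 by (simp add: sum_gp_strict)
  have "x 0 = (\<Sum>m<L. r ^ m * ((t - rho \<sigma> \<theta>) - \<xi> m + e m)) + r ^ L * x L"
    by (rule linear_recursion_unroll) (rule rec2)
  also have "(\<Sum>m<L. r ^ m * ((t - rho \<sigma> \<theta>) - \<xi> m + e m))
      = (t - rho \<sigma> \<theta>) * (\<Sum>m<L. r ^ m) - (\<Sum>m<L. r ^ m * \<xi> m) + (\<Sum>m<L. r ^ m * e m)"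
    by (simp add: algebra_simps sum.distrib sum_subtractf sum_distrib_left)
  also note gp
  also have "(t - rho \<sigma> \<theta>) * ((1 - r ^ L) / (1 - r)) = (t - rho \<sigma> \<theta>) / (1 - r) - r ^ L * ((t - rho \<sigma> \<theta>) / (1 - r))"
  proof -
    have "u * ((1 - z) / w) = u / w - z * (u / w)" for u z w :: real
      by (simp add: algebra_simps diff_divide_distrib)
    then show ?thesis .
  qed
  finally have "x 0 - ((t - rho \<sigma> \<theta>) / (1 - r) - (\<Sum>m<L. r ^ m * \<xi> m))
      = (\<Sum>m<L. r ^ m * e m) + r ^ L * (x L - (t - rho \<sigma> \<theta>) / (1 - r))"
    unfolding right_diff_distrib[of "r ^ L"] by linarith
  also have "\<bar>\<dots>\<bar> \<le> (\<eta> * \<theta> + \<sigma>\<^sup>2 * \<delta>) / (\<theta>\<^sup>2 * \<sigma>) * \<delta> / (1 - r) + r ^ L * (\<delta> + \<eta> / (1 - r))"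
  proof (rule order_trans[OF abs_triangle_ineq add_mono])
    let ?E = "(\<eta> * \<theta> + \<sigma>\<^sup>2 * \<delta>) / (\<theta>\<^sup>2 * \<sigma>) * \<delta>"
    have E0: "?E \<ge> 0" using \<eta> \<theta>0 \<sigma> \<delta>0 by simp
    have "\<bar>\<Sum>m<L. r ^ m * e m\<bar> \<le> (\<Sum>m<L. r ^ m * ?E)"
    proof (rule order_trans[OF sum_abs sum_mono])
      fix m assume m: "m \<in> {..<L}"
      have "\<bar>r ^ m * e m\<bar> = r ^ m * \<bar>e m\<bar>" using r01 by (simp add: abs_mult)
      also have "\<dots> \<le> r ^ m * ?E" using e[of m] m r01 by (intro mult_left_mono) auto
      finally show "\<bar>r ^ m * e m\<bar> \<le> r ^ m * ?E" .
    qed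
    also have "\<dots> = (1 - r ^ L) / (1 - r) * ?E"
      unfolding sum_distrib_right[symmetric] gp ..
    also have "\<dots> \<le> 1 / (1 - r) * ?E"
      using r01 E0 by (intro mult_right_mono divide_right_mono) auto
    finally show "\<bar>\<Sum>m<L. r ^ m * e m\<bar> \<le> ?E / (1 - r)" by (simp only: mult.left_neutral times_divide_eq_left)
    have "\<bar>(t - rho \<sigma> \<theta>) / (1 - r)\<bar> \<le> \<eta> / (1 - r)" using t r01 by (simp add: divide_right_mono)
    then have "\<bar>x L - (t - rho \<sigma> \<theta>) / (1 - r)\<bar> \<le> \<delta> + \<eta> / (1 - r)"
      using small[of L] by linarith
    then show "\<bar>r ^ L * (x L - (t - rho \<sigma> \<theta>) / (1 - r))\<bar> \<le> r ^ L * (\<delta> + \<eta> / (1 - r))"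
      using r01 by (simp add: abs_mult mult_left_mono)
  qed
  finally show ?thesis by (simp add: x_def \<xi>_def)
qed

section \<open>Concentration\<close>

text \<open>The tilted density is proportional to a centered normal density of variance 1 / (1 - 2
  l). The value is the moment generating function of a centered chi-square variable.\<close>

lemma nn_integral_std_normal_exp_square:
  assumes l: "l < 1 / 2"
  shows "(\<integral>\<^sup>+x. ennreal (exp (l * (x\<^sup>2 - 1))) \<partial>std_normal_distribution) = ennreal (exp (- l) / sqrt (1 - 2 * l))"
proof -
  define s where "s = 1 / sqrt (1 - 2 * l)"
  have s: "s > 0" "s\<^sup>2 = 1 / (1 - 2 * l)" using l by (auto simp: s_def power_divide)
  have eq: "std_normal_density x * exp (l * (x\<^sup>2 - 1)) = exp (- l) * s * normal_density 0 s x" for x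
  proof -
    have "- x\<^sup>2 / 2 + l * (x\<^sup>2 - 1) = - l + (- x\<^sup>2 / (2 * s\<^sup>2))"
      unfolding s(2) by (simp add: field_simps)
    then have "exp (- x\<^sup>2 / 2) * exp (l * (x\<^sup>2 - 1)) = exp (- l) * exp (- x\<^sup>2 / (2 * s\<^sup>2))"
      by (simp flip: exp_add)
    moreover have "sqrt (2 * pi * s\<^sup>2) = s * sqrt (2 * pi)"
      using s(1) by (simp add: real_sqrt_mult)
    ultimately show ?thesis
      using s(1) unfolding normal_density_def by (simp add: field_simps)
  qed
  interpret g: prob_space "density lborel (normal_density 0 s)" by (rule prob_space_normal_density[OF s(1)])
  have one: "(\<integral>\<^sup>+x. ennreal (normal_density 0 s x) \<partial>lborel) = 1"
    using g.emeasure_space_1 by (simp add: emeasure_density)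
  have "(\<integral>\<^sup>+x. ennreal (exp (l * (x\<^sup>2 - 1))) \<partial>std_normal_distribution)
      = (\<integral>\<^sup>+x. ennreal (exp (- l) * s) * ennreal (normal_density 0 s x) \<partial>lborel)"
    using s(1) by (simp add: nn_integral_density eq flip: ennreal_mult')
  also have "\<dots> = ennreal (exp (- l) * s)" by (simp add: nn_integral_cmult one)
  finally show ?thesis by (simp add: s_def)
qed

text \<open>With |l| <= 1/4 the argument x = - 2 l satisfies |x| <= 1/2, where |ln (1 + x) - x| <= 2
  x^2.\<close>

lemma exp_div_sqrt_le:
  fixes l :: real
  assumes "\<bar>l\<bar> \<le> 1 / 4"
  shows "exp (- l) / sqrt (1 - 2 * l) \<le> exp (4 * l\<^sup>2)"
proof -
  have pos: "1 - 2 * l > 0" using assms by (auto simp: abs_le_iff)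
  have "\<bar>ln (1 + (- 2 * l)) - (- 2 * l)\<bar> \<le> 2 * (- 2 * l)\<^sup>2"
    by (rule abs_ln_one_plus_x_minus_x_bound) (use assms in \<open>auto simp: abs_le_iff\<close>)
  then have "- 2 * l - 8 * l\<^sup>2 \<le> ln (1 - 2 * l)" by (simp add: abs_le_iff power2_eq_square)
  then have "exp (- 2 * l - 8 * l\<^sup>2) \<le> 1 - 2 * l" using pos ln_ge_iff by blast
  also have "exp (- 2 * l - 8 * l\<^sup>2) = (exp (- l - 4 * l\<^sup>2))\<^sup>2"
    by (simp add: power2_eq_square flip: exp_add)
  finally have "(exp (- l - 4 * l\<^sup>2))\<^sup>2 \<le> 1 - 2 * l" .
  then have "exp (- l - 4 * l\<^sup>2) \<le> sqrt (1 - 2 * l)" by (rule real_le_rsqrt)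
  moreover have "exp (- l) = exp (4 * l\<^sup>2) * exp (- l - 4 * l\<^sup>2)" by (simp flip: exp_add)
  ultimately show ?thesis using pos by (simp add: divide_le_eq)
qed

text \<open>The matrix is represented by standardised entries, so that the parameters appear only as
  coefficients and the chain and the linear statistic can be compared at the same sample
  point.\<close>

locale normal_array = prob_space +
  fixes N :: nat and G :: "nat \<times> nat \<Rightarrow> 'a \<Rightarrow> real"
  assumes indep: "indep_vars (\<lambda>_. borel) G (upper_tri {0..<N})"
    and std: "\<And>p. p \<in> upper_tri {0..<N} \<Longrightarrow> distr M borel (G p) = std_normal_distribution"
begin

lemma measurable_entry: "p \<in> upper_tri {0..<N} \<Longrightarrow> G p \<in> borel_measurable M"
  using indep unfolding indep_vars_def by auto

lemma nn_integral_entry: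
  assumes p: "p \<in> upper_tri {0..<N}" and f: "f \<in> borel_measurable borel"
  shows "(\<integral>\<^sup>+\<omega>. f (G p \<omega>) \<partial>M) = (\<integral>\<^sup>+x. f x \<partial>std_normal_distribution)"
  unfolding std[OF p, symmetric] using measurable_entry[OF p] f by (subst nn_integral_distr) auto

text \<open>Exponential Markov inequality. Writing the event with the factor l on both sides lets a
  negative l describe the lower tail.\<close>

lemma chernoff_one_sided:
  assumes K: "K \<subseteq> upper_tri {0..<N}" and l: "\<bar>l\<bar> \<le> 1 / 4"
  shows "prob {\<omega> \<in> space M. l * \<tau> \<le> l * (\<Sum>p\<in>K. (G p \<omega>)\<^sup>2 - 1)} \<le> exp (- l * \<tau> + 4 * l\<^sup>2 * card K)"
proof -
  have fin: "finite K" using K by (rule finite_subset) simp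
  have [measurable]: "p \<in> K \<Longrightarrow> G p \<in> borel_measurable M" for p using K measurable_entry[of p] by blast
  let ?S = "\<lambda>\<omega>. \<Sum>p\<in>K. (G p \<omega>)\<^sup>2 - 1"
  let ?u = "\<lambda>\<omega>. ennreal (exp (l * ?S \<omega>))"
  have [measurable]: "?u \<in> borel_measurable M" by measurable
  have "(\<integral>\<^sup>+\<omega>. ?u \<omega> \<partial>M) = (\<integral>\<^sup>+\<omega>. (\<Prod>p\<in>K. ennreal (exp (l * ((G p \<omega>)\<^sup>2 - 1)))) \<partial>M)"
    using fin by (simp add: sum_distrib_left exp_sum prod_ennreal)
  also have "\<dots> = (\<Prod>p\<in>K. \<integral>\<^sup>+\<omega>. ennreal (exp (l * ((G p \<omega>)\<^sup>2 - 1))) \<partial>M)"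
  proof (rule indep_vars_nn_integral[OF fin])
    have "indep_vars (\<lambda>_. borel) G K" by (rule indep_vars_subset[OF indep K])
    then show "indep_vars (\<lambda>_. borel) (\<lambda>p \<omega>. ennreal (exp (l * ((G p \<omega>)\<^sup>2 - 1)))) K"
      by (rule indep_vars_compose2) measurable
  qed simp
  also have "\<dots> = (\<Prod>p\<in>K. ennreal (exp (- l) / sqrt (1 - 2 * l)))"
  proof (rule prod.cong[OF refl])
    fix p assume "p \<in> K"
    then have "(\<integral>\<^sup>+\<omega>. ennreal (exp (l * ((G p \<omega>)\<^sup>2 - 1))) \<partial>M)
        = (\<integral>\<^sup>+x. ennreal (exp (l * (x\<^sup>2 - 1))) \<partial>std_normal_distribution)"
      using K by (intro nn_integral_entry[where f = "\<lambda>x. ennreal (exp (l * (x\<^sup>2 - 1)))"]) auto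
    also have "\<dots> = ennreal (exp (- l) / sqrt (1 - 2 * l))"
      by (rule nn_integral_std_normal_exp_square) (use l in \<open>auto simp: abs_le_iff\<close>)
    finally show "(\<integral>\<^sup>+\<omega>. ennreal (exp (l * ((G p \<omega>)\<^sup>2 - 1))) \<partial>M) = ennreal (exp (- l) / sqrt (1 - 2 * l))" .
  qed
  also have "\<dots> \<le> (\<Prod>p\<in>K. ennreal (exp (4 * l\<^sup>2)))"
    by (intro prod_mono_ennreal ennreal_leI exp_div_sqrt_le l)
  also have "\<dots> = ennreal (exp (4 * l\<^sup>2 * card K))"
    by (simp add: ennreal_power flip: exp_of_nat2_mult)
  finally have u: "(\<integral>\<^sup>+\<omega>. ?u \<omega> \<partial>M) \<le> ennreal (exp (4 * l\<^sup>2 * card K))" .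
  have "emeasure M {\<omega> \<in> space M. l * \<tau> \<le> l * ?S \<omega>} = emeasure M {\<omega> \<in> space M. 1 \<le> ennreal (exp (- l * \<tau>)) * ?u \<omega>}"
  proof -
    have "1 \<le> ennreal (exp (- l * \<tau>)) * ?u \<omega> \<longleftrightarrow> l * \<tau> \<le> l * ?S \<omega>" for \<omega>
      by (simp flip: ennreal_mult' exp_add)
    then show ?thesis by simp
  qed
  also have "\<dots> \<le> ennreal (exp (- l * \<tau>)) * (\<integral>\<^sup>+\<omega>. ?u \<omega> * indicator (space M) \<omega> \<partial>M)"
    by (rule nn_integral_Markov_inequality) auto
  also have "\<dots> = ennreal (exp (- l * \<tau>)) * (\<integral>\<^sup>+\<omega>. ?u \<omega> \<partial>M)"
    by (simp cong: nn_integral_cong)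
  also have "\<dots> \<le> ennreal (exp (- l * \<tau>)) * ennreal (exp (4 * l\<^sup>2 * card K))"
    by (intro mult_left_mono u) simp
  also have "\<dots> = ennreal (exp (- l * \<tau> + 4 * l\<^sup>2 * card K))"
    unfolding exp_add by (simp add: ennreal_mult')
  finally show ?thesis by (simp add: emeasure_eq_measure)
qed

lemma chernoff_two_sided:
  assumes K: "K \<subseteq> upper_tri {0..<N}" and l: "0 < l" "l \<le> 1 / 4"
  shows "prob {\<omega> \<in> space M. \<tau> \<le> \<bar>\<Sum>p\<in>K. (G p \<omega>)\<^sup>2 - 1\<bar>} \<le> 2 * exp (- l * \<tau> + 4 * l\<^sup>2 * card K)"
proof -
  let ?S = "\<lambda>\<omega>. \<Sum>p\<in>K. (G p \<omega>)\<^sup>2 - 1"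
  have [measurable]: "p \<in> K \<Longrightarrow> G p \<in> borel_measurable M" for p using K measurable_entry[of p] by blast
  have "{\<omega> \<in> space M. \<tau> \<le> \<bar>?S \<omega>\<bar>} \<subseteq>
      {\<omega> \<in> space M. l * \<tau> \<le> l * ?S \<omega>} \<union> {\<omega> \<in> space M. (- l) * (- \<tau>) \<le> (- l) * ?S \<omega>}"
  proof safe
    fix \<omega> assume *: "\<tau> \<le> \<bar>?S \<omega>\<bar>" "\<not> - l * - \<tau> \<le> - l * ?S \<omega>"
    then have "l * ?S \<omega> > - (l * \<tau>)" by simp
    then have "l * ?S \<omega> > l * (- \<tau>)" by simp
    then have "?S \<omega> > - \<tau>" using l by (simp only: mult_less_cancel_left_pos)
    then show "l * \<tau> \<le> l * ?S \<omega>" using * l by (intro mult_left_mono) auto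
  qed
  then have "prob {\<omega> \<in> space M. \<tau> \<le> \<bar>?S \<omega>\<bar>} \<le>
     prob ({\<omega> \<in> space M. l * \<tau> \<le> l * ?S \<omega>} \<union> {\<omega> \<in> space M. (- l) * (- \<tau>) \<le> (- l) * ?S \<omega>})"
    by (rule finite_measure_mono) measurable
  also have "\<dots> \<le> prob {\<omega> \<in> space M. l * \<tau> \<le> l * ?S \<omega>} + prob {\<omega> \<in> space M. (- l) * (- \<tau>) \<le> (- l) * ?S \<omega>}"
    by (rule measure_Un_le) measurable
  also have "\<dots> \<le> exp (- l * \<tau> + 4 * l\<^sup>2 * card K) + exp (- (- l) * (- \<tau>) + 4 * (- l)\<^sup>2 * card K)"
    by (intro add_mono chernoff_one_sided K) (use l in auto)
  finally show ?thesis by simp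
qed

text \<open>The exceptional event, outside which every row is under control. Diagonal entries enter
  through their squares so that the chi-square bound covers them too.\<close>

definition deviation :: "real \<Rightarrow> real \<Rightarrow> 'a set" where
  "deviation \<tau> \<tau>' = (\<Union>m\<in>{0..<N}. {\<omega> \<in> space M. \<tau> \<le> \<bar>(G (m, m) \<omega>)\<^sup>2 - 1\<bar>} \<union>
      {\<omega> \<in> space M. \<tau>' \<le> \<bar>\<Sum>j\<in>{Suc m..<N}. (G (m, j) \<omega>)\<^sup>2 - 1\<bar>})"

lemma sets_deviation: "deviation \<tau> \<tau>' \<in> sets M"
proof -
  have [measurable]: "m \<in> {0..<N} \<Longrightarrow> G (m, m) \<in> borel_measurable M" for m
    by (rule measurable_entry) (auto simp: upper_tri_def)
  have [measurable]: "j \<in> {Suc m..<N} \<Longrightarrow> G (m, j) \<in> borel_measurable M" for m j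
    by (rule measurable_entry) (auto simp: upper_tri_def)
  show ?thesis unfolding deviation_def by measurable
qed

text \<open>Union bound over the rows. A diagonal entry is a sum with a single summand, for which l
  = 1/4 is good enough; for the row sums l is left free, to be optimised once the scale is
  fixed.\<close>

lemma prob_deviation:
  fixes l :: real
  assumes l: "0 < l" "l \<le> 1 / 4"
  shows "prob (deviation \<tau> \<tau>') \<le> N * (2 * exp (1 / 4 - \<tau> / 4) + 2 * exp (- l * \<tau>' + 4 * l\<^sup>2 * N))"
proof -
  let ?A = "\<lambda>m. {\<omega> \<in> space M. \<tau> \<le> \<bar>(G (m, m) \<omega>)\<^sup>2 - 1\<bar>}"
  let ?B = "\<lambda>m. {\<omega> \<in> space M. \<tau>' \<le> \<bar>\<Sum>j\<in>{Suc m..<N}. (G (m, j) \<omega>)\<^sup>2 - 1\<bar>}"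
  have [measurable]: "m \<in> {0..<N} \<Longrightarrow> G (m, m) \<in> borel_measurable M" for m
    by (rule measurable_entry) (auto simp: upper_tri_def)
  have [measurable]: "j \<in> {Suc m..<N} \<Longrightarrow> G (m, j) \<in> borel_measurable M" for m j
    by (rule measurable_entry) (auto simp: upper_tri_def)
  have sA: "?A m \<in> sets M" if "m \<in> {0..<N}" for m using that by measurable
  have sB: "?B m \<in> sets M" for m by measurable
  have A: "prob (?A m) \<le> 2 * exp (1 / 4 - \<tau> / 4)" if "m \<in> {0..<N}" for m
  proof -
    have "{(m, m)} \<subseteq> upper_tri {0..<N}" using that by (auto simp: upper_tri_def)
    from chernoff_two_sided[OF this, of "1 / 4" \<tau>] show ?thesis by (simp add: power2_eq_square)
  qed
  have B: "prob (?B m) \<le> 2 * exp (- l * \<tau>' + 4 * l\<^sup>2 * N)" if m: "m \<in> {0..<N}" for m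
  proof -
    let ?K = "Pair m ` {Suc m..<N}"
    have K: "?K \<subseteq> upper_tri {0..<N}" using m by (auto simp: upper_tri_def)
    have sum: "(\<Sum>p\<in>?K. (G p \<omega>)\<^sup>2 - 1) = (\<Sum>j\<in>{Suc m..<N}. (G (m, j) \<omega>)\<^sup>2 - 1)" for \<omega>
      by (subst sum.reindex) (auto simp: inj_on_def)
    have "card ?K \<le> N" by (subst card_image) (auto simp: inj_on_def)
    then have "4 * l\<^sup>2 * card ?K \<le> 4 * l\<^sup>2 * N" by (intro mult_left_mono) auto
    then have "2 * exp (- l * \<tau>' + 4 * l\<^sup>2 * card ?K) \<le> 2 * exp (- l * \<tau>' + 4 * l\<^sup>2 * N)" by simp
    with chernoff_two_sided[OF K l, of \<tau>'] show ?thesis unfolding sum by linarith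
  qed
  have "prob (deviation \<tau> \<tau>') \<le> (\<Sum>m\<in>{0..<N}. prob (?A m \<union> ?B m))"
    unfolding deviation_def by (rule finite_measure_subadditive_finite) (use sA sB in auto)
  also have "\<dots> \<le> (\<Sum>m\<in>{0..<N}. 2 * exp (1 / 4 - \<tau> / 4) + 2 * exp (- l * \<tau>' + 4 * l\<^sup>2 * N))"
  proof (rule sum_mono)
    fix m assume m: "m \<in> {0..<N}"
    have "prob (?A m \<union> ?B m) \<le> prob (?A m) + prob (?B m)"
      by (rule measure_Un_le) (use m sA sB in auto)
    then show "prob (?A m \<union> ?B m) \<le> 2 * exp (1 / 4 - \<tau> / 4) + 2 * exp (- l * \<tau>' + 4 * l\<^sup>2 * N)"
      using A[OF m] B[OF m] by linarith
  qed
  finally show ?thesis by simp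
qed

end

section \<open>The central limit theorem for the linear statistic\<close>

lemma exp_minus_bound:
  fixes y :: real
  assumes "y \<ge> 0"
  shows "\<bar>exp (- y) - (1 - y)\<bar> \<le> y\<^sup>2"
proof -
  have "1 - y \<le> exp (- y)" using exp_ge_add_one_self[of "- y"] by simp
  moreover have "exp (- y) \<le> 1 - y + y\<^sup>2"
  proof -
    have "exp (- y) \<le> 1 / (1 + y)"
      unfolding exp_minus inverse_eq_divide using exp_ge_add_one_self[of y] assms by (intro frac_le) auto
    also have "1 \<le> (1 - y + y\<^sup>2) * (1 + y)"
    proof -
      have "(1 - y + y\<^sup>2) * (1 + y) = 1 + y ^ 3" by (simp add: algebra_simps power2_eq_square power3_eq_cube)
      then show ?thesis using assms by simp
    qed
    then have "1 / (1 + y) \<le> 1 - y + y\<^sup>2" using assms by (simp add: divide_le_eq)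
    finally show ?thesis .
  qed
  ultimately show ?thesis by (simp add: abs_le_iff)
qed

abbreviation centered_chi_sq :: "real measure" where
  "centered_chi_sq \<equiv> distr std_normal_distribution borel (\<lambda>x. x\<^sup>2 - 1)"

text \<open>The variable has variance 2 and a finite third absolute moment, so its characteristic
  function is 1 - t^2 + O(|t|^3). The cubic order matters: about L N factors with arguments of order
  1 / sqrt N are compared below.\<close>

lemma char_centered_chi_sq:
  "\<exists>C\<ge>0. \<forall>t. cmod (char centered_chi_sq t - exp (- (complex_of_real t)\<^sup>2)) \<le> C * \<bar>t\<bar> ^ 3"
proof -
  interpret N: real_distribution std_normal_distribution by (rule real_dist_normal_dist)
  let ?X = "\<lambda>x::real. x\<^sup>2 - 1"
  note mom = integrable_std_normal_distribution_moment
  have i1: "integrable std_normal_distribution ?X" using mom[of 2] by simp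
  have sq: "(?X x)\<^sup>2 = x ^ 4 - 2 * x\<^sup>2 + 1" for x :: real by (simp add: power2_eq_square power4_eq_xxxx algebra_simps)
  have i2: "integrable std_normal_distribution (\<lambda>x. (?X x)\<^sup>2)"
    unfolding sq using mom[of 2] mom[of 4] by simp
  have m2: "(LINT x|std_normal_distribution. x\<^sup>2) = 1" using std_normal_distribution_even_moments(1)[of 1] by simp
  have m4: "(LINT x|std_normal_distribution. x ^ 4) = 3"
    using std_normal_distribution_even_moments(1)[of 2] by (simp add: fact_numeral)
  have e1: "N.expectation ?X = 0" using mom[of 2] m2 N.prob_space by simp
  have v: "N.variance ?X = 2"
    unfolding e1 using mom[of 2] mom[of 4] m2 m4 N.prob_space by (simp add: sq)
  have i3: "integrable std_normal_distribution (\<lambda>x. \<bar>?X x\<bar> ^ 3)"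
  proof (rule Bochner_Integration.integrable_bound)
    show "integrable std_normal_distribution (\<lambda>x. x ^ 6 + 3 * x ^ 4 + 3 * x\<^sup>2 + 1)"
      using mom[of 2] mom[of 4] mom[of 6] by simp
    show "AE x in std_normal_distribution. norm (\<bar>?X x\<bar> ^ 3) \<le> norm (x ^ 6 + 3 * x ^ 4 + 3 * x\<^sup>2 + 1)"
    proof (rule AE_I2)
      fix x :: real
      have "\<bar>?X x\<bar> ^ 3 \<le> (x\<^sup>2 + 1) ^ 3" by (intro power_mono) (auto simp: abs_le_iff)
      also have "(x\<^sup>2 + 1) ^ 3 = x ^ 6 + 3 * x ^ 4 + 3 * x\<^sup>2 + 1"
        by (simp add: power3_eq_cube power2_eq_square eval_nat_numeral algebra_simps)
      finally show "norm (\<bar>?X x\<bar> ^ 3) \<le> norm (x ^ 6 + 3 * x ^ 4 + 3 * x\<^sup>2 + 1)" by simp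
    qed
  qed simp
  define K where "K = N.expectation (\<lambda>x. \<bar>?X x\<bar> ^ 3)"
  have K: "K \<ge> 0" unfolding K_def by (intro integral_nonneg_AE) auto
  interpret C: real_distribution centered_chi_sq
    by (rule N.real_distribution_distr) measurable
  have main: "cmod (char centered_chi_sq t - (1 - t\<^sup>2)) \<le> K * \<bar>t\<bar> ^ 3" for t
  proof -
    have "cmod (char centered_chi_sq t - (1 - t\<^sup>2 * 2 / 2))
        \<le> (t\<^sup>2 / 6) * N.expectation (\<lambda>x. min (6 * (?X x)\<^sup>2) (\<bar>t\<bar> * \<bar>?X x\<bar> ^ 3))"
      by (rule N.char_approx3'[OF _ i1 i2 e1 v]) (auto simp: complex_eq_iff)
    also have "N.expectation (\<lambda>x. min (6 * (?X x)\<^sup>2) (\<bar>t\<bar> * \<bar>?X x\<bar> ^ 3)) \<le> N.expectation (\<lambda>x. \<bar>t\<bar> * \<bar>?X x\<bar> ^ 3)"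
      using i2 i3 by (intro integral_mono integrable_min) auto
    also have "\<dots> = \<bar>t\<bar> * K" by (simp add: K_def)
    finally have "cmod (char centered_chi_sq t - (1 - t\<^sup>2 * 2 / 2)) \<le> t\<^sup>2 / 6 * (\<bar>t\<bar> * K)"
      by (simp add: mult_left_mono)
    also have "\<bar>t\<bar> ^ 3 = t\<^sup>2 * \<bar>t\<bar>" by (simp add: power3_eq_cube power2_eq_square)
    then have "t\<^sup>2 / 6 * (\<bar>t\<bar> * K) = K / 6 * \<bar>t\<bar> ^ 3" by simp
    also have "\<dots> \<le> K * \<bar>t\<bar> ^ 3" using K by (intro mult_right_mono) auto
    finally show ?thesis by simp
  qed
  \<comment> \<open>K comes from the Taylor remainder; the additional 2 covers exp (- t^2) - (1 -
    t^2) for |t| <= 1 and the trivial bound for |t| > 1.\<close>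
  have "cmod (char centered_chi_sq t - exp (- (complex_of_real t)\<^sup>2)) \<le> (K + 2) * \<bar>t\<bar> ^ 3" for t
  proof -
    have ex: "exp (- (complex_of_real t)\<^sup>2) = complex_of_real (exp (- t\<^sup>2))"
      by (simp flip: exp_of_real)
    show ?thesis
    proof (cases "\<bar>t\<bar> \<le> 1")
      case True
      have "cmod (complex_of_real (1 - t\<^sup>2) - complex_of_real (exp (- t\<^sup>2))) = \<bar>exp (- t\<^sup>2) - (1 - t\<^sup>2)\<bar>"
        by (simp only: norm_of_real abs_minus_commute flip: of_real_diff)
      also have "\<dots> \<le> (t\<^sup>2)\<^sup>2" by (rule exp_minus_bound) simp
      also have "(t\<^sup>2)\<^sup>2 = \<bar>t\<bar> ^ 4" by (simp add: power_even_abs flip: power_mult)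
      also have "\<dots> \<le> \<bar>t\<bar> ^ 3" using True by (intro power_decreasing) auto
      finally have "cmod (complex_of_real (1 - t\<^sup>2) - complex_of_real (exp (- t\<^sup>2))) \<le> \<bar>t\<bar> ^ 3" .
      moreover have "cmod (char centered_chi_sq t - exp (- (complex_of_real t)\<^sup>2)) \<le>
          cmod (char centered_chi_sq t - (1 - t\<^sup>2)) + cmod (complex_of_real (1 - t\<^sup>2) - complex_of_real (exp (- t\<^sup>2)))"
        unfolding ex
        using norm_triangle_ineq[of "char centered_chi_sq t - complex_of_real (1 - t\<^sup>2)" "complex_of_real (1 - t\<^sup>2) - complex_of_real (exp (- t\<^sup>2))"]
        by simp
      moreover have nn: "0 \<le> \<bar>t\<bar> ^ 3" by simp
      ultimately show ?thesis using main[of t] by (simp add: distrib_right) (use nn in linarith)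
    next
      case False
      have "cmod (char centered_chi_sq t - exp (- (complex_of_real t)\<^sup>2)) \<le> cmod (char centered_chi_sq t) + cmod (complex_of_real (exp (- t\<^sup>2)))"
        unfolding ex by (rule norm_triangle_ineq4)
      also have "\<dots> \<le> 1 + 1" using C.cmod_char_le_1[of t] by (intro add_mono) (auto simp: norm_of_real)
      also have "\<dots> \<le> 2 * \<bar>t\<bar> ^ 3" using False one_le_power[of "\<bar>t\<bar>" 3] by simp
      also have "\<dots> \<le> (K + 2) * \<bar>t\<bar> ^ 3" using K by (intro mult_right_mono) auto
      finally show ?thesis .
    qed
  qed
  then show ?thesis using K by (intro exI[of _ "K + 2"]) auto
qed

lemma (in prob_space) char_distr_scale:
  assumes "random_variable borel X"
  shows "char (distr M borel (\<lambda>\<omega>. a * X \<omega>)) t = char (distr M borel X) (a * t)"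
  unfolding char_def using assms by (simp add: integral_distr mult_ac)

context normal_array
begin

text \<open>The statistic is the linear part of \<open>sqrt N\<close> times the deviation of the threshold from \<open>\<theta>\<close>,
  with entries normalised to unit variance; a deterministic shift of at most the order \<open>L\<^sup>2 / sqrt N\<close>, due to
  row \<open>m\<close> having only \<open>N - m - 1\<close> off-diagonal entries, is left out.\<close>

definition statistic_term :: "real \<Rightarrow> real \<Rightarrow> nat \<times> nat \<Rightarrow> 'a \<Rightarrow> real" where
  "statistic_term \<sigma> \<theta> = (\<lambda>(m, j) \<omega>. if m = j then (\<sigma>\<^sup>2 / \<theta>\<^sup>2) ^ m * sqrt 2 * \<sigma> * G (m, j) \<omega>
     else (\<sigma>\<^sup>2 / \<theta>\<^sup>2) ^ m * (\<sigma>\<^sup>2 / (\<theta> * sqrt N)) * ((G (m, j) \<omega>)\<^sup>2 - 1))"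

definition statistic :: "real \<Rightarrow> real \<Rightarrow> nat \<Rightarrow> 'a \<Rightarrow> real" where
  "statistic \<sigma> \<theta> L \<omega> = (\<Sum>p\<in>Sigma {..<L} (\<lambda>m. {m..<N}). statistic_term \<sigma> \<theta> p \<omega>)"

lemma statistic_index: "Sigma {..<L} (\<lambda>m. {m..<N}) \<subseteq> upper_tri {0..<N}"
  by (auto simp: upper_tri_def)

lemma indep_statistic_term:
  "indep_vars (\<lambda>_. borel) (statistic_term \<sigma> \<theta>) (Sigma {..<L} (\<lambda>m. {m..<N}))"
proof -
  have "indep_vars (\<lambda>_. borel) G (Sigma {..<L} (\<lambda>m. {m..<N}))"
    by (rule indep_vars_subset[OF indep statistic_index])
  then have "indep_vars (\<lambda>_. borel) (\<lambda>p \<omega>. (\<lambda>x. if fst p = snd p then (\<sigma>\<^sup>2 / \<theta>\<^sup>2) ^ fst p * sqrt 2 * \<sigma> * x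
     else (\<sigma>\<^sup>2 / \<theta>\<^sup>2) ^ fst p * (\<sigma>\<^sup>2 / (\<theta> * sqrt N)) * (x\<^sup>2 - 1)) (G p \<omega>)) (Sigma {..<L} (\<lambda>m. {m..<N}))"
    by (rule indep_vars_compose2) measurable
  moreover have "statistic_term \<sigma> \<theta> = (\<lambda>p \<omega>. (\<lambda>x. if fst p = snd p then (\<sigma>\<^sup>2 / \<theta>\<^sup>2) ^ fst p * sqrt 2 * \<sigma> * x
     else (\<sigma>\<^sup>2 / \<theta>\<^sup>2) ^ fst p * (\<sigma>\<^sup>2 / (\<theta> * sqrt N)) * (x\<^sup>2 - 1)) (G p \<omega>))"
    by (auto simp: statistic_term_def fun_eq_iff)
  ultimately show ?thesis by simp
qed

lemma measurable_statistic: "statistic \<sigma> \<theta> L \<in> borel_measurable M"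
  unfolding statistic_def[abs_def]
  using indep_statistic_term[of \<sigma> \<theta> L] by (intro borel_measurable_sum) (auto simp: indep_vars_def)

text \<open>Products of numbers of modulus at most 1 are compared factor by factor. The exponent is
  x^2 times half a variance: row m contributes the variance 2 \<sigma>^2 r^(2 m) through its
  diagonal entry and 2 \<sigma>^2 r^(2 m) r / N through each of its N - m - 1 other entries, because
  \<sigma>^4 / \<theta>^2 = \<sigma>^2 r.\<close>

lemma char_statistic_bound:
  fixes r :: real
  assumes \<sigma>: "\<sigma> > 0" and \<theta>: "\<theta> > \<sigma>" and N: "N > 0" and C: "C \<ge> 0"
    "\<And>t. cmod (char centered_chi_sq t - exp (- (complex_of_real t)\<^sup>2)) \<le> C * \<bar>t\<bar> ^ 3" and L: "L \<le> N"
    and r: "r = \<sigma>\<^sup>2 / \<theta>\<^sup>2"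
  shows "cmod (char (distr M borel (statistic \<sigma> \<theta> L)) x -
      exp (- complex_of_real (\<sigma>\<^sup>2 * x\<^sup>2 * (\<Sum>m<L. (r\<^sup>2) ^ m * (1 + r * (N - Suc m) / N)))))
    \<le> L * N * (C * (\<sigma>\<^sup>2 / (\<theta> * sqrt N) * \<bar>x\<bar>) ^ 3)"
proof -
  let ?J = "Sigma {..<L} (\<lambda>m. {m..<N})"
  have r01: "0 \<le> r" "r \<le> 1" using \<sigma> \<theta> by (auto simp: r power_mono)
  define d where "d m = r ^ m * (\<sigma>\<^sup>2 / (\<theta> * sqrt N))" for m
  have d: "0 \<le> d m" "d m \<le> \<sigma>\<^sup>2 / (\<theta> * sqrt N)" for m
  proof -
    have k: "0 \<le> \<sigma>\<^sup>2 / (\<theta> * sqrt N)" using \<sigma> \<theta> by simp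
    show "0 \<le> d m" unfolding d_def using r01 k by (intro mult_nonneg_nonneg) auto
    show "d m \<le> \<sigma>\<^sup>2 / (\<theta> * sqrt N)"
      unfolding d_def using mult_right_mono[OF power_le_one[OF r01, of m] k] by (simp only: mult_1)
  qed
  define \<psi> where "\<psi> = (\<lambda>(m, j). if m = j then \<sigma>\<^sup>2 * x\<^sup>2 * (r\<^sup>2) ^ m else (d m * x)\<^sup>2)"
  let ?\<phi> = "\<lambda>p. char (distr M borel (statistic_term \<sigma> \<theta> p)) x"
  have rv: "random_variable borel (G p)" if "p \<in> ?J" for p
    using that statistic_index by (intro measurable_entry) auto
  have rvt: "random_variable borel (statistic_term \<sigma> \<theta> p)" if "p \<in> ?J" for p
    using that indep_statistic_term[of \<sigma> \<theta> L] by (auto simp: indep_vars_def)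
  have term_bound: "cmod (?\<phi> p - exp (- complex_of_real (\<psi> p))) \<le> C * (\<sigma>\<^sup>2 / (\<theta> * sqrt N) * \<bar>x\<bar>) ^ 3" if p: "p \<in> ?J" for p
  proof -
    obtain m j where pm: "p = (m, j)" by (cases p)
    have pI: "p \<in> upper_tri {0..<N}" using p statistic_index by blast
    show ?thesis
    proof (cases "m = j")
      case True
      define c where "c = r ^ m * sqrt 2 * \<sigma>"
      have "?\<phi> p = char (distr M borel (\<lambda>\<omega>. c * G p \<omega>)) x"
        using True by (simp add: statistic_term_def pm c_def r)
      also have "\<dots> = char std_normal_distribution (c * x)"
        by (simp add: char_distr_scale rv[OF p] std[OF pI])
      also have "\<dots> = complex_of_real (exp (- (c * x)\<^sup>2 / 2))"
        by (simp add: char_std_normal_distribution)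
      also have "- (c * x)\<^sup>2 / 2 = - \<psi> p"
        using True by (simp add: \<psi>_def pm c_def power_mult_distrib mult_ac flip: power_mult)
      finally have "?\<phi> p = exp (- complex_of_real (\<psi> p))" by (simp flip: exp_of_real)
      \<comment> \<open>A diagonal term is exactly Gaussian, so its factor carries no error.\<close>
      then show ?thesis using C(1) \<sigma> \<theta> by simp
    next
      case False
      have "?\<phi> p = char (distr M borel (\<lambda>\<omega>. d m * ((G p \<omega>)\<^sup>2 - 1))) x"
        using False by (simp add: statistic_term_def pm d_def r)
      also have "\<dots> = char (distr M borel (\<lambda>\<omega>. (G p \<omega>)\<^sup>2 - 1)) (d m * x)"
        by (rule char_distr_scale) (use rv[OF p] in measurable)
      also have "distr M borel (\<lambda>\<omega>. (G p \<omega>)\<^sup>2 - 1) = centered_chi_sq"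
        unfolding std[OF pI, symmetric] using rv[OF p] by (subst distr_distr) (auto simp: comp_def)
      finally have "?\<phi> p = char centered_chi_sq (d m * x)" .
      moreover have "exp (- complex_of_real (\<psi> p)) = exp (- (complex_of_real (d m * x))\<^sup>2)"
        using False by (simp add: \<psi>_def pm)
      ultimately have "cmod (?\<phi> p - exp (- complex_of_real (\<psi> p))) \<le> C * \<bar>d m * x\<bar> ^ 3"
        using C(2)[of "d m * x"] by simp
      also have "\<bar>d m * x\<bar> \<le> \<sigma>\<^sup>2 / (\<theta> * sqrt N) * \<bar>x\<bar>"
        unfolding abs_mult using d[of m] by (intro mult_right_mono) auto
      then have "C * \<bar>d m * x\<bar> ^ 3 \<le> C * (\<sigma>\<^sup>2 / (\<theta> * sqrt N) * \<bar>x\<bar>) ^ 3"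
        using C(1) by (intro mult_left_mono power_mono) auto
      finally show ?thesis .
    qed
  qed
  have \<psi>0: "\<psi> p \<ge> 0" for p by (auto simp: \<psi>_def split: prod.split)
  have "char (distr M borel (statistic \<sigma> \<theta> L)) x = (\<Prod>p\<in>?J. ?\<phi> p)"
    unfolding statistic_def[abs_def] by (rule char_distr_sum[OF indep_statistic_term])
  moreover have "exp (- complex_of_real (\<sigma>\<^sup>2 * x\<^sup>2 * (\<Sum>m<L. (r\<^sup>2) ^ m * (1 + r * (N - Suc m) / N))))
      = (\<Prod>p\<in>?J. exp (- complex_of_real (\<psi> p)))"
  proof -
    have row: "(\<Sum>j\<in>{m..<N}. \<psi> (m, j)) = \<sigma>\<^sup>2 * x\<^sup>2 * ((r\<^sup>2) ^ m * (1 + r * (N - Suc m) / N))" if m: "m < L" for m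
    proof -
      have mN: "m < N" using m L by simp
      have ins: "{m..<N} = insert m {Suc m..<N}" using mN by auto
      have dm: "(d m * x)\<^sup>2 = \<sigma>\<^sup>2 * x\<^sup>2 * (r\<^sup>2) ^ m * r / N"
        using \<sigma> \<theta> N unfolding d_def r by (simp add: power_mult_distrib power_divide field_simps flip: power_mult)
      have "(\<Sum>j\<in>{m..<N}. \<psi> (m, j)) = \<sigma>\<^sup>2 * x\<^sup>2 * (r\<^sup>2) ^ m + (\<Sum>j\<in>{Suc m..<N}. (d m * x)\<^sup>2)"
        unfolding ins by (subst sum.insert) (auto simp: \<psi>_def intro!: sum.cong)
      also have "\<dots> = \<sigma>\<^sup>2 * x\<^sup>2 * (r\<^sup>2) ^ m + real (N - Suc m) * (\<sigma>\<^sup>2 * x\<^sup>2 * (r\<^sup>2) ^ m * r / N)"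
        by (simp add: dm)
      also have "\<dots> = \<sigma>\<^sup>2 * x\<^sup>2 * ((r\<^sup>2) ^ m * (1 + r * (N - Suc m) / N))"
        using mN by (simp add: algebra_simps)
      finally show ?thesis .
    qed
    have "(\<Sum>p\<in>?J. \<psi> p) = (\<Sum>m<L. \<Sum>j\<in>{m..<N}. \<psi> (m, j))"
      by (subst sum.Sigma) auto
    also have "\<dots> = \<sigma>\<^sup>2 * x\<^sup>2 * (\<Sum>m<L. (r\<^sup>2) ^ m * (1 + r * (N - Suc m) / N))"
      by (simp add: row sum_distrib_left)
    finally have "\<sigma>\<^sup>2 * x\<^sup>2 * (\<Sum>m<L. (r\<^sup>2) ^ m * (1 + r * (N - Suc m) / N)) = (\<Sum>p\<in>?J. \<psi> p)" by simp
    then show ?thesis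
      by (simp add: exp_sum sum_negf[symmetric])
  qed
  moreover have "cmod ((\<Prod>p\<in>?J. ?\<phi> p) - (\<Prod>p\<in>?J. exp (- complex_of_real (\<psi> p)))) \<le>
      (\<Sum>p\<in>?J. cmod (?\<phi> p - exp (- complex_of_real (\<psi> p))))"
  proof (rule norm_prod_diff)
    fix p assume p: "p \<in> ?J"
    interpret D: real_distribution "distr M borel (statistic_term \<sigma> \<theta> p)"
      by (rule real_distribution_distr[OF rvt[OF p]])
    show "cmod (?\<phi> p) \<le> 1" by (rule D.cmod_char_le_1)
    show "cmod (exp (- complex_of_real (\<psi> p))) \<le> 1" using \<psi>0[of p] by (simp add: norm_exp_eq_Re)
  qed
  moreover have "(\<Sum>p\<in>?J. cmod (?\<phi> p - exp (- complex_of_real (\<psi> p)))) \<le> L * N * (C * (\<sigma>\<^sup>2 / (\<theta> * sqrt N) * \<bar>x\<bar>) ^ 3)"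
  proof -
    let ?B = "C * (\<sigma>\<^sup>2 / (\<theta> * sqrt N) * \<bar>x\<bar>) ^ 3"
    have B: "?B \<ge> 0" using C(1) \<sigma> \<theta> by simp
    have "(\<Sum>p\<in>?J. cmod (?\<phi> p - exp (- complex_of_real (\<psi> p)))) \<le> real (card ?J) * ?B"
      by (rule sum_bounded_above) (rule term_bound)
    also have "\<dots> \<le> real (L * N) * ?B"
    proof (rule mult_right_mono[OF _ B])
      have "card ?J \<le> card ({..<L} \<times> {..<N})" by (intro card_mono) auto
      then show "real (card ?J) \<le> real (L * N)" by (simp only: card_cartesian_product card_lessThan of_nat_le_iff)
    qed
    finally show ?thesis by simp
  qed
  ultimately show ?thesis by simp
qed

end

context normal_array
begin

lemma statistic_rows:
  assumes "L \<le> N"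
  shows "statistic \<sigma> \<theta> L \<omega> = (\<Sum>m<L. (\<sigma>\<^sup>2 / \<theta>\<^sup>2) ^ m * (sqrt 2 * \<sigma> * G (m, m) \<omega> +
    \<sigma>\<^sup>2 / (\<theta> * sqrt N) * (\<Sum>j\<in>{Suc m..<N}. (G (m, j) \<omega>)\<^sup>2 - 1)))"
proof -
  have "statistic \<sigma> \<theta> L \<omega> = (\<Sum>m<L. \<Sum>j\<in>{m..<N}. statistic_term \<sigma> \<theta> (m, j) \<omega>)"
    unfolding statistic_def by (subst sum.Sigma) auto
  also have "\<dots> = (\<Sum>m<L. (\<sigma>\<^sup>2 / \<theta>\<^sup>2) ^ m * (sqrt 2 * \<sigma> * G (m, m) \<omega> +
    \<sigma>\<^sup>2 / (\<theta> * sqrt N) * (\<Sum>j\<in>{Suc m..<N}. (G (m, j) \<omega>)\<^sup>2 - 1)))"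
  proof (rule sum.cong[OF refl])
    fix m assume "m \<in> {..<L}"
    then have ins: "{m..<N} = insert m {Suc m..<N}" using assms by auto
    have "(\<Sum>j\<in>{Suc m..<N}. statistic_term \<sigma> \<theta> (m, j) \<omega>)
        = (\<sigma>\<^sup>2 / \<theta>\<^sup>2) ^ m * (\<sigma>\<^sup>2 / (\<theta> * sqrt N)) * (\<Sum>j\<in>{Suc m..<N}. (G (m, j) \<omega>)\<^sup>2 - 1)"
      unfolding sum_distrib_left by (rule sum.cong) (auto simp: statistic_term_def)
    moreover have "(\<Sum>j\<in>{m..<N}. statistic_term \<sigma> \<theta> (m, j) \<omega>)
        = statistic_term \<sigma> \<theta> (m, m) \<omega> + (\<Sum>j\<in>{Suc m..<N}. statistic_term \<sigma> \<theta> (m, j) \<omega>)"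
      unfolding ins by (subst sum.insert) auto
    ultimately show "(\<Sum>j\<in>{m..<N}. statistic_term \<sigma> \<theta> (m, j) \<omega>) = (\<sigma>\<^sup>2 / \<theta>\<^sup>2) ^ m * (sqrt 2 * \<sigma> * G (m, m) \<omega> +
        \<sigma>\<^sup>2 / (\<theta> * sqrt N) * (\<Sum>j\<in>{Suc m..<N}. (G (m, j) \<omega>)\<^sup>2 - 1))"
      by (simp add: statistic_term_def distrib_left mult.assoc)
  qed
  finally show ?thesis .
qed

text \<open>The linearisation at a fixed sample point: outside the exceptional event, survival of
  the chain and an inequality for the statistic agree up to the margin \<open>err\<close>. The two
  arguments of \<open>deviation\<close> are what the bound \<eta> on the diagonal term and on the
  fluctuation of the row sum become for standardised entries.\<close>

lemma chain_iff_statistic: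
  fixes r \<delta> \<eta> s q C err t :: real and Y :: "nat \<times> nat \<Rightarrow> real"
  assumes \<sigma>: "\<sigma> > 0" and \<theta>: "\<theta> > \<sigma>" and \<eta>: "\<eta> > 0" and L: "2 * L < N"
    and Y: "Y = (\<lambda>p. \<sigma> / sqrt N * G p \<omega>)" and t: "t = rho \<sigma> \<theta> + s / sqrt N"
    and good: "\<omega> \<in> space M" "\<omega> \<notin> deviation (N * \<eta>\<^sup>2 / (2 * \<sigma>\<^sup>2) - 1) (N * \<eta> / \<sigma>\<^sup>2)"
    and q: "(\<sigma>\<^sup>2 + 2 * \<eta>) / (\<theta> * \<sigma>) \<le> q" "q < 1" and s: "\<bar>s\<bar> / sqrt N \<le> 2 * \<eta>"
    and LN: "\<sigma>\<^sup>2 * (2 * L) / N \<le> \<eta>" and t_ge: "2 * \<sigma> + \<eta> + \<eta> / \<sigma> \<le> t" and t_le: "t + \<eta> \<le> C"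
    and r: "r = \<sigma>\<^sup>2 / \<theta>\<^sup>2" and \<delta>: "\<delta> = 2 * \<eta> * (2 + 1 / \<theta>) / (1 - q) + q ^ L * (C + \<theta>)"
    and err: "err = sqrt N * ((2 * \<eta> * \<theta> + \<sigma>\<^sup>2 * \<delta>) / (\<theta>\<^sup>2 * \<sigma>) * \<delta> / (1 - r) + r ^ L * (\<delta> + 2 * \<eta> / (1 - r)))
        + (real L)\<^sup>2 * (\<sigma>\<^sup>2 / (\<theta> * sqrt N))"
  shows "statistic \<sigma> \<theta> L \<omega> < s / (1 - r) - err \<Longrightarrow> chain t N Y N \<theta>"
    and "chain t N Y N \<theta> \<Longrightarrow> statistic \<sigma> \<theta> L \<omega> < s / (1 - r) + err"
proof -
  have \<theta>0: "\<theta> > 0" using \<sigma> \<theta> by simp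
  have r01: "0 < r" "r < 1" using \<sigma> \<theta> by (auto simp: r power_strict_mono)
  have N0: "N > 0" "real N > 0" using L by auto
  define a b where "a m = sqrt 2 * Y (m, m)" and "b m = entry_sq_sum N Y m" for m
  define S where "S m = (\<Sum>j\<in>{Suc m..<N}. (G (m, j) \<omega>)\<^sup>2 - 1)" for m
  have a: "\<bar>a m\<bar> \<le> \<eta>" if "m < N" for m
  proof -
    have "(G (m, m) \<omega>)\<^sup>2 < N * \<eta>\<^sup>2 / (2 * \<sigma>\<^sup>2)"
      using good that unfolding deviation_def by (force simp: abs_le_iff not_le)
    then have "(a m)\<^sup>2 \<le> \<eta>\<^sup>2"
      using \<sigma> N0 by (simp add: a_def Y power_mult_distrib power_divide field_simps)
    then show ?thesis using \<eta> by (simp add: abs_le_square_iff[symmetric])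
  qed
  have b_eq: "b m = \<sigma>\<^sup>2 / N * (S m + (real N - real m - 1))" if "m < N" for m
  proof -
    have "b m = \<sigma>\<^sup>2 / N * (\<Sum>j\<in>{Suc m..<N}. (G (m, j) \<omega>)\<^sup>2)"
      using N0 by (simp add: b_def Y power_mult_distrib power_divide sum_distrib_left)
    also have "(\<Sum>j\<in>{Suc m..<N}. (G (m, j) \<omega>)\<^sup>2) = S m + (real N - real m - 1)"
      using that by (simp add: S_def sum_subtractf of_nat_diff)
    finally show ?thesis .
  qed
  have S: "\<bar>\<sigma>\<^sup>2 / N * S m\<bar> \<le> \<eta>" if "m < N" for m
  proof -
    have "\<bar>S m\<bar> < N * \<eta> / \<sigma>\<^sup>2"
      using good that unfolding deviation_def S_def by (force simp: not_le)
    then show ?thesis using \<sigma> N0 by (simp add: abs_mult field_simps)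
  qed
  have b: "\<bar>b m - \<sigma>\<^sup>2 + \<sigma>\<^sup>2 / N * (real m + 1)\<bar> \<le> \<eta>" if "m < N" for m
  proof -
    have "b m - \<sigma>\<^sup>2 + \<sigma>\<^sup>2 / N * (real m + 1) = \<sigma>\<^sup>2 / N * S m"
      using N0 by (simp add: b_eq[OF that] field_simps)
    then show ?thesis using S[OF that] by simp
  qed
  have b_le: "b m \<le> \<sigma>\<^sup>2 + \<eta>" if "m < N" for m
  proof -
    have "0 \<le> \<sigma>\<^sup>2 / N * (real m + 1)" by simp
    then show ?thesis using b[OF that] by linarith
  qed
  \<comment> \<open>One \<eta> pays for the fluctuation and one for the mean \<sigma>^2 (1 - (m + 1)
    / N), which is close to \<sigma>^2 in the first 2 L rows.\<close>
  have b_near: "\<bar>b m - \<sigma>\<^sup>2\<bar> \<le> 2 * \<eta>" if m: "m < 2 * L" for m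
  proof -
    have "\<sigma>\<^sup>2 / N * (real m + 1) \<le> \<sigma>\<^sup>2 / N * (2 * L)" using m by (intro mult_left_mono) auto
    also have "\<dots> \<le> \<eta>" using LN by simp
    finally have "\<sigma>\<^sup>2 / N * (real m + 1) \<le> \<eta>" .
    moreover have "0 \<le> \<sigma>\<^sup>2 / N * (real m + 1)" by simp
    moreover have "\<bar>b m - \<sigma>\<^sup>2 + \<sigma>\<^sup>2 / N * (real m + 1)\<bar> \<le> \<eta>" using b m L by simp
    ultimately show ?thesis by linarith
  qed
  have ge: "\<sigma> \<le> threshold t N Y (Suc k)" if "k < N" for k
    by (rule threshold_ge[of _ _ _ _ \<eta>])
       (use that \<sigma> a b_le t_ge \<eta> in \<open>auto simp: a_def[symmetric] b_def[symmetric] abs_le_iff\<close>)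
  \<comment> \<open>\<open>threshold\<close> counts rows from the bottom of the matrix. D is indexed
    by the row, so that D 0 belongs to the whole chain.\<close>
  define D where "D m = threshold t N Y (N - m)" for m
  have D_ge: "\<sigma> \<le> D m" if "m < N" for m
    using ge[of "N - Suc m"] that by (simp add: D_def Suc_diff_Suc)
  have D_rec: "D m = t - a m - b m / D (Suc m)" if m: "m < N" for m
  proof -
    obtain k where k: "N - m = Suc k" using m by (metis Suc_diff_Suc)
    then have k': "N - Suc k = m" "N - Suc m = k" using m by auto
    show ?thesis unfolding D_def k k'(2) threshold.simps k'(1) a_def b_def ..
  qed
  have "D (2 * L) \<le> C"
  proof -
    \<comment> \<open>If 2 L is the last row, the denominator is the conventional value of
      \<open>threshold\<close> at 0, and the empty sum b (2 * L) makes the quotient vanish.\<close>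
    have "0 \<le> b (2 * L) / D (Suc (2 * L))"
    proof (cases "Suc (2 * L) < N")
      case True
      then show ?thesis using D_ge[OF True] \<sigma> by (simp add: b_def sum_nonneg)
    next
      case False
      then have "b (2 * L) = 0" by (simp add: b_def)
      then show ?thesis by simp
    qed
    then show ?thesis using D_rec[OF L] a[OF L] t_le by linarith
  qed
  note D_end = this
  have lin: "\<bar>D 0 - \<theta> - ((t - rho \<sigma> \<theta>) / (1 - r) - (\<Sum>m<L. r ^ m * (a m + (b m - \<sigma>\<^sup>2) / \<theta>)))\<bar>
    \<le> (2 * \<eta> * \<theta> + \<sigma>\<^sup>2 * \<delta>) / (\<theta>\<^sup>2 * \<sigma>) * \<delta> / (1 - r) + r ^ L * (\<delta> + 2 * \<eta> / (1 - r))"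
  proof (rule threshold_linearize[where L = L and q = q and C = C and \<delta> = \<delta>, OF \<sigma> \<theta> _ D_rec D_ge D_end _ b_near _ q])
    show "\<bar>t - rho \<sigma> \<theta>\<bar> \<le> 2 * \<eta>" using s N0 by (simp add: t)
    show "\<bar>a m\<bar> \<le> 2 * \<eta>" if "m < 2 * L" for m using a[of m] that L \<eta> by linarith
  qed (use \<eta> L r \<delta> in \<open>simp_all\<close>)
  \<comment> \<open>The deterministic part of the linear form, caused by the row means lying below
    \<sigma>^2.\<close>
  define \<kappa> where "\<kappa> = (\<Sum>m<L. r ^ m * (\<sigma>\<^sup>2 / (\<theta> * sqrt N) * (real m + 1)))"
  have \<kappa>: "0 \<le> \<kappa>" "\<kappa> \<le> (real L)\<^sup>2 * (\<sigma>\<^sup>2 / (\<theta> * sqrt N))"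
  proof -
    define k where "k = \<sigma>\<^sup>2 / (\<theta> * sqrt N)"
    have k: "0 \<le> k" using \<sigma> \<theta>0 by (simp add: k_def)
    show "0 \<le> \<kappa>" unfolding \<kappa>_def k_def[symmetric] using r01 k by (intro sum_nonneg mult_nonneg_nonneg) auto
    have "\<kappa> \<le> (\<Sum>m<L. 1 * (k * L))"
      unfolding \<kappa>_def k_def[symmetric] using r01 k by (intro sum_mono mult_mono power_le_one) auto
    then show "\<kappa> \<le> (real L)\<^sup>2 * (\<sigma>\<^sup>2 / (\<theta> * sqrt N))"
      unfolding k_def[symmetric] by (simp add: power2_eq_square mult_ac)
  qed
  have "sqrt N * (\<Sum>m<L. r ^ m * (a m + (b m - \<sigma>\<^sup>2) / \<theta>)) = statistic \<sigma> \<theta> L \<omega> - \<kappa>"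
  proof -
    have "sqrt N * (r ^ m * (a m + (b m - \<sigma>\<^sup>2) / \<theta>))
        = r ^ m * (sqrt 2 * \<sigma> * G (m, m) \<omega> + \<sigma>\<^sup>2 / (\<theta> * sqrt N) * S m) - r ^ m * (\<sigma>\<^sup>2 / (\<theta> * sqrt N) * (real m + 1))"
      if m: "m < L" for m
    proof -
      have sN: "sqrt N > 0" "real N = sqrt N * sqrt N" using N0 by auto
      have "sqrt N * a m = sqrt 2 * \<sigma> * G (m, m) \<omega>" using sN by (simp add: a_def Y)
      moreover have "sqrt N * ((b m - \<sigma>\<^sup>2) / \<theta>) = \<sigma>\<^sup>2 / (\<theta> * sqrt N) * S m - \<sigma>\<^sup>2 / (\<theta> * sqrt N) * (real m + 1)"
      proof -
        have "b m - \<sigma>\<^sup>2 = \<sigma>\<^sup>2 / N * (S m - (real m + 1))"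
          using N0 m L by (simp add: b_eq field_simps)
        then have "sqrt N * ((b m - \<sigma>\<^sup>2) / \<theta>) = sqrt N * (\<sigma>\<^sup>2 / (sqrt N * sqrt N) * (S m - (real m + 1)) / \<theta>)"
          using sN(2) by simp
        also have "\<dots> = \<sigma>\<^sup>2 / (\<theta> * sqrt N) * (S m - (real m + 1))"
        proof -
          have "w * (k / (w * w) * z / \<theta>) = k / (\<theta> * w) * z" if "w > 0" for w k z :: real
            using that by simp
          then show ?thesis using sN(1) .
        qed
        finally show ?thesis by (simp add: right_diff_distrib)
      qed
      ultimately have "sqrt N * (a m + (b m - \<sigma>\<^sup>2) / \<theta>) = sqrt 2 * \<sigma> * G (m, m) \<omega> + \<sigma>\<^sup>2 / (\<theta> * sqrt N) * S m - \<sigma>\<^sup>2 / (\<theta> * sqrt N) * (real m + 1)"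
        by (simp only: distrib_left)
      then have "r ^ m * (sqrt N * (a m + (b m - \<sigma>\<^sup>2) / \<theta>)) = r ^ m * (sqrt 2 * \<sigma> * G (m, m) \<omega> + \<sigma>\<^sup>2 / (\<theta> * sqrt N) * S m - \<sigma>\<^sup>2 / (\<theta> * sqrt N) * (real m + 1))"
        by simp
      then show ?thesis by (simp only: right_diff_distrib mult.left_commute)
    qed
    then have "sqrt N * (\<Sum>m<L. r ^ m * (a m + (b m - \<sigma>\<^sup>2) / \<theta>))
       = (\<Sum>m<L. r ^ m * (sqrt 2 * \<sigma> * G (m, m) \<omega> + \<sigma>\<^sup>2 / (\<theta> * sqrt N) * S m)) - \<kappa>"
      unfolding \<kappa>_def sum_distrib_left sum_subtractf[symmetric] by (intro sum.cong) auto
    then show ?thesis using L by (simp add: statistic_rows S_def r)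
  qed
  moreover have "sqrt N * ((t - rho \<sigma> \<theta>) / (1 - r)) = s / (1 - r)"
    using N0 by (simp add: t)
  ultimately have eq: "sqrt N * (D 0 - \<theta> - ((t - rho \<sigma> \<theta>) / (1 - r) - (\<Sum>m<L. r ^ m * (a m + (b m - \<sigma>\<^sup>2) / \<theta>))))
      = sqrt N * (D 0 - \<theta>) - s / (1 - r) + (statistic \<sigma> \<theta> L \<omega> - \<kappa>)"
    by (simp only: right_diff_distrib)
  have "\<bar>sqrt N * (D 0 - \<theta>) - s / (1 - r) + (statistic \<sigma> \<theta> L \<omega> - \<kappa>)\<bar>
      \<le> sqrt N * ((2 * \<eta> * \<theta> + \<sigma>\<^sup>2 * \<delta>) / (\<theta>\<^sup>2 * \<sigma>) * \<delta> / (1 - r) + r ^ L * (\<delta> + 2 * \<eta> / (1 - r)))"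
    unfolding eq[symmetric] abs_mult using lin by (simp add: mult_left_mono)
  then have close: "\<bar>sqrt N * (D 0 - \<theta>) - (s / (1 - r) - statistic \<sigma> \<theta> L \<omega>)\<bar> \<le> err"
    using \<kappa> unfolding err by linarith
  have "chain t N Y (Suc (N - 1)) \<theta> \<longleftrightarrow> \<theta> < threshold t N Y (Suc (N - 1))"
  proof (rule chain_iff_less_threshold)
    fix i assume i: "0 < i" "i \<le> N - 1"
    then have "i - 1 < N" "Suc (i - 1) = i" using N0 by auto
    then show "threshold t N Y i > 0" using ge[of "i - 1"] \<sigma> by simp
  qed (use N0 in auto)
  then have iff: "chain t N Y N \<theta> \<longleftrightarrow> \<theta> < D 0" using N0 by (simp add: D_def)
  show "chain t N Y N \<theta>" if "statistic \<sigma> \<theta> L \<omega> < s / (1 - r) - err"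
  proof -
    have "0 < sqrt N * (D 0 - \<theta>)" using close that by linarith
    then show ?thesis unfolding iff using N0 by (simp add: zero_less_mult_iff)
  qed
  show "statistic \<sigma> \<theta> L \<omega> < s / (1 - r) + err" if "chain t N Y N \<theta>"
  proof -
    have "0 < sqrt N * (D 0 - \<theta>)" using that N0 unfolding iff by simp
    then show ?thesis using close by linarith
  qed
qed

end

section \<open>Centered Gaussian laws on the line\<close>

lemma gauss_eq_distr_std_normal:
  assumes "v > 0"
  shows "gauss v = distr std_normal_distribution borel (\<lambda>x. v * x)"
proof -
  interpret N: prob_space std_normal_distribution by (rule prob_space_normal_density) simp
  have "distributed std_normal_distribution lborel (\<lambda>x. x) std_normal_density"
    by (simp add: distributed_def distr_id2)
  from N.normal_density_affine[OF this, of v 0] assms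
  have "distr std_normal_distribution lborel (\<lambda>x. v * x) = gauss v"
    by (simp add: distributed_def)
  moreover have "distr std_normal_distribution lborel (\<lambda>x. v * x) = distr std_normal_distribution borel (\<lambda>x. v * x)"
    by (rule distr_cong) auto
  ultimately show ?thesis by simp
qed

lemma real_distribution_gauss: "v > 0 \<Longrightarrow> real_distribution (gauss v)"
  using prob_space_normal_density[of v 0] by (auto simp: real_distribution_def real_distribution_axioms_def)

lemma char_gauss:
  assumes "v > 0"
  shows "char (gauss v) x = exp (- complex_of_real (v\<^sup>2 * x\<^sup>2 / 2))"
proof -
  interpret N: prob_space std_normal_distribution by (rule prob_space_normal_density) simp
  have "char (gauss v) x = char (distr std_normal_distribution borel (\<lambda>x. x)) (v * x)"
    unfolding gauss_eq_distr_std_normal[OF assms] by (rule N.char_distr_scale) simp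
  also have "distr std_normal_distribution borel (\<lambda>x. x) = std_normal_distribution"
    by (rule distr_id2) simp
  finally show ?thesis by (simp add: char_std_normal_distribution power_mult_distrib flip: exp_of_real)
qed

lemma isCont_cdf_gauss:
  assumes "v > 0"
  shows "isCont (cdf (gauss v)) x"
proof -
  interpret D: real_distribution "gauss v" by (rule real_distribution_gauss[OF assms])
  have "emeasure (gauss v) {x} = 0"
    by (subst emeasure_density) (auto simp: nn_integral_0_iff_AE intro: AE_mp[OF AE_lborel_singleton[of x]])
  then show ?thesis by (simp add: D.isCont_cdf measure_def)
qed

text \<open>Moves the factor 1 / (1 - r) from the argument s into the variance of the limit
  law.\<close>

lemma cdf_gauss_scale:
  assumes "v > 0" "c > 0"
  shows "cdf (gauss v) (x / c) = cdf (gauss (c * v)) x"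
proof -
  have scale: "cdf (gauss w) y = cdf std_normal_distribution (y / w)" if "w > 0" for w y
  proof -
    have "(\<lambda>z. w * z) -` {..y} = {..y / w}" by (auto simp: pos_le_divide_eq[OF that] mult.commute)
    then show ?thesis
      unfolding gauss_eq_distr_std_normal[OF that] cdf_def by (subst measure_distr) auto
  qed
  show ?thesis
    unfolding scale[OF assms(1)] scale[OF mult_pos_pos[OF assms(2,1)]] by simp
qed

text \<open>Any cutoff that is \<open>o(N\<^sup>1\<^sup>/\<^sup>4)\<close> but large compared with \<open>ln N\<close> would do.\<close>

definition cutoff :: "nat \<Rightarrow> nat" where
  "cutoff N = nat \<lfloor>real N powr (1 / 8)\<rfloor>"

lemma cutoff_bounds: "real (cutoff N) \<le> real N powr (1 / 8)" "real N powr (1 / 8) - 1 \<le> real (cutoff N)"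
  unfolding cutoff_def by (simp_all add: of_nat_nat)

lemma filterlim_cutoff: "filterlim cutoff sequentially sequentially"
proof -
  have "filterlim (\<lambda>N. real N powr (1 / 8) - 1) at_top sequentially" by real_asymp
  then have "filterlim (\<lambda>N. real (cutoff N)) at_top sequentially"
    by (rule filterlim_at_top_mono) (auto intro: always_eventually cutoff_bounds)
  then show ?thesis by (simp add: filterlim_sequentially_iff_filterlim_real)
qed

text \<open>The index is shifted by one because the continuity theorem wants a probability law at
  every index, while an array is given for positive N. The exponent tends to \<sigma>^2 x^2 (1 + r)
  / (1 - r^2) = \<sigma>^2 x^2 / (1 - r).\<close>

lemma weak_conv_statistic:
  fixes P :: "nat \<Rightarrow> 'a measure"
  assumes \<sigma>: "\<sigma> > 0" and \<theta>: "\<theta> > \<sigma>" and arr: "\<And>N. N > 0 \<Longrightarrow> normal_array (P N) N (G N)"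
    and r: "r = \<sigma>\<^sup>2 / \<theta>\<^sup>2"
  shows "weak_conv_m (\<lambda>n. distr (P (Suc n)) borel (normal_array.statistic (Suc n) (G (Suc n)) \<sigma> \<theta> (cutoff (Suc n))))
      (gauss (sqrt (2 * \<sigma>\<^sup>2 / (1 - r))))"
proof (rule levy_continuity)
  have r01: "0 < r" "r < 1" using \<sigma> \<theta> by (auto simp: r power_strict_mono)
  let ?T = "\<lambda>N. normal_array.statistic N (G N) \<sigma> \<theta> (cutoff N)"
  show "real_distribution (distr (P (Suc n)) borel (?T (Suc n)))" for n
  proof -
    interpret A: normal_array "P (Suc n)" "Suc n" "G (Suc n)" by (rule arr) simp
    show ?thesis by (rule A.real_distribution_distr[OF A.measurable_statistic])
  qed
  have v: "sqrt (2 * \<sigma>\<^sup>2 / (1 - r)) > 0" using \<sigma> r01 by simp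
  show "real_distribution (gauss (sqrt (2 * \<sigma>\<^sup>2 / (1 - r))))" by (rule real_distribution_gauss[OF v])
  fix x :: real
  obtain C where C: "C \<ge> 0" "\<And>t. cmod (char centered_chi_sq t - exp (- (complex_of_real t)\<^sup>2)) \<le> C * \<bar>t\<bar> ^ 3"
    using char_centered_chi_sq by blast
  define w where "w N = (\<Sum>m<cutoff N. (r\<^sup>2) ^ m * (1 + r * real (N - Suc m) / N))" for N
  have cut_le: "cutoff N \<le> N" if "N > 0" for N
  proof -
    have "real N powr (1 / 8) \<le> real N powr 1" using that by (intro powr_mono) auto
    then have "real (cutoff N) \<le> real N" using cutoff_bounds(1)[of N] that by simp
    then show ?thesis by simp
  qed
  have w_lim: "w \<longlonglongrightarrow> 1 / (1 - r)"
  proof -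
    have r2: "norm (r\<^sup>2) < 1" using r01 by (simp add: abs_square_less_1)
    have "(\<lambda>n. \<Sum>m<n. (r\<^sup>2) ^ m) \<longlonglongrightarrow> 1 / (1 - r\<^sup>2)"
      using geometric_sums[OF r2] unfolding sums_def .
    then have g: "(\<lambda>N. \<Sum>m<cutoff N. (r\<^sup>2) ^ m) \<longlonglongrightarrow> 1 / (1 - r\<^sup>2)"
      by (rule filterlim_compose[OF _ filterlim_cutoff])
    \<comment> \<open>Row m has N - m - 1 rather than N off-diagonal entries; over the rows below
      the cutoff L this changes the sum by at most L^2 / N.\<close>
    define e where "e N = (1 + r) * (\<Sum>m<cutoff N. (r\<^sup>2) ^ m) - w N" for N
    have e_eq: "e N = (\<Sum>m<cutoff N. (r\<^sup>2) ^ m * (r * (real m + 1) / N))" if N: "N > 0" for N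
    proof -
      have "(1 + r) * (r\<^sup>2) ^ m - (r\<^sup>2) ^ m * (1 + r * real (N - Suc m) / N) = (r\<^sup>2) ^ m * (r * (real m + 1) / N)"
        if "m < cutoff N" for m
      proof -
        have "real (N - Suc m) = real N - (real m + 1)" using that cut_le[OF N] by (simp add: of_nat_diff)
        then show ?thesis using N by (simp add: field_simps)
      qed
      then show ?thesis unfolding e_def w_def sum_distrib_left sum_subtractf[symmetric] by (intro sum.cong) auto
    qed
    have "e \<longlonglongrightarrow> 0"
    proof (rule tendsto_sandwich[OF _ _ tendsto_const])
      show "\<forall>\<^sub>F N in sequentially. 0 \<le> e N"
        using eventually_gt_at_top[of 0]
        by eventually_elim (use r01 in \<open>auto simp: e_eq intro!: sum_nonneg mult_nonneg_nonneg divide_nonneg_nonneg\<close>)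
      show "\<forall>\<^sub>F N in sequentially. e N \<le> real N powr (1 / 8) * real N powr (1 / 8) / N"
        using eventually_gt_at_top[of 0]
      proof eventually_elim
        case (elim N)
        have "e N \<le> (\<Sum>m<cutoff N. 1 * (1 * real (cutoff N) / N))"
          unfolding e_eq[OF elim] using r01
          by (intro sum_mono mult_mono power_le_one divide_right_mono) (auto simp: power_le_one)
        also have "\<dots> = real (cutoff N) * real (cutoff N) / N" by simp
        also have "\<dots> \<le> real N powr (1 / 8) * real N powr (1 / 8) / N"
          using cutoff_bounds(1) by (intro divide_right_mono mult_mono) auto
        finally show ?case .
      qed
      show "(\<lambda>N. real N powr (1 / 8) * real N powr (1 / 8) / real N) \<longlonglongrightarrow> 0" by real_asymp
    qed
    then have "(\<lambda>N. (1 + r) * (\<Sum>m<cutoff N. (r\<^sup>2) ^ m) - e N) \<longlonglongrightarrow> (1 + r) * (1 / (1 - r\<^sup>2)) - 0"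
      by (intro tendsto_intros g)
    moreover have "(1 + r) * (1 / (1 - r\<^sup>2)) = 1 / (1 - r)"
    proof -
      have "1 - r\<^sup>2 = (1 + r) * (1 - r)" by (simp add: power2_eq_square algebra_simps)
      then show ?thesis using r01 by simp
    qed
    ultimately show ?thesis by (simp add: e_def)
  qed
  have lim: "(\<lambda>N. exp (- complex_of_real (\<sigma>\<^sup>2 * x\<^sup>2 * w N))) \<longlonglongrightarrow> exp (- complex_of_real (\<sigma>\<^sup>2 * x\<^sup>2 * (1 / (1 - r))))"
    by (intro tendsto_intros w_lim)
  have lim_eq: "exp (- complex_of_real (\<sigma>\<^sup>2 * x\<^sup>2 * (1 / (1 - r)))) = char (gauss (sqrt (2 * \<sigma>\<^sup>2 / (1 - r)))) x"
  proof -
    have "(sqrt (2 * \<sigma>\<^sup>2 / (1 - r)))\<^sup>2 = 2 * \<sigma>\<^sup>2 / (1 - r)" using r01 by simp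
    then have "(sqrt (2 * \<sigma>\<^sup>2 / (1 - r)))\<^sup>2 * x\<^sup>2 / 2 = \<sigma>\<^sup>2 * x\<^sup>2 * (1 / (1 - r))"
    proof -
      have "2 * a / b * c / 2 = a * c * (1 / b)" for a b c :: real by simp
      then show ?thesis using \<open>(sqrt (2 * \<sigma>\<^sup>2 / (1 - r)))\<^sup>2 = 2 * \<sigma>\<^sup>2 / (1 - r)\<close> by (simp only:)
    qed
    then show ?thesis unfolding char_gauss[OF v] by (simp only:)
  qed
  have diff: "(\<lambda>N. char (distr (P N) borel (?T N)) x - exp (- complex_of_real (\<sigma>\<^sup>2 * x\<^sup>2 * w N))) \<longlonglongrightarrow> 0"
  proof (rule Lim_null_comparison)
    show "\<forall>\<^sub>F N in sequentially. norm (char (distr (P N) borel (?T N)) x - exp (- complex_of_real (\<sigma>\<^sup>2 * x\<^sup>2 * w N)))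
       \<le> (C * (\<sigma>\<^sup>2 / \<theta> * \<bar>x\<bar>) ^ 3) * (real N powr (1 / 8) * N * (1 / sqrt N) ^ 3)"
      using eventually_gt_at_top[of 0]
    proof eventually_elim
      case (elim N)
      interpret A: normal_array "P N" N "G N" by (rule arr[OF elim])
      have "norm (char (distr (P N) borel (?T N)) x - exp (- complex_of_real (\<sigma>\<^sup>2 * x\<^sup>2 * w N)))
         \<le> cutoff N * N * (C * (\<sigma>\<^sup>2 / (\<theta> * sqrt N) * \<bar>x\<bar>) ^ 3)"
        unfolding w_def by (rule A.char_statistic_bound[OF \<sigma> \<theta> elim C cut_le[OF elim] r])
      also have "\<dots> \<le> real N powr (1 / 8) * N * (C * (\<sigma>\<^sup>2 / (\<theta> * sqrt N) * \<bar>x\<bar>) ^ 3)"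
      proof (rule mult_right_mono)
        have "real (cutoff N) * real N \<le> real N powr (1 / 8) * real N"
          by (rule mult_right_mono[OF cutoff_bounds(1)]) simp
        then show "real (cutoff N * N) \<le> real N powr (1 / 8) * real N" by simp
      qed (use C(1) \<sigma> \<theta> in simp)
      also have "\<dots> = (C * (\<sigma>\<^sup>2 / \<theta> * \<bar>x\<bar>) ^ 3) * (real N powr (1 / 8) * N * (1 / sqrt N) ^ 3)"
        by (simp add: power_mult_distrib power_divide)
      finally show ?case .
    qed
    \<comment> \<open>The order is N^(1/8 + 1 - 3/2): number of factors times the cubic remainder of
      each.\<close>
    have "(\<lambda>N. real N powr (1 / 8) * N * (1 / sqrt N) ^ 3) \<longlonglongrightarrow> 0" by real_asymp
    then show "(\<lambda>N. (C * (\<sigma>\<^sup>2 / \<theta> * \<bar>x\<bar>) ^ 3) * (real N powr (1 / 8) * N * (1 / sqrt N) ^ 3)) \<longlonglongrightarrow> 0"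
      by (rule tendsto_mult_right_zero)
  qed
  have "(\<lambda>N. char (distr (P N) borel (?T N)) x) \<longlonglongrightarrow> char (gauss (sqrt (2 * \<sigma>\<^sup>2 / (1 - r)))) x"
    by (rule Lim_transform[OF lim[unfolded lim_eq] diff])
  then show "(\<lambda>n. char (distr (P (Suc n)) borel (?T (Suc n))) x) \<longlonglongrightarrow> char (gauss (sqrt (2 * \<sigma>\<^sup>2 / (1 - r)))) x"
    by (rule LIMSEQ_Suc)
qed

section \<open>The limit law of the chain\<close>

text \<open>Convergence of F n is used at two points shifted by a fixed amount, and continuity of
  the limit removes the shift. In the application d n is the probability of the exceptional
  event.\<close>

lemma LIMSEQ_sandwich_cdf:
  fixes F :: "nat \<Rightarrow> real \<Rightarrow> real" and \<Phi> :: "real \<Rightarrow> real"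
  assumes F: "\<And>x. (\<lambda>n. F n x) \<longlonglongrightarrow> \<Phi> x" and cont: "isCont \<Phi> u" and d: "d \<longlonglongrightarrow> 0"
    and le: "\<And>\<epsilon>. \<epsilon> > 0 \<Longrightarrow> \<forall>\<^sub>F n in sequentially. F n (u - \<epsilon>) - d n \<le> p n \<and> p n \<le> F n (u + \<epsilon>) + d n"
  shows "p \<longlonglongrightarrow> \<Phi> u"
proof (rule LIMSEQ_I)
  fix e :: real assume e: "e > 0"
  obtain h where h: "h > 0" "\<And>x. \<bar>x - u\<bar> < h \<Longrightarrow> \<bar>\<Phi> x - \<Phi> u\<bar> < e / 3"
    using cont[unfolded continuous_at_eps_delta dist_real_def, rule_format, of "e / 3"] e by auto
  have h2: "\<bar>\<Phi> (u - h / 2) - \<Phi> u\<bar> < e / 3" "\<bar>\<Phi> (u + h / 2) - \<Phi> u\<bar> < e / 3"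
    using h by auto
  have "\<forall>\<^sub>F n in sequentially. \<bar>F n (u - h / 2) - \<Phi> (u - h / 2)\<bar> < e / 3"
    "\<forall>\<^sub>F n in sequentially. \<bar>F n (u + h / 2) - \<Phi> (u + h / 2)\<bar> < e / 3"
    "\<forall>\<^sub>F n in sequentially. \<bar>d n\<bar> < e / 3"
    using tendstoD[OF F, of "e / 3" "u - h / 2"] tendstoD[OF F, of "e / 3" "u + h / 2"] tendstoD[OF d, of "e / 3"] e
    by (simp_all add: dist_real_def)
  moreover have "\<forall>\<^sub>F n in sequentially. F n (u - h / 2) - d n \<le> p n \<and> p n \<le> F n (u + h / 2) + d n"
    using le[of "h / 2"] h by simp
  ultimately have "\<forall>\<^sub>F n in sequentially. \<bar>p n - \<Phi> u\<bar> < e"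
    by eventually_elim (use h2 in linarith)
  then show "\<exists>n0. \<forall>n\<ge>n0. norm (p n - \<Phi> u) < e"
    by (simp add: eventually_sequentially)
qed

text \<open>The geometric factor decays like exp (- c N^(1/8)), faster than any power. The power 1/4
  is the half of sqrt N that is given to each small factor of the error.\<close>

lemma LIMSEQ_power_cutoff:
  fixes q :: real
  assumes q: "0 < q" "q < 1"
  shows "(\<lambda>N. real N powr (1 / 4) * q ^ cutoff N) \<longlonglongrightarrow> 0"
proof (rule tendsto_sandwich[OF _ _ tendsto_const])
  define c where "c = - ln q"
  have c: "c > 0" using q by (simp add: c_def)
  have qc: "q = exp (- c)" using q by (simp add: c_def)
  show "\<forall>\<^sub>F N in sequentially. 0 \<le> real N powr (1 / 4) * q ^ cutoff N" using q by simp
  show "\<forall>\<^sub>F N in sequentially. real N powr (1 / 4) * q ^ cutoff N \<le> real N powr (1 / 4) * exp (c - c * real N powr (1 / 8))"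
  proof (rule always_eventually, rule allI, rule mult_left_mono)
    fix N
    have "q ^ cutoff N = exp (- c * cutoff N)" unfolding qc by (simp flip: exp_of_nat2_mult)
    also have "\<dots> \<le> exp (c - c * real N powr (1 / 8))"
    proof -
      have "c * (real N powr (1 / 8) - 1) \<le> c * cutoff N" using cutoff_bounds(2)[of N] c by (intro mult_left_mono) auto
      then show ?thesis by (simp add: algebra_simps)
    qed
    finally show "q ^ cutoff N \<le> exp (c - c * real N powr (1 / 8))" .
  qed simp
  show "(\<lambda>N. real N powr (1 / 4) * exp (c - c * real N powr (1 / 8))) \<longlonglongrightarrow> 0"
    using c by real_asymp
qed

text \<open>Supplies the hypotheses of \<open>chain_iff_statistic\<close>. The exponent 3/10 lies
  between 1/4 and 1/2: above 1/4 the quadratic error sqrt N * \<eta>^2 vanishes, and below 1/2 the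
  scale \<eta> dominates s / sqrt N while N \<eta>^2 grows like a power of N, as the concentration
  bound needs.\<close>

lemma eventually_conditions:
  fixes \<sigma> \<theta> s :: real
  assumes \<sigma>: "\<sigma> > 0" and \<theta>: "\<theta> > \<sigma>"
  defines "\<eta> \<equiv> \<lambda>N::nat. real N powr (- 3 / 10)"
  shows "\<forall>\<^sub>F N in sequentially. 2 * cutoff N < N"
    "\<forall>\<^sub>F N in sequentially. (\<sigma>\<^sup>2 + 2 * \<eta> N) / (\<theta> * \<sigma>) \<le> (1 + \<sigma> / \<theta>) / 2"
    "\<forall>\<^sub>F N in sequentially. \<bar>s\<bar> / sqrt N \<le> 2 * \<eta> N"
    "\<forall>\<^sub>F N in sequentially. \<sigma>\<^sup>2 * (2 * cutoff N) / N \<le> \<eta> N"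
    "\<forall>\<^sub>F N in sequentially. 2 * \<sigma> + \<eta> N + \<eta> N / \<sigma> \<le> rho \<sigma> \<theta> + s / sqrt N"
    "\<forall>\<^sub>F N in sequentially. rho \<sigma> \<theta> + s / sqrt N + \<eta> N \<le> rho \<sigma> \<theta> + 1"
proof -
  have \<theta>0: "\<theta> > 0" using assms by simp
  have \<eta>: "\<eta> \<longlonglongrightarrow> 0" unfolding \<eta>_def by real_asymp
  have sN: "(\<lambda>N. s / sqrt (real N)) \<longlonglongrightarrow> 0"
  proof -
    have "(\<lambda>N. 1 / sqrt (real N)) \<longlonglongrightarrow> 0" by real_asymp
    from tendsto_mult_right_zero[OF this, of s] show ?thesis by simp
  qed
  have "\<forall>\<^sub>F N in sequentially. 2 * real N powr (1 / 8) < real N" by real_asymp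
  then show "\<forall>\<^sub>F N in sequentially. 2 * cutoff N < N"
  proof eventually_elim
    case (elim N)
    have "real (2 * cutoff N) < real N" using elim cutoff_bounds(1)[of N] by simp
    then show ?case by (simp only: of_nat_less_iff)
  qed
  have "(\<lambda>N. (\<sigma>\<^sup>2 + 2 * \<eta> N) / (\<theta> * \<sigma>)) \<longlonglongrightarrow> (\<sigma>\<^sup>2 + 2 * 0) / (\<theta> * \<sigma>)"
    by (intro tendsto_intros \<eta>) (use \<sigma> \<theta>0 in auto)
  \<comment> \<open>The slope bound tends to \<sigma> / \<theta> < 1, and q is the midpoint between
    this limit and 1.\<close>
  moreover have "(\<sigma>\<^sup>2 + 2 * 0) / (\<theta> * \<sigma>) < (1 + \<sigma> / \<theta>) / 2"
  proof -
    have eq: "(\<sigma>\<^sup>2 + 2 * 0) / (\<theta> * \<sigma>) = \<sigma> / \<theta>" using \<sigma> by (simp add: power2_eq_square)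
    have lt: "x < (1 + x) / 2" if "x < 1" for x :: real using that by simp
    show ?thesis unfolding eq by (rule lt) (use \<theta> \<theta>0 in simp)
  qed
  ultimately have "\<forall>\<^sub>F N in sequentially. (\<sigma>\<^sup>2 + 2 * \<eta> N) / (\<theta> * \<sigma>) < (1 + \<sigma> / \<theta>) / 2"
    by (rule order_tendstoD(2))
  then show "\<forall>\<^sub>F N in sequentially. (\<sigma>\<^sup>2 + 2 * \<eta> N) / (\<theta> * \<sigma>) \<le> (1 + \<sigma> / \<theta>) / 2"
    by eventually_elim (rule less_imp_le)
  have "(\<lambda>N. \<bar>s\<bar> * real N powr (- 1 / 5)) \<longlonglongrightarrow> 0"
    by (rule tendsto_mult_right_zero) real_asymp
  then have "\<forall>\<^sub>F N in sequentially. \<bar>s\<bar> * real N powr (- 1 / 5) < 2" by (rule order_tendstoD) simp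
  then show "\<forall>\<^sub>F N in sequentially. \<bar>s\<bar> / sqrt N \<le> 2 * \<eta> N"
    using eventually_gt_at_top[of 0]
  proof eventually_elim
    case (elim N)
    have "real N powr (- 1 / 5) * \<eta> N = real N powr (- (1 / 2))"
      unfolding \<eta>_def powr_add[symmetric] by simp
    also have "\<dots> = 1 / sqrt N" using elim(2) by (simp only: powr_minus_divide powr_half_sqrt of_nat_0_le_iff)
    finally have "\<bar>s\<bar> / sqrt N = \<bar>s\<bar> * real N powr (- 1 / 5) * \<eta> N" by (simp add: mult.assoc)
    also have "\<dots> \<le> 2 * \<eta> N" using elim(1) by (intro mult_right_mono) (auto simp: \<eta>_def)
    finally show ?case .
  qed
  have "(\<lambda>N. 2 * \<sigma>\<^sup>2 * real N powr (1 / 8 - 1 + 3 / 10)) \<longlonglongrightarrow> 0"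
    by (rule tendsto_mult_right_zero) real_asymp
  then have "\<forall>\<^sub>F N in sequentially. 2 * \<sigma>\<^sup>2 * real N powr (1 / 8 - 1 + 3 / 10) < 1" by (rule order_tendstoD) simp
  then show "\<forall>\<^sub>F N in sequentially. \<sigma>\<^sup>2 * (2 * cutoff N) / N \<le> \<eta> N"
    using eventually_gt_at_top[of 0]
  proof eventually_elim
    case (elim N)
    have "\<sigma>\<^sup>2 * (2 * cutoff N) / N \<le> \<sigma>\<^sup>2 * (2 * real N powr (1 / 8)) / N"
      using cutoff_bounds(1)[of N] by (intro divide_right_mono mult_left_mono) auto
    also have "\<dots> = 2 * \<sigma>\<^sup>2 * (real N powr (1 / 8) * real N powr (- 1))"
    proof -
      have "real N powr (- 1) = 1 / N" using elim(2) by (simp add: powr_minus_divide)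
      then show ?thesis by simp
    qed
    also have "real N powr (1 / 8) * real N powr (- 1) = real N powr (1 / 8 - 1 + 3 / 10) * \<eta> N"
      unfolding \<eta>_def powr_add[symmetric] by simp
    finally have "\<sigma>\<^sup>2 * (2 * cutoff N) / N \<le> 2 * \<sigma>\<^sup>2 * real N powr (1 / 8 - 1 + 3 / 10) * \<eta> N" by (simp add: mult.assoc)
    also have "\<dots> \<le> 1 * \<eta> N" using elim(1) by (intro mult_right_mono) (auto simp: \<eta>_def)
    finally show ?case by simp
  qed
  \<comment> \<open>The outlier lies strictly above the edge 2 \<sigma> of the bulk; this gap
    absorbs the terms in \<eta> and s / sqrt N.\<close>
  have gap: "2 * \<sigma> < rho \<sigma> \<theta>"
  proof -
    have "0 < (\<theta> - \<sigma>)\<^sup>2 / \<theta>" using \<theta> \<theta>0 by simp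
    also have "\<dots> = rho \<sigma> \<theta> - 2 * \<sigma>"
    proof -
      have "(\<theta> - \<sigma>)\<^sup>2 = (rho \<sigma> \<theta> - 2 * \<sigma>) * \<theta>"
        using \<theta>0 by (simp add: rho_def power2_eq_square algebra_simps)
      then show ?thesis using \<theta>0 by simp
    qed
    finally show ?thesis by simp
  qed
  have "(\<lambda>N. rho \<sigma> \<theta> + s / sqrt N - (2 * \<sigma> + \<eta> N + \<eta> N / \<sigma>)) \<longlonglongrightarrow> rho \<sigma> \<theta> + 0 - (2 * \<sigma> + 0 + 0 / \<sigma>)"
    by (intro tendsto_intros \<eta> sN) (use \<sigma> in auto)
  then have "\<forall>\<^sub>F N in sequentially. 0 < rho \<sigma> \<theta> + s / sqrt N - (2 * \<sigma> + \<eta> N + \<eta> N / \<sigma>)"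
    by (rule order_tendstoD) (use gap in simp)
  then show "\<forall>\<^sub>F N in sequentially. 2 * \<sigma> + \<eta> N + \<eta> N / \<sigma> \<le> rho \<sigma> \<theta> + s / sqrt N"
    by eventually_elim linarith
  have "(\<lambda>N. s / sqrt N + \<eta> N) \<longlonglongrightarrow> 0 + 0" by (intro tendsto_intros \<eta> sN)
  then have "\<forall>\<^sub>F N in sequentially. s / sqrt N + \<eta> N < 1" by (rule order_tendstoD) simp
  then show "\<forall>\<^sub>F N in sequentially. rho \<sigma> \<theta> + s / sqrt N + \<eta> N \<le> rho \<sigma> \<theta> + 1"
    by eventually_elim linarith
qed

text \<open>The pathwise comparison becomes one of probabilities, since the margin
  \<open>err\<close> and the probability of the exceptional event both vanish.\<close>

lemma LIMSEQ_prob_chain: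
  fixes P :: "nat \<Rightarrow> 'a measure"
  assumes \<sigma>: "\<sigma> > 0" and \<theta>: "\<theta> > \<sigma>" and arr: "\<And>N. N > 0 \<Longrightarrow> normal_array (P N) N (G N)"
    and r: "r = \<sigma>\<^sup>2 / \<theta>\<^sup>2"
  shows "(\<lambda>N. measure (P N) {\<omega> \<in> space (P N). chain (rho \<sigma> \<theta> + s / sqrt N) N (\<lambda>p. \<sigma> / sqrt N * G N p \<omega>) N \<theta>})
      \<longlonglongrightarrow> cdf (gauss (sqrt (2 * \<sigma>\<^sup>2 / (1 - r)))) (s / (1 - r))"
proof -
  have \<theta>0: "\<theta> > 0" using \<sigma> \<theta> by simp
  have r01: "0 < r" "r < 1" using \<sigma> \<theta> by (auto simp: r power_strict_mono)
  define q where "q = (1 + \<sigma> / \<theta>) / 2"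
  have q: "0 < q" "q < 1" using \<sigma> \<theta> \<theta>0 by (auto simp: q_def field_simps)
  define C where "C = rho \<sigma> \<theta> + 1"
  define \<eta> where "\<eta> N = real N powr (- 3 / 10)" for N :: nat
  define \<delta> where "\<delta> N = 2 * \<eta> N * (2 + 1 / \<theta>) / (1 - q) + q ^ cutoff N * (C + \<theta>)" for N
  define err where "err N = sqrt N * ((2 * \<eta> N * \<theta> + \<sigma>\<^sup>2 * \<delta> N) / (\<theta>\<^sup>2 * \<sigma>) * \<delta> N / (1 - r)
      + r ^ cutoff N * (\<delta> N + 2 * \<eta> N / (1 - r))) + (real (cutoff N))\<^sup>2 * (\<sigma>\<^sup>2 / (\<theta> * sqrt N))" for N
  let ?T = "\<lambda>N. normal_array.statistic N (G N) \<sigma> \<theta> (cutoff N)"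
  let ?dev = "\<lambda>N. normal_array.deviation (P N) N (G N) (N * (\<eta> N)\<^sup>2 / (2 * \<sigma>\<^sup>2) - 1) (N * \<eta> N / \<sigma>\<^sup>2)"
  let ?ch = "\<lambda>N \<omega>. chain (rho \<sigma> \<theta> + s / sqrt N) N (\<lambda>p. \<sigma> / sqrt N * G N p \<omega>) N \<theta>"
  let ?v = "sqrt (2 * \<sigma>\<^sup>2 / (1 - r))"
  have v: "?v > 0" using \<sigma> r01 by simp
  have err: "err \<longlonglongrightarrow> 0"
  proof -
    \<comment> \<open>The factor sqrt N is split into two factors N^(1/4), one for each small factor
      in the products that make up the linearisation error.\<close>
    define x y z where "x N = real N powr (1 / 4) * \<eta> N" and "y N = real N powr (1 / 4) * q ^ cutoff N"
      and "z N = real N powr (1 / 4) * r ^ cutoff N" for N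
    define d where "d N = 2 * x N * (2 + 1 / \<theta>) / (1 - q) + y N * (C + \<theta>)" for N
    have x: "x \<longlonglongrightarrow> 0" unfolding x_def \<eta>_def by real_asymp
    have y: "y \<longlonglongrightarrow> 0" unfolding y_def by (rule LIMSEQ_power_cutoff[OF q])
    have z: "z \<longlonglongrightarrow> 0" unfolding z_def by (rule LIMSEQ_power_cutoff[OF r01])
    have d: "d \<longlonglongrightarrow> 0"
    proof -
      have "d \<longlonglongrightarrow> 2 * 0 * (2 + 1 / \<theta>) / (1 - q) + 0 * (C + \<theta>)"
        unfolding d_def by (intro tendsto_intros x y) (use q in auto)
      then show ?thesis by simp
    qed
    have "(\<lambda>N. (2 * x N * \<theta> + \<sigma>\<^sup>2 * d N) / (\<theta>\<^sup>2 * \<sigma>) * d N / (1 - r) + z N * (d N + 2 * x N / (1 - r)))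
        \<longlonglongrightarrow> (2 * 0 * \<theta> + \<sigma>\<^sup>2 * 0) / (\<theta>\<^sup>2 * \<sigma>) * 0 / (1 - r) + 0 * (0 + 2 * 0 / (1 - r))"
      by (intro tendsto_intros x d z) (use r01 \<sigma> \<theta>0 in auto)
    moreover have "(\<lambda>N. (real (cutoff N))\<^sup>2 * (\<sigma>\<^sup>2 / (\<theta> * sqrt N))) \<longlonglongrightarrow> 0"
    proof (rule tendsto_sandwich[OF _ _ tendsto_const])
      show "\<forall>\<^sub>F N in sequentially. 0 \<le> (real (cutoff N))\<^sup>2 * (\<sigma>\<^sup>2 / (\<theta> * sqrt N))" using \<theta>0 by simp
      show "\<forall>\<^sub>F N in sequentially. (real (cutoff N))\<^sup>2 * (\<sigma>\<^sup>2 / (\<theta> * sqrt N)) \<le> (real N powr (1 / 8))\<^sup>2 * (\<sigma>\<^sup>2 / (\<theta> * sqrt N))"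
        using \<theta>0 cutoff_bounds(1) by (intro always_eventually allI mult_right_mono power_mono) auto
      have "(\<lambda>N. \<sigma>\<^sup>2 / \<theta> * ((real N powr (1 / 8))\<^sup>2 / sqrt N)) \<longlonglongrightarrow> 0"
        by (rule tendsto_mult_right_zero) real_asymp
      then show "(\<lambda>N. (real N powr (1 / 8))\<^sup>2 * (\<sigma>\<^sup>2 / (\<theta> * sqrt N))) \<longlonglongrightarrow> 0"
        by (simp add: mult_ac)
    qed
    ultimately have "(\<lambda>N. ((2 * x N * \<theta> + \<sigma>\<^sup>2 * d N) / (\<theta>\<^sup>2 * \<sigma>) * d N / (1 - r) + z N * (d N + 2 * x N / (1 - r)))
        + (real (cutoff N))\<^sup>2 * (\<sigma>\<^sup>2 / (\<theta> * sqrt N))) \<longlonglongrightarrow> 0"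
      using tendsto_add_zero by fastforce
    moreover have "\<forall>\<^sub>F N in sequentially. ((2 * x N * \<theta> + \<sigma>\<^sup>2 * d N) / (\<theta>\<^sup>2 * \<sigma>) * d N / (1 - r) + z N * (d N + 2 * x N / (1 - r)))
        + (real (cutoff N))\<^sup>2 * (\<sigma>\<^sup>2 / (\<theta> * sqrt N)) = err N"
      using eventually_gt_at_top[of 0]
    proof eventually_elim
      case (elim N)
      define w where "w = real N powr (1 / 4)"
      have w: "sqrt N = w * w" unfolding w_def powr_add[symmetric] by (simp add: powr_half_sqrt)
      have dN: "d N = w * \<delta> N" by (simp add: d_def \<delta>_def x_def y_def w_def algebra_simps add_divide_distrib)
      show ?case
        unfolding err_def dN x_def z_def w_def[symmetric]
        by (simp add: w algebra_simps add_divide_distrib)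
    qed
    ultimately show ?thesis by (rule Lim_transform_eventually)
  qed
  have dev: "(\<lambda>N. measure (P N) (?dev N)) \<longlonglongrightarrow> 0"
  proof (rule tendsto_sandwich[OF _ _ tendsto_const])
    show "\<forall>\<^sub>F N in sequentially. 0 \<le> measure (P N) (?dev N)" by simp
    have "(\<lambda>N. \<eta> N / (8 * \<sigma>\<^sup>2)) \<longlonglongrightarrow> 0" unfolding \<eta>_def by (rule tendsto_divide_zero) real_asymp
    then have "\<forall>\<^sub>F N in sequentially. \<eta> N / (8 * \<sigma>\<^sup>2) < 1 / 4" by (rule order_tendstoD) simp
    then show "\<forall>\<^sub>F N in sequentially. measure (P N) (?dev N) \<le>
       N * (2 * exp (1 / 2 - 1 / (8 * \<sigma>\<^sup>2) * real N powr (4 / 10)) + 2 * exp (- 1 / (16 * \<sigma> ^ 4) * real N powr (4 / 10)))"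
      using eventually_gt_at_top[of 0]
    proof eventually_elim
      case (elim N)
      interpret A: normal_array "P N" N "G N" by (rule arr[OF elim(2)])
      \<comment> \<open>Minimises - l \<tau>' + 4 l^2 N at \<tau>' = N \<eta> / \<sigma>^2. The
        minimum is - N \<eta>^2 / (16 \<sigma>^4), and N \<eta>^2 = N^(4/10) is enough to beat the
        factor N of the union bound.\<close>
      define l where "l = \<eta> N / (8 * \<sigma>\<^sup>2)"
      have l: "0 < l" "l \<le> 1 / 4" using elim \<sigma> by (auto simp: l_def \<eta>_def)
      have N\<eta>: "N * (\<eta> N)\<^sup>2 = real N powr (4 / 10)"
      proof -
        have "real N * (\<eta> N)\<^sup>2 = real N powr 1 * (real N powr (- 3 / 10) * real N powr (- 3 / 10))"
          using elim(2) by (simp add: \<eta>_def power2_eq_square)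
        then show ?thesis unfolding powr_add[symmetric] by simp
      qed
      have "1 / 4 - (N * (\<eta> N)\<^sup>2 / (2 * \<sigma>\<^sup>2) - 1) / 4 = 1 / 2 - 1 / (8 * \<sigma>\<^sup>2) * real N powr (4 / 10)"
        unfolding N\<eta> using \<sigma> by (simp add: field_simps)
      moreover have "- l * (N * \<eta> N / \<sigma>\<^sup>2) + 4 * l\<^sup>2 * N = - 1 / (16 * \<sigma> ^ 4) * (N * (\<eta> N)\<^sup>2)"
        using \<sigma> by (simp add: l_def power_divide power_mult_distrib field_simps power2_eq_square power4_eq_xxxx)
      ultimately show ?case using A.prob_deviation[OF l] unfolding N\<eta> by metis
    qed
    have "0 < 1 / (8 * \<sigma>\<^sup>2)" "0 < 1 / (16 * \<sigma> ^ 4)" using \<sigma> by auto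
    then show "(\<lambda>N. real N * (2 * exp (1 / 2 - 1 / (8 * \<sigma>\<^sup>2) * real N powr (4 / 10)) + 2 * exp (- 1 / (16 * \<sigma> ^ 4) * real N powr (4 / 10)))) \<longlonglongrightarrow> 0"
    proof -
      have lim: "(\<lambda>N. real N * (2 * exp (1 / 2 - c * real N powr (4 / 10)) + 2 * exp (- c' * real N powr (4 / 10)))) \<longlonglongrightarrow> 0"
        if "c > 0" "c' > 0" for c c' :: real
      proof -
        have "(\<lambda>N. real N * (2 * exp (1 / 2 - c * real N powr (4 / 10)))) \<longlonglongrightarrow> 0" using \<open>c > 0\<close> by real_asymp
        moreover have "(\<lambda>N. real N * (2 * exp (- c' * real N powr (4 / 10)))) \<longlonglongrightarrow> 0" using \<open>c' > 0\<close> by real_asymp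
        ultimately show ?thesis unfolding distrib_left by (rule tendsto_add_zero)
      qed
      show ?thesis using lim[of "1 / (8 * \<sigma>\<^sup>2)" "1 / (16 * \<sigma> ^ 4)"] \<sigma> by simp
    qed
  qed
  show ?thesis
  proof (rule LIMSEQ_sandwich_cdf[where F = "\<lambda>N. cdf (distr (P N) borel (?T N))", OF _ isCont_cdf_gauss[OF v] dev])
    show "(\<lambda>N. cdf (distr (P N) borel (?T N)) x) \<longlonglongrightarrow> cdf (gauss ?v) x" for x
    proof (rule LIMSEQ_imp_Suc)
      show "(\<lambda>n. cdf (distr (P (Suc n)) borel (?T (Suc n))) x) \<longlonglongrightarrow> cdf (gauss ?v) x"
        using weak_conv_statistic[OF \<sigma> \<theta> arr r] isCont_cdf_gauss[OF v] unfolding weak_conv_m_def weak_conv_def by blast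
    qed
    fix \<epsilon> :: real assume \<epsilon>: "\<epsilon> > 0"
    have "\<forall>\<^sub>F N in sequentially. err N < \<epsilon>" by (rule order_tendstoD(2)[OF err \<epsilon>])
    then show "\<forall>\<^sub>F N in sequentially. cdf (distr (P N) borel (?T N)) (s / (1 - r) - \<epsilon>) - measure (P N) (?dev N)
         \<le> measure (P N) {\<omega> \<in> space (P N). ?ch N \<omega>} \<and>
        measure (P N) {\<omega> \<in> space (P N). ?ch N \<omega>} \<le> cdf (distr (P N) borel (?T N)) (s / (1 - r) + \<epsilon>) + measure (P N) (?dev N)"
      using eventually_gt_at_top[of 0] eventually_conditions(1,2,4)[OF \<sigma> \<theta>] eventually_conditions(3,5,6)[OF \<sigma> \<theta>, of s]
    proof eventually_elim
      case (elim N)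
      interpret A: normal_array "P N" N "G N" by (rule arr[OF elim(2)])
      have \<eta>0: "\<eta> N > 0" using elim(2) by (simp add: \<eta>_def)
      have key: "?T N \<omega> < s / (1 - r) - err N \<Longrightarrow> ?ch N \<omega>" "?ch N \<omega> \<Longrightarrow> ?T N \<omega> < s / (1 - r) + err N"
        if "\<omega> \<in> space (P N)" "\<omega> \<notin> ?dev N" for \<omega>
        using A.chain_iff_statistic[where q = q and s = s and C = C and r = r and \<delta> = "\<delta> N" and err = "err N",
            OF \<sigma> \<theta> \<eta>0 elim(3) refl refl that] elim q r
        unfolding C_def q_def \<eta>_def \<delta>_def err_def by auto
      note [measurable] = A.measurable_statistic[of \<sigma> \<theta> "cutoff N"]
      have cdf: "cdf (distr (P N) borel (?T N)) x = measure (P N) {\<omega> \<in> space (P N). ?T N \<omega> \<le> x}" for x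
        unfolding cdf_def by (subst measure_distr) (auto simp: vimage_def Int_def conj_commute)
      have T: "{\<omega> \<in> space (P N). ?T N \<omega> \<le> x} \<in> sets (P N)" for x by measurable
      have ch: "{\<omega> \<in> space (P N). ?ch N \<omega>} \<in> sets (P N)"
        by (rule pred_chain) (auto intro!: borel_measurable_times borel_measurable_divide A.measurable_entry simp: upper_tri_def)
      note D = A.sets_deviation[of "N * (\<eta> N)\<^sup>2 / (2 * \<sigma>\<^sup>2) - 1" "N * \<eta> N / \<sigma>\<^sup>2"]
      have "measure (P N) {\<omega> \<in> space (P N). ?T N \<omega> \<le> s / (1 - r) - \<epsilon>} \<le> measure (P N) ({\<omega> \<in> space (P N). ?ch N \<omega>} \<union> ?dev N)"
        using key(1) elim(1) by (intro A.finite_measure_mono sets.Un ch D) force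
      also have "\<dots> \<le> measure (P N) {\<omega> \<in> space (P N). ?ch N \<omega>} + measure (P N) (?dev N)"
        by (rule measure_Un_le[OF ch D])
      finally have 1: "cdf (distr (P N) borel (?T N)) (s / (1 - r) - \<epsilon>) - measure (P N) (?dev N) \<le> measure (P N) {\<omega> \<in> space (P N). ?ch N \<omega>}"
        unfolding cdf by linarith
      have "measure (P N) {\<omega> \<in> space (P N). ?ch N \<omega>} \<le> measure (P N) ({\<omega> \<in> space (P N). ?T N \<omega> \<le> s / (1 - r) + \<epsilon>} \<union> ?dev N)"
        using key(2) elim(1) by (intro A.finite_measure_mono sets.Un T D) force
      also have "\<dots> \<le> measure (P N) {\<omega> \<in> space (P N). ?T N \<omega> \<le> s / (1 - r) + \<epsilon>} + measure (P N) (?dev N)"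
        by (rule measure_Un_le[OF T D])
      finally show ?case using 1 unfolding cdf by linarith
    qed
  qed
qed

section \<open>Largest eigenvalues and rank-one matrices\<close>

text \<open>Cauchy-Schwarz in every row; K is the squared Frobenius norm, increased by 1 to be
  positive.\<close>

lemma mult_mat_vec_bounded:
  fixes M :: "real mat"
  assumes M: "M \<in> carrier_mat n n"
  shows "\<exists>K>0. \<forall>v\<in>carrier_vec n. scalar_prod (M *\<^sub>v v) (M *\<^sub>v v) \<le> K * scalar_prod v v"
proof -
  define K where "K = (\<Sum>i\<in>{0..<n}. \<Sum>j\<in>{0..<n}. (M $$ (i, j))\<^sup>2) + 1"
  have "K > 0" unfolding K_def by (intro add_nonneg_pos sum_nonneg) auto
  moreover have "scalar_prod (M *\<^sub>v v) (M *\<^sub>v v) \<le> K * scalar_prod v v" if v: "v \<in> carrier_vec n" for v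
  proof -
    have vv: "scalar_prod v v = (\<Sum>j\<in>{0..<n}. (v $ j)\<^sup>2)"
      using v by (simp add: scalar_prod_def power2_eq_square)
    have "(M *\<^sub>v v) $ i = (\<Sum>j\<in>{0..<n}. M $$ (i, j) * v $ j)" if "i < n" for i
      using that v M by (simp add: scalar_prod_def)
    then have "scalar_prod (M *\<^sub>v v) (M *\<^sub>v v) = (\<Sum>i\<in>{0..<n}. (\<Sum>j\<in>{0..<n}. M $$ (i, j) * v $ j)\<^sup>2)"
      using v M by (simp add: scalar_prod_def[of "M *\<^sub>v v"] power2_eq_square)
    also have "\<dots> \<le> (\<Sum>i\<in>{0..<n}. (\<Sum>j\<in>{0..<n}. (M $$ (i, j))\<^sup>2) * (\<Sum>j\<in>{0..<n}. (v $ j)\<^sup>2))"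
      by (intro sum_mono Cauchy_Schwarz_ineq_sum)
    also have "\<dots> = (K - 1) * scalar_prod v v"
      unfolding vv K_def by (simp add: sum_distrib_right)
    also have "\<dots> \<le> K * scalar_prod v v"
      unfolding vv by (intro mult_right_mono sum_nonneg) auto
    finally show ?thesis .
  qed
  ultimately show ?thesis by blast
qed

lemma scalar_prod_self_pos:
  fixes v :: "real vec"
  assumes "v \<in> carrier_vec n" "v \<noteq> 0\<^sub>v n"
  shows "scalar_prod v v > 0"
proof -
  obtain i where i: "i < n" "v $ i \<noteq> 0"
    using assms by (metis carrier_vecD eq_vecI index_zero_vec(1) index_zero_vec(2))
  have "0 < (\<Sum>j\<in>{0..<n}. (v $ j)\<^sup>2)"
    by (rule sum_pos2[of _ i]) (use i in auto)
  then show ?thesis using assms by (simp add: scalar_prod_def power2_eq_square)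
qed

lemma scalar_prod_self_nonneg:
  fixes v :: "real vec"
  shows "scalar_prod v v \<ge> 0"
  by (simp add: scalar_prod_def sum_nonneg)

lemma mat_quadratic_bounded:
  fixes M :: "real mat"
  assumes M: "M \<in> carrier_mat n n"
  shows "\<exists>K>0. \<forall>v\<in>carrier_vec n. \<bar>scalar_prod v (M *\<^sub>v v)\<bar> \<le> K * scalar_prod v v"
proof -
  obtain K where K: "K > 0" "\<forall>v\<in>carrier_vec n. scalar_prod (M *\<^sub>v v) (M *\<^sub>v v) \<le> K * scalar_prod v v"
    using mult_mat_vec_bounded[OF M] by blast
  have "\<bar>scalar_prod v (M *\<^sub>v v)\<bar> \<le> (1 + K) / 2 * scalar_prod v v" if v: "v \<in> carrier_vec n" for v
  proof -
    have Mv: "M *\<^sub>v v \<in> carrier_vec n" using M v by simp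
    have ab: "\<bar>a * b\<bar> \<le> (a * a + b * b) / 2" for a b :: real
    proof -
      have "0 \<le> (a - b)\<^sup>2" "0 \<le> (a + b)\<^sup>2" by auto
      then show ?thesis by (auto simp: power2_eq_square algebra_simps abs_le_iff)
    qed
    have "\<bar>scalar_prod v (M *\<^sub>v v)\<bar> \<le> (\<Sum>i\<in>{0..<n}. \<bar>v $ i * (M *\<^sub>v v) $ i\<bar>)"
      unfolding scalar_prod_def using Mv by (metis carrier_vecD sum_abs)
    also have "\<dots> \<le> (\<Sum>i\<in>{0..<n}. (v $ i * v $ i + (M *\<^sub>v v) $ i * (M *\<^sub>v v) $ i) / 2)"
      by (intro sum_mono ab)
    also have "\<dots> = (scalar_prod v v + scalar_prod (M *\<^sub>v v) (M *\<^sub>v v)) / 2"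
      unfolding scalar_prod_def carrier_vecD[OF v] carrier_vecD[OF Mv]
      by (simp add: sum.distrib flip: sum_divide_distrib)
    also have "\<dots> \<le> (1 + K) / 2 * scalar_prod v v"
      using K(2) v by (simp add: algebra_simps)
    finally show ?thesis .
  qed
  then show ?thesis using K(1) by (intro exI[of _ "(1 + K) / 2"]) auto
qed

lemma symmetric_scalar_prod:
  fixes B :: "real mat"
  assumes B: "B \<in> carrier_mat n n" "transpose_mat B = B" and v: "v \<in> carrier_vec n" "w \<in> carrier_vec n"
  shows "scalar_prod (B *\<^sub>v v) w = scalar_prod v (B *\<^sub>v w)"
  using assoc_scalar_prod[of v n B n w] B v transpose_vec_mult_scalar[OF B(1) v(2,1)]
  by (metis comm_scalar_prod mult_mat_vec_carrier)

text \<open>A negative semidefinite form \<open>C\<close> with \<open>\<bar>v \<bullet> C v\<bar> \<le> \<kappa> v \<bullet> v\<close> controls \<open>C v\<close>: test it on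
  \<open>v + C v / \<kappa>\<close>.\<close>

lemma nsd_mult_bound:
  fixes C :: "real mat"
  assumes C: "C \<in> carrier_mat n n" "transpose_mat C = C"
    and nsd: "\<And>v. v \<in> carrier_vec n \<Longrightarrow> scalar_prod v (C *\<^sub>v v) \<le> 0"
    and \<kappa>: "\<kappa> > 0" "\<And>v. v \<in> carrier_vec n \<Longrightarrow> \<bar>scalar_prod v (C *\<^sub>v v)\<bar> \<le> \<kappa> * scalar_prod v v"
    and v: "v \<in> carrier_vec n"
  shows "scalar_prod (C *\<^sub>v v) (C *\<^sub>v v) \<le> - \<kappa> * scalar_prod v (C *\<^sub>v v)"
proof -
  define w where "w = C *\<^sub>v v"
  have w: "w \<in> carrier_vec n" "C *\<^sub>v w \<in> carrier_vec n" "C *\<^sub>v v \<in> carrier_vec n" using C v by (auto simp: w_def)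
  define a where "a = 1 / \<kappa>"
  define x where "x = v + a \<cdot>\<^sub>v w"
  have x: "x \<in> carrier_vec n" using v w by (simp add: x_def)
  have Cx: "C *\<^sub>v x = C *\<^sub>v v + a \<cdot>\<^sub>v (C *\<^sub>v w)"
    unfolding x_def using C v w by (simp add: mult_add_distrib_mat_vec[of C n n] mult_mat_vec[of C n n])
  have vw: "scalar_prod v (C *\<^sub>v w) = scalar_prod w w"
    using symmetric_scalar_prod[OF C v w(1)] by (simp add: w_def)
  have "scalar_prod (v + a \<cdot>\<^sub>v w) (C *\<^sub>v v + a \<cdot>\<^sub>v (C *\<^sub>v w)) = scalar_prod v (C *\<^sub>v v) + a * scalar_prod v (C *\<^sub>v w)
      + (a * scalar_prod w (C *\<^sub>v v) + a * a * scalar_prod w (C *\<^sub>v w))"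
    using v w by (simp add: add_scalar_prod_distrib[of _ n] scalar_prod_add_distrib[of _ n] algebra_simps)
  then have "scalar_prod x (C *\<^sub>v x) = scalar_prod v (C *\<^sub>v v) + a * scalar_prod v (C *\<^sub>v w)
      + (a * scalar_prod w (C *\<^sub>v v) + a * a * scalar_prod w (C *\<^sub>v w))"
    using Cx by (simp add: x_def)
  also have "\<dots> = scalar_prod v w + 2 * a * scalar_prod w w + a * a * scalar_prod w (C *\<^sub>v w)"
    using vw by (simp add: w_def)
  finally have "scalar_prod v w + 2 * a * scalar_prod w w + a * a * scalar_prod w (C *\<^sub>v w) \<le> 0"
    using nsd[OF x] by simp
  moreover have "a * a * scalar_prod w (C *\<^sub>v w) \<ge> - (a * scalar_prod w w)"
  proof -
    have "- (\<kappa> * scalar_prod w w) \<le> scalar_prod w (C *\<^sub>v w)" using \<kappa>(2)[OF w(1)] by simp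
    then have "a * a * (- (\<kappa> * scalar_prod w w)) \<le> a * a * scalar_prod w (C *\<^sub>v w)"
      by (intro mult_left_mono) auto
    then show ?thesis using \<kappa>(1) by (simp add: a_def)
  qed
  ultimately have "scalar_prod v w + a * scalar_prod w w \<le> 0" by simp
  then have "\<kappa> * (scalar_prod v w + a * scalar_prod w w) \<le> 0" using \<kappa>(1) by (simp add: mult_le_0_iff)
  then show ?thesis using \<kappa>(1) by (simp add: w_def a_def algebra_simps)
qed

text \<open>If \<open>s\<close> is the supremum of the Rayleigh quotients and \<open>B - s\<close> were invertible, then \<open>B - s\<close> would be
  bounded away from \<open>0\<close>, so \<open>s\<close> could be decreased.\<close>

lemma lambda1_le_iff:
  assumes n: "n > 0" and B: "B \<in> carrier_mat n n" "transpose_mat B = B"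
  shows "lambda1 B \<le> t \<longleftrightarrow> (\<forall>v\<in>carrier_vec n. scalar_prod v (B *\<^sub>v v) \<le> t * scalar_prod v v)"
proof -
  define T where "T = {t. \<forall>v\<in>carrier_vec n. scalar_prod v (B *\<^sub>v v) \<le> t * scalar_prod v v}"
  obtain K where "\<forall>v\<in>carrier_vec n. \<bar>scalar_prod v (B *\<^sub>v v)\<bar> \<le> K * scalar_prod v v"
    using mat_quadratic_bounded[OF B(1)] by blast
  then have KT: "K \<in> T" by (auto simp: T_def abs_le_iff)
  have "\<exists>v\<in>carrier_vec n. scalar_prod v v = (1::real)"
    using n by (intro bexI[of _ "unit_vec n 0"]) auto
  then obtain e :: "real vec" where e: "e \<in> carrier_vec n" "scalar_prod e e = 1" by blast
  have bdd: "bdd_below T"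
    using e by (intro bdd_belowI[of _ "scalar_prod e (B *\<^sub>v e)"]) (auto simp: T_def)
  define s where "s = Inf T"
  have sT: "s \<in> T"
    unfolding T_def
  proof safe
    fix v :: "real vec" assume v: "v \<in> carrier_vec n"
    show "scalar_prod v (B *\<^sub>v v) \<le> s * scalar_prod v v"
    proof (cases "v = 0\<^sub>v n")
      case True
      then show ?thesis using B by simp
    next
      case False
      then have p: "scalar_prod v v > 0" using scalar_prod_self_pos v by blast
      have "scalar_prod v (B *\<^sub>v v) / scalar_prod v v \<le> s"
        unfolding s_def using KT v p by (intro cInf_greatest) (auto simp: T_def field_simps)
      then show ?thesis using p by (simp add: field_simps)
    qed
  qed
  have up: "t \<in> T \<longleftrightarrow> s \<le> t" for t
  proof
    assume "s \<le> t"
    show "t \<in> T" unfolding T_def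
    proof safe
      fix v :: "real vec" assume "v \<in> carrier_vec n"
      then have "scalar_prod v (B *\<^sub>v v) \<le> s * scalar_prod v v" using sT by (auto simp: T_def)
      also have "\<dots> \<le> t * scalar_prod v v"
        using \<open>s \<le> t\<close> scalar_prod_self_nonneg by (rule mult_right_mono)
      finally show "scalar_prod v (B *\<^sub>v v) \<le> t * scalar_prod v v" .
    qed
  qed (use bdd in \<open>auto simp: s_def intro: cInf_lower\<close>)
  have ev_s: "eigenvalue B s"
  proof (rule ccontr)
    assume "\<not> eigenvalue B s"
    define C where "C = char_matrix B s"
    have C: "C \<in> carrier_mat n n" "transpose_mat C = C"
      using B by (auto simp: C_def char_matrix_def transpose_add[of _ n n])
    have det: "det C \<noteq> 0" using \<open>\<not> eigenvalue B s\<close> eigenvalue_det[OF B(1)] by (simp add: C_def)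
    obtain D where D: "D \<in> carrier_mat n n" "D * C = 1\<^sub>m n"
      using det_non_zero_imp_unit[OF C(1) det, of "()"] by (auto simp: Units_def ring_mat_def)
    have Cv: "scalar_prod v (C *\<^sub>v v) = scalar_prod v (B *\<^sub>v v) - s * scalar_prod v v" if v: "v \<in> carrier_vec n" for v
    proof -
      have "C *\<^sub>v v = B *\<^sub>v v + (- s) \<cdot>\<^sub>v v"
        unfolding C_def char_matrix_def
        by (rule eq_vecI) (use B v in \<open>auto simp: add_scalar_prod_distrib[of _ n]\<close>)
      then show ?thesis using v B by (simp add: scalar_prod_add_distrib[of _ n])
    qed
    have nsd: "scalar_prod v (C *\<^sub>v v) \<le> 0" if "v \<in> carrier_vec n" for v
      using sT that by (auto simp: Cv T_def)
    obtain \<kappa> where \<kappa>: "\<kappa> > 0" "\<And>v. v \<in> carrier_vec n \<Longrightarrow> \<bar>scalar_prod v (C *\<^sub>v v)\<bar> \<le> \<kappa> * scalar_prod v v"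
      using mat_quadratic_bounded[OF C(1)] by blast
    obtain L where L: "L > 0" "\<And>v. v \<in> carrier_vec n \<Longrightarrow> scalar_prod (D *\<^sub>v v) (D *\<^sub>v v) \<le> L * scalar_prod v v"
      using mult_mat_vec_bounded[OF D(1)] by blast
    \<comment> \<open>Since v = D (C v), the squared norm of v is at most L times that of C v, hence
      at most - L \<kappa> times the form of C at v. So the form of B - s lies below - \<epsilon>
      times the squared norm.\<close>
    define \<epsilon> where "\<epsilon> = 1 / (L * \<kappa>)"
    have \<epsilon>: "\<epsilon> > 0" using L \<kappa> by (simp add: \<epsilon>_def)
    have "s - \<epsilon> \<in> T"
      unfolding T_def
    proof safe
      fix v :: "real vec" assume v: "v \<in> carrier_vec n"
      have "v = D *\<^sub>v (C *\<^sub>v v)"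
        using assoc_mult_mat_vec[OF D(1) C(1) v] D(2) v by simp
      then have "scalar_prod v v \<le> L * scalar_prod (C *\<^sub>v v) (C *\<^sub>v v)"
        using L(2)[of "C *\<^sub>v v"] C v by simp
      also have "\<dots> \<le> L * (- \<kappa> * scalar_prod v (C *\<^sub>v v))"
        using nsd_mult_bound[OF C nsd \<kappa> v] L(1) by (intro mult_left_mono) auto
      finally have "\<epsilon> * scalar_prod v v \<le> - scalar_prod v (C *\<^sub>v v)"
        using L(1) \<kappa>(1) by (simp add: \<epsilon>_def field_simps)
      then show "scalar_prod v (B *\<^sub>v v) \<le> (s - \<epsilon>) * scalar_prod v v"
        using v by (simp add: Cv algebra_simps)
    qed
    then show False using up[of "s - \<epsilon>"] \<epsilon> by simp
  qed
  have "k \<le> s" if k: "eigenvalue B k" for k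
  proof -
    obtain v where v: "v \<in> carrier_vec n" "v \<noteq> 0\<^sub>v n" "B *\<^sub>v v = k \<cdot>\<^sub>v v"
      using k B by (auto simp: eigenvalue_def eigenvector_def)
    have "k * scalar_prod v v \<le> s * scalar_prod v v"
      using sT v by (auto simp: T_def)
    then show ?thesis using scalar_prod_self_pos[OF v(1,2)] by simp
  qed
  then have "lambda1 B = s"
    unfolding lambda1_def using card_finite_spectrum(1)[OF B(1)] ev_s
    by (intro Max_eqI) (auto simp: spectrum_def)
  then show ?thesis using up[of t] by (auto simp: T_def)
qed

section \<open>Symmetric matrices of rank one\<close>

text \<open>A nonzero minor would make the columns j and l linearly independent, so the rank would
  be at least 2.\<close>

lemma rank_one_minor:
  fixes A :: "real mat"
  assumes A: "A \<in> carrier_mat n n" and rk: "vec_space.rank n A = 1"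
    and ind: "i < n" "j < n" "k < n" "l < n"
  shows "A $$ (i, j) * A $$ (k, l) = A $$ (i, l) * A $$ (k, j)"
proof (rule ccontr)
  assume ne: "A $$ (i, j) * A $$ (k, l) \<noteq> A $$ (i, l) * A $$ (k, j)"
  interpret vec_space "TYPE(real)" n .
  let ?x = "col A j" and ?y = "col A l"
  have xy: "?x \<in> carrier_vec n" "?y \<in> carrier_vec n" using A ind by auto
  \<comment> \<open>Linear independence concerns a set of vectors, so the two columns must be
    distinct for the set to have two elements.\<close>
  have neq: "?x \<noteq> ?y"
  proof
    assume "?x = ?y"
    then have "?x $ i = ?y $ i" "?x $ k = ?y $ k" by auto
    then show False using ne A ind by simp
  qed
  have "lin_indpt {?x, ?y}"
  proof -
    have lc: "\<forall>v\<in>{?x, ?y}. a v = 0" if "lincomb a {?x, ?y} = 0\<^sub>v n" for a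
    proof -
      from that have "(lincomb a {?x, ?y}) $ i = 0" "(lincomb a {?x, ?y}) $ k = 0" using ind by auto
      then have e: "a ?x * A $$ (i, j) + a ?y * A $$ (i, l) = 0" "a ?x * A $$ (k, j) + a ?y * A $$ (k, l) = 0"
        using lincomb_index[of i "{?x, ?y}" a] lincomb_index[of k "{?x, ?y}" a] ind xy neq A by auto
      let ?D = "A $$ (i, j) * A $$ (k, l) - A $$ (i, l) * A $$ (k, j)"
      \<comment> \<open>Cramer's rule for the equations in the coordinates i and k.\<close>
      have "a ?x * ?D = (a ?x * A $$ (i, j) + a ?y * A $$ (i, l)) * A $$ (k, l) - (a ?x * A $$ (k, j) + a ?y * A $$ (k, l)) * A $$ (i, l)"
        "a ?y * ?D = (a ?x * A $$ (k, j) + a ?y * A $$ (k, l)) * A $$ (i, j) - (a ?x * A $$ (i, j) + a ?y * A $$ (i, l)) * A $$ (k, j)"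
        by (simp_all add: algebra_simps)
      then have "a ?x * ?D = 0" "a ?y * ?D = 0" unfolding e by auto
      then show ?thesis using ne by simp
    qed
    show ?thesis
      by (rule finite_lin_indpt2) (use xy lc in \<open>auto simp: module_vec_simps\<close>)
  qed
  moreover have "{?x, ?y} \<subseteq> set (cols A)" using A ind by (auto simp: cols_def)
  ultimately have "rank A \<ge> card {?x, ?y}" using rank_ge_card_indpt[OF A] by blast
  then show False using neq rk by simp
qed

text \<open>For an eigenvector w, vanishing minors and the eigenvector equation give A_ij w_k = w_i
  A_kj. Multiplying by w_k and summing over k yields |w|^2 A = \<theta> w w^T, and u is w
  normalised.\<close>

lemma rank_one_symmetric:
  fixes A :: "real mat"
  assumes A: "A \<in> carrier_mat n n" "transpose_mat A = A" and rk: "vec_space.rank n A = 1"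
    and ev: "eigenvalue A \<theta>" and \<theta>: "\<theta> \<noteq> 0"
  shows "\<exists>u. (\<Sum>i\<in>{0..<n}. (u i)\<^sup>2) = 1 \<and> (\<forall>i<n. \<forall>j<n. A $$ (i, j) = \<theta> * u i * u j)"
proof -
  obtain w where w: "w \<in> carrier_vec n" "w \<noteq> 0\<^sub>v n" "A *\<^sub>v w = \<theta> \<cdot>\<^sub>v w"
    using ev A by (auto simp: eigenvalue_def eigenvector_def)
  have sym: "A $$ (i, j) = A $$ (j, i)" if "i < n" "j < n" for i j
    using A that by (metis carrier_matD index_transpose_mat(1))
  have row: "(\<Sum>l\<in>{0..<n}. A $$ (k, l) * w $ l) = \<theta> * w $ k" if k: "k < n" for k
  proof -
    have "(A *\<^sub>v w) $ k = (\<Sum>l\<in>{0..<n}. A $$ (k, l) * w $ l)" using k A w(1) by (simp add: scalar_prod_def)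
    then show ?thesis using w k by simp
  qed
  define r where "r = (\<Sum>k\<in>{0..<n}. (w $ k)\<^sup>2)"
  have r: "r > 0" using scalar_prod_self_pos[OF w(1,2)] w(1) by (simp add: r_def scalar_prod_def power2_eq_square)
  have cross: "A $$ (i, j) * w $ k = w $ i * A $$ (k, j)" if "i < n" "j < n" "k < n" for i j k
  proof -
    have "A $$ (i, j) * (\<theta> * w $ k) = (\<Sum>l\<in>{0..<n}. A $$ (i, j) * A $$ (k, l) * w $ l)"
      unfolding row[OF that(3), symmetric] by (simp add: sum_distrib_left mult.assoc)
    also have "\<dots> = (\<Sum>l\<in>{0..<n}. A $$ (i, l) * A $$ (k, j) * w $ l)"
      using rank_one_minor[OF A(1) rk] that by (intro sum.cong) auto
    also have "\<dots> = (\<theta> * w $ i) * A $$ (k, j)"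
      unfolding row[OF that(1), symmetric] by (simp add: sum_distrib_left mult_ac)
    finally show ?thesis using \<theta> by simp
  qed
  have main: "A $$ (i, j) * r = \<theta> * w $ i * w $ j" if ij: "i < n" "j < n" for i j
  proof -
    have "A $$ (i, j) * r = (\<Sum>k\<in>{0..<n}. A $$ (i, j) * w $ k * w $ k)"
      by (simp add: r_def sum_distrib_left power2_eq_square mult.assoc)
    also have "\<dots> = (\<Sum>k\<in>{0..<n}. w $ i * (A $$ (j, k) * w $ k))"
      using cross sym ij by (intro sum.cong) (auto simp: mult.assoc)
    also have "\<dots> = \<theta> * w $ i * w $ j"
      using row[OF ij(2)] by (simp add: sum_distrib_left[symmetric])
    finally show ?thesis .
  qed
  define u where "u i = w $ i / sqrt r" for i
  have "(\<Sum>i\<in>{0..<n}. (u i)\<^sup>2) = 1"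
    using r by (simp add: u_def power_divide r_def[symmetric] flip: sum_divide_distrib)
  moreover have "A $$ (i, j) = \<theta> * u i * u j" if "i < n" "j < n" for i j
  proof -
    have "\<theta> * u i * u j = \<theta> * w $ i * w $ j / r" using r by (simp add: u_def)
    then show ?thesis using r by (simp add: main[OF that, symmetric])
  qed
  ultimately show ?thesis by blast
qed

text \<open>The eigenvalue \<theta> is absorbed into the perturbing vector; for a unit vector u the
  squared norm becomes \<theta>, the starting value of the chain.\<close>

lemma lambda1_rank_one_iff:
  fixes B A :: "real mat"
  assumes n: "n > 0" and B: "B \<in> carrier_mat n n" "transpose_mat B = B"
    and A: "A \<in> carrier_mat n n" "transpose_mat A = A"
    and u: "\<And>i j. i < n \<Longrightarrow> j < n \<Longrightarrow> A $$ (i, j) = \<theta> * u i * u j" and \<theta>: "\<theta> \<ge> 0"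
  shows "lambda1 (B + A) \<le> t \<longleftrightarrow> dominated t {0..<n} (\<lambda>i j. B $$ (i, j)) (\<lambda>i. sqrt \<theta> * u i)"
proof -
  have BA: "B + A \<in> carrier_mat n n" "transpose_mat (B + A) = B + A"
    using A B by (auto simp: transpose_add[of _ n n])
  have form: "scalar_prod v ((B + A) *\<^sub>v v) = bform {0..<n} (\<lambda>i j. B $$ (i, j)) (\<lambda>i. v $ i) + (\<Sum>i\<in>{0..<n}. sqrt \<theta> * u i * v $ i)\<^sup>2"
    if v: "v \<in> carrier_vec n" for v
  proof -
    have "scalar_prod v ((B + A) *\<^sub>v v) = (\<Sum>i\<in>{0..<n}. v $ i * ((B + A) *\<^sub>v v) $ i)"
    proof -
      have d: "dim_vec ((B + A) *\<^sub>v v) = n" using A by simp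
      show ?thesis unfolding scalar_prod_def d ..
    qed
    also have "\<dots> = (\<Sum>i\<in>{0..<n}. v $ i * (\<Sum>j\<in>{0..<n}. (B $$ (i, j) + \<theta> * u i * u j) * v $ j))"
    proof (rule sum.cong[OF refl])
      fix i assume i: "i \<in> {0..<n}"
      then have "((B + A) *\<^sub>v v) $ i = (\<Sum>j\<in>{0..<n}. (B + A) $$ (i, j) * v $ j)"
        using v A B by (simp add: scalar_prod_def)
      also have "\<dots> = (\<Sum>j\<in>{0..<n}. (B $$ (i, j) + \<theta> * u i * u j) * v $ j)"
        using i A B u by (intro sum.cong) auto
      finally show "v $ i * ((B + A) *\<^sub>v v) $ i = v $ i * (\<Sum>j\<in>{0..<n}. (B $$ (i, j) + \<theta> * u i * u j) * v $ j)" by simp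
    qed
    also have "\<dots> = bform {0..<n} (\<lambda>i j. B $$ (i, j)) (\<lambda>i. v $ i) + (\<Sum>i\<in>{0..<n}. \<Sum>j\<in>{0..<n}. \<theta> * (u i * v $ i) * (u j * v $ j))"
      unfolding bform_def sum_distrib_left sum.distrib[symmetric]
      by (intro sum.cong refl) (simp add: algebra_simps)
    also have "(\<Sum>i\<in>{0..<n}. \<Sum>j\<in>{0..<n}. \<theta> * (u i * v $ i) * (u j * v $ j)) = \<theta> * (\<Sum>i\<in>{0..<n}. u i * v $ i)\<^sup>2"
      unfolding power2_eq_square sum_product by (simp add: sum_distrib_left mult.assoc)
    also have "\<dots> = (\<Sum>i\<in>{0..<n}. sqrt \<theta> * u i * v $ i)\<^sup>2"
      using \<theta> by (simp add: mult.assoc power_mult_distrib flip: sum_distrib_left)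
    finally show ?thesis .
  qed
  have norm: "scalar_prod v v = (\<Sum>i\<in>{0..<n}. (v $ i)\<^sup>2)" if "v \<in> carrier_vec n" for v :: "real vec"
    using that by (simp add: scalar_prod_def power2_eq_square)
  have "lambda1 (B + A) \<le> t \<longleftrightarrow> (\<forall>v\<in>carrier_vec n. bform {0..<n} (\<lambda>i j. B $$ (i, j)) (\<lambda>i. v $ i)
      + (\<Sum>i\<in>{0..<n}. sqrt \<theta> * u i * v $ i)\<^sup>2 \<le> t * (\<Sum>i\<in>{0..<n}. (v $ i)\<^sup>2))"
    unfolding lambda1_le_iff[OF n BA] by (simp add: form norm)
  also have "\<dots> \<longleftrightarrow> dominated t {0..<n} (\<lambda>i j. B $$ (i, j)) (\<lambda>i. sqrt \<theta> * u i)"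
  proof
    assume *: "\<forall>v\<in>carrier_vec n. bform {0..<n} (\<lambda>i j. B $$ (i, j)) (\<lambda>i. v $ i)
      + (\<Sum>i\<in>{0..<n}. sqrt \<theta> * u i * v $ i)\<^sup>2 \<le> t * (\<Sum>i\<in>{0..<n}. (v $ i)\<^sup>2)"
    show "dominated t {0..<n} (\<lambda>i j. B $$ (i, j)) (\<lambda>i. sqrt \<theta> * u i)"
      unfolding dominated_def
    proof
      fix v :: "nat \<Rightarrow> real"
      show "bform {0..<n} (\<lambda>i j. B $$ (i, j)) v + (\<Sum>i\<in>{0..<n}. sqrt \<theta> * u i * v i)\<^sup>2 \<le> t * (\<Sum>i\<in>{0..<n}. (v i)\<^sup>2)"
      proof -
        let ?w = "\<lambda>i. Matrix.vec n v $ i"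
        have w: "?w i = v i" if "i \<in> {0..<n}" for i using that by simp
        have "bform {0..<n} (\<lambda>i j. B $$ (i, j)) ?w = bform {0..<n} (\<lambda>i j. B $$ (i, j)) v"
          "(\<Sum>i\<in>{0..<n}. sqrt \<theta> * u i * ?w i) = (\<Sum>i\<in>{0..<n}. sqrt \<theta> * u i * v i)"
          "(\<Sum>i\<in>{0..<n}. (?w i)\<^sup>2) = (\<Sum>i\<in>{0..<n}. (v i)\<^sup>2)"
          unfolding bform_def by (intro sum.cong refl; simp only: w)+
        then show ?thesis using *[rule_format, OF vec_carrier, of v] by (simp only:)
      qed
    qed
  qed (auto simp: dominated_def)
  finally show ?thesis .
qed

section \<open>Transfer to the GOE and conclusion\<close>

text \<open>Both events depend only on the upper triangle of the array, so the identity for the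
  product measure carries over to any probability space on which that triangle has the product
  law.\<close>

lemma (in normal_array) prob_dominated_eq_chain:
  assumes N: "N > 0" and s: "s > 0"
  defines "Y \<equiv> \<lambda>\<omega> p. s * G p \<omega>"
  shows "{\<omega> \<in> space M. dominated t {0..<N} (wigner_entry (Y \<omega>)) y} \<in> sets M" (is "?A \<in> _")
    and "prob {\<omega> \<in> space M. dominated t {0..<N} (wigner_entry (Y \<omega>)) y}
       = prob {\<omega> \<in> space M. chain t N (Y \<omega>) N (\<Sum>i\<in>{0..<N}. (y i)\<^sup>2)}"
proof -
  let ?I = "upper_tri {0..<N}"
  let ?R = "\<lambda>\<omega>. \<lambda>p\<in>?I. Y \<omega> p"
  have rv: "(\<lambda>\<omega>. Y \<omega> p) \<in> borel_measurable M" if "p \<in> ?I" for p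
    using measurable_entry[OF that] by (simp add: Y_def)
  have ind: "indep_vars (\<lambda>_. borel) (\<lambda>p \<omega>. Y \<omega> p) ?I"
    unfolding Y_def using indep by (rule indep_vars_compose2) measurable
  have ne: "?I \<noteq> {}" using N by (auto simp: upper_tri_def)
  have dist: "distr M borel (\<lambda>\<omega>. Y \<omega> p) = gauss s" if p: "p \<in> ?I" for p
    unfolding gauss_eq_distr_std_normal[OF s] std[OF p, symmetric] Y_def
    using measurable_entry[OF p] by (subst distr_distr) (auto simp: comp_def)
  have "distr M (\<Pi>\<^sub>M p\<in>?I. borel) ?R = (\<Pi>\<^sub>M p\<in>?I. distr M borel (\<lambda>\<omega>. Y \<omega> p))"
    using indep_vars_iff_distr_eq_PiM'[where I = "?I" and X = "\<lambda>p \<omega>. Y \<omega> p" and M' = "\<lambda>_. borel", OF ne rv] ind by simp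
  also have "\<dots> = gprod s ?I" by (rule PiM_cong) (auto simp: dist)
  finally have D: "distr M (\<Pi>\<^sub>M p\<in>?I. borel) ?R = gprod s ?I" .
  have sets_eq: "sets (gprod s ?I) = sets (\<Pi>\<^sub>M p\<in>?I. borel)" by (rule sets_PiM_cong) auto
  have R: "?R \<in> measurable M (gprod s ?I)"
    unfolding measurable_cong_sets[OF refl sets_eq] by (rule measurable_restrict) (rule rv)
  have DR: "distr M (gprod s ?I) ?R = gprod s ?I"
    using D by (simp add: distr_cong[OF refl sets_eq refl])
  have dom: "dominated t {0..<N} (wigner_entry (?R \<omega>)) y = dominated t {0..<N} (wigner_entry (Y \<omega>)) y" for \<omega>
    by (rule dominated_cong) (auto simp: wigner_entry_def upper_tri_def)
  have ch: "chain t N (?R \<omega>) N d = chain t N (Y \<omega>) N d" for \<omega> d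
    by (rule chain_cong) (auto simp: upper_tri_def)
  show "?A \<in> sets M"
  proof (rule sets_dominated)
    fix i j assume "i \<in> {0..<N}" "j \<in> {0..<N}"
    then show "(\<lambda>\<omega>. wigner_entry (Y \<omega>) i j) \<in> borel_measurable M"
      unfolding wigner_entry_def
      by (cases i j rule: linorder_cases) (simp_all add: rv upper_tri_def borel_measurable_times min_def max_def)
  qed simp
  let ?d = "\<Sum>i\<in>{0..<N}. (y i)\<^sup>2"
  have ch_sets: "{Z \<in> space (gprod s ?I). chain t N Z N ?d} \<in> sets (gprod s ?I)"
    by (rule pred_chain) (auto intro!: measurable_gprod_component simp: upper_tri_def)
  have "emeasure M {\<omega> \<in> space M. dominated t {0..<N} (wigner_entry (Y \<omega>)) y}
      = emeasure (gprod s ?I) {Z \<in> space (gprod s ?I). dominated t {0..<N} (wigner_entry Z) y}"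
    using emeasure_distr_vimage[OF R DR sets_dominated_wigner[of "{0..<N}" s t y]] unfolding dom by simp
  also have "\<dots> = emeasure (gprod s ?I) {Z \<in> space (gprod s ?I). chain t N Z N ?d}"
    using emeasure_dominated_eq_chain[OF s order_refl, of N t y] by simp
  also have "\<dots> = emeasure M {\<omega> \<in> space M. chain t N (Y \<omega>) N ?d}"
    using emeasure_distr_vimage[OF R DR ch_sets] unfolding ch by simp
  finally show "prob {\<omega> \<in> space M. dominated t {0..<N} (wigner_entry (Y \<omega>)) y} = prob {\<omega> \<in> space M. chain t N (Y \<omega>) N ?d}"
    by (simp add: measure_def)
qed

text \<open>The matrix is recovered from the standardised entries at every sample point, not merely
  in law, so events about X become events about G.\<close>

lemma GOE_distributed_normal_array:
  assumes GOE: "GOE_distributed P N \<sigma> X" and \<sigma>: "\<sigma> > 0" and N: "N > 0"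
  shows "\<exists>G. normal_array P N G \<and> (\<forall>\<omega>\<in>space P. X \<omega> \<in> carrier_mat N N \<and> transpose_mat (X \<omega>) = X \<omega> \<and>
    (\<forall>i<N. \<forall>j<N. X \<omega> $$ (i, j) = wigner_entry (\<lambda>p. \<sigma> / sqrt N * G p \<omega>) i j))"
proof -
  obtain W where P: "prob_space P" and W: "gaussian_wigner P N \<sigma> W"
    and X: "\<And>\<omega>. \<omega> \<in> space P \<Longrightarrow> X \<omega> = (1 / sqrt (real N)) \<cdot>\<^sub>m W \<omega>"
    using GOE by (auto simp: GOE_distributed_def)
  interpret prob_space P by (rule P)
  define Y where "Y = (\<lambda>(i, j) \<omega>. if i = j then 1 / sqrt 2 * W \<omega> $$ (i, i) else W \<omega> $$ (i, j))"
  have I: "{(i, j). i \<le> j \<and> j < N} = upper_tri {0..<N}" by (auto simp: upper_tri_def)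
  have Wm: "W \<omega> \<in> carrier_mat N N" "transpose_mat (W \<omega>) = W \<omega>" if "\<omega> \<in> space P" for \<omega>
    using W that by (auto simp: gaussian_wigner_def)
  have ind: "indep_vars (\<lambda>_. borel) Y (upper_tri {0..<N})"
    and dist: "\<And>p. p \<in> upper_tri {0..<N} \<Longrightarrow> distributed P lborel (Y p) (normal_density 0 \<sigma>)"
    using W unfolding gaussian_wigner_def Let_def I Y_def by auto
  define G where "G p \<omega> = Y p \<omega> / \<sigma>" for p \<omega>
  have "normal_array P N G"
  proof (unfold_locales)
    show "indep_vars (\<lambda>_. borel) G (upper_tri {0..<N})"
      unfolding G_def[abs_def] using ind by (rule indep_vars_compose2) measurable
    fix p assume "p \<in> upper_tri {0..<N}"
    from dist[OF this] have d: "distributed P lborel (\<lambda>\<omega>. (Y p \<omega> - 0) / \<sigma>) std_normal_density"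
      using normal_standard_normal_convert[OF \<sigma>] by blast
    have "distr P borel (G p) = distr P lborel (\<lambda>\<omega>. (Y p \<omega> - 0) / \<sigma>)"
      by (rule distr_cong) (auto simp: G_def)
    then show "distr P borel (G p) = std_normal_distribution"
      using d by (simp add: distributed_def)
  qed
  moreover have "X \<omega> $$ (i, j) = wigner_entry (\<lambda>p. \<sigma> / sqrt N * G p \<omega>) i j" if \<omega>: "\<omega> \<in> space P" and ij: "i < N" "j < N" for \<omega> i j
  proof -
    have sym: "W \<omega> $$ (i, j) = W \<omega> $$ (j, i)"
      using Wm[OF \<omega>] ij by (metis carrier_matD index_transpose_mat(1))
    have "X \<omega> $$ (i, j) = W \<omega> $$ (i, j) / sqrt N" using X[OF \<omega>] Wm[OF \<omega>] ij by simp
    then show ?thesis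
      using \<sigma> sym by (cases i j rule: linorder_cases) (auto simp: wigner_entry_def G_def Y_def min_def max_def)
  qed
  moreover have "X \<omega> \<in> carrier_mat N N \<and> transpose_mat (X \<omega>) = X \<omega>" if "\<omega> \<in> space P" for \<omega>
  proof -
    have "transpose_mat (c \<cdot>\<^sub>m W \<omega>) = c \<cdot>\<^sub>m transpose_mat (W \<omega>)" for c
      by (rule eq_matI) auto
    then show ?thesis unfolding X[OF that] using Wm[OF that] by simp
  qed
  ultimately show ?thesis by blast
qed

theorem theorem2p3:
  fixes \<sigma> \<theta> :: real
    and A :: "nat \<Rightarrow> real mat"
    and P :: "nat \<Rightarrow> 'a measure"
    and X :: "nat \<Rightarrow> 'a \<Rightarrow> real mat"
  assumes "\<sigma> > 0" and "\<theta> > \<sigma>"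
    and "\<And>N. N \<ge> 1 \<Longrightarrow> A N \<in> carrier_mat N N"
    and "\<And>N. N \<ge> 1 \<Longrightarrow> transpose_mat (A N) = A N"
    and "\<And>N. N \<ge> 1 \<Longrightarrow> vec_space.rank N (A N) = 1"
    and "\<And>N. N \<ge> 1 \<Longrightarrow> eigenvalue (A N) \<theta>"
    and "\<And>N. N \<ge> 1 \<Longrightarrow> GOE_distributed (P N) N \<sigma> (X N)"
  shows "weak_conv_m
           (\<lambda>N. distr (P N) borel (\<lambda>\<omega>. sqrt (real N) * (lambda1 (X N \<omega> + A N) - rho \<sigma> \<theta>)))
           (gaussian_law 0 (2 * (sigma_theta \<sigma> \<theta>)\<^sup>2))"
proof -
  note \<sigma> = assms(1) and \<theta> = assms(2) and A = assms(3-6) and GOE = assms(7)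
  have \<theta>0: "\<theta> > 0" using \<sigma> \<theta> by simp
  define r where "r = \<sigma>\<^sup>2 / \<theta>\<^sup>2"
  have r01: "0 < r" "r < 1" using \<sigma> \<theta> by (auto simp: r_def power_strict_mono)
  define Q where "Q N G \<longleftrightarrow> normal_array (P N) N G \<and> (\<forall>\<omega>\<in>space (P N). X N \<omega> \<in> carrier_mat N N \<and> transpose_mat (X N \<omega>) = X N \<omega> \<and>
    (\<forall>i<N. \<forall>j<N. X N \<omega> $$ (i, j) = wigner_entry (\<lambda>p. \<sigma> / sqrt N * G p \<omega>) i j))" for N G
  have "\<exists>G. Q N G" if "N > 0" for N
    unfolding Q_def by (rule GOE_distributed_normal_array[OF GOE \<sigma> that]) (use that in simp)
  then have "\<forall>N. \<exists>G. N > 0 \<longrightarrow> Q N G" by blast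
  from choice[OF this] obtain G where Q: "\<And>N. N > 0 \<Longrightarrow> Q N (G N)" by blast
  have G: "normal_array (P N) N (G N)" if "N > 0" for N using Q[OF that] unfolding Q_def by blast
  have X: "X N \<omega> \<in> carrier_mat N N" "transpose_mat (X N \<omega>) = X N \<omega>"
    "\<And>i j. i < N \<Longrightarrow> j < N \<Longrightarrow> X N \<omega> $$ (i, j) = wigner_entry (\<lambda>p. \<sigma> / sqrt N * G N p \<omega>) i j"
    if "N > 0" "\<omega> \<in> space (P N)" for N \<omega>
    using Q[OF that(1)] that(2) unfolding Q_def by blast+
  let ?f = "\<lambda>N \<omega>. sqrt (real N) * (lambda1 (X N \<omega> + A N) - rho \<sigma> \<theta>)"
  let ?ch = "\<lambda>N s. measure (P N) {\<omega> \<in> space (P N). chain (rho \<sigma> \<theta> + s / sqrt N) N (\<lambda>p. \<sigma> / sqrt N * G N p \<omega>) N \<theta>}"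
  have cdf_eq: "cdf (distr (P N) borel (?f N)) s = ?ch N s" if N: "N > 0" for N s
  proof -
    interpret normal_array "P N" N "G N" by (rule G[OF N])
    obtain u where u: "(\<Sum>i\<in>{0..<N}. (u i)\<^sup>2) = 1" "\<And>i j. i < N \<Longrightarrow> j < N \<Longrightarrow> A N $$ (i, j) = \<theta> * u i * u j"
      using rank_one_symmetric[of "A N" N \<theta>] A[of N] N \<theta>0 by (auto simp: Suc_le_eq)
    let ?Y = "\<lambda>\<omega> p. \<sigma> / sqrt N * G N p \<omega>"
    let ?y = "\<lambda>i. sqrt \<theta> * u i"
    have s: "\<sigma> / sqrt N > 0" using \<sigma> N by simp
    have dom: "lambda1 (X N \<omega> + A N) \<le> t \<longleftrightarrow> dominated t {0..<N} (wigner_entry (?Y \<omega>)) ?y" if \<omega>: "\<omega> \<in> space (P N)" for \<omega> t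
    proof -
      have "lambda1 (X N \<omega> + A N) \<le> t \<longleftrightarrow> dominated t {0..<N} (\<lambda>i j. X N \<omega> $$ (i, j)) ?y"
        by (rule lambda1_rank_one_iff) (use N X[OF N \<omega>] A[of N] u \<theta>0 in auto)
      also have "\<dots> \<longleftrightarrow> dominated t {0..<N} (wigner_entry (?Y \<omega>)) ?y"
        by (rule dominated_cong) (use X(3)[OF N \<omega>] in auto)
      finally show ?thesis .
    qed
    \<comment> \<open>Measurability of the largest eigenvalue follows from that of its sublevel
      events; it is needed for \<open>distr\<close> to be the intended law.\<close>
    have "(\<lambda>\<omega>. lambda1 (X N \<omega> + A N)) \<in> borel_measurable (P N)"
    proof (rule borel_measurable_iff_le[THEN iffD2], rule allI)
      fix t
      have "{\<omega> \<in> space (P N). lambda1 (X N \<omega> + A N) \<le> t} = {\<omega> \<in> space (P N). dominated t {0..<N} (wigner_entry (?Y \<omega>)) ?y}"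
        using dom by blast
      then show "{\<omega> \<in> space (P N). lambda1 (X N \<omega> + A N) \<le> t} \<in> sets (P N)"
        using prob_dominated_eq_chain(1)[OF N s] by simp
    qed
    then have [measurable]: "?f N \<in> borel_measurable (P N)" by measurable
    have "cdf (distr (P N) borel (?f N)) s = measure (P N) {\<omega> \<in> space (P N). ?f N \<omega> \<le> s}"
      unfolding cdf_def by (subst measure_distr) (auto simp: vimage_def Int_def conj_commute)
    also have "{\<omega> \<in> space (P N). ?f N \<omega> \<le> s} = {\<omega> \<in> space (P N). dominated (rho \<sigma> \<theta> + s / sqrt N) {0..<N} (wigner_entry (?Y \<omega>)) ?y}"
    proof -
      have "?f N \<omega> \<le> s \<longleftrightarrow> lambda1 (X N \<omega> + A N) \<le> rho \<sigma> \<theta> + s / sqrt N" for \<omega>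
      proof -
        have "w * (l - \<rho>) \<le> s \<longleftrightarrow> l \<le> \<rho> + s / w" if "w > 0" for w l \<rho> :: real
        proof -
          have "w * (l - \<rho>) \<le> s \<longleftrightarrow> l - \<rho> \<le> s / w" using that by (simp add: pos_le_divide_eq mult.commute)
          then show ?thesis by linarith
        qed
        then show ?thesis using N by simp
      qed
      then show ?thesis using dom by blast
    qed
    also have "measure (P N) \<dots> = measure (P N) {\<omega> \<in> space (P N). chain (rho \<sigma> \<theta> + s / sqrt N) N (?Y \<omega>) N (\<Sum>i\<in>{0..<N}. (?y i)\<^sup>2)}"
      by (rule prob_dominated_eq_chain(2)[OF N s])
    also have "(\<Sum>i\<in>{0..<N}. (?y i)\<^sup>2) = \<theta>"
      using u(1) \<theta>0 by (simp add: power_mult_distrib flip: sum_distrib_left)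
    finally show ?thesis .
  qed
  have law: "gaussian_law 0 (2 * (sigma_theta \<sigma> \<theta>)\<^sup>2) = gauss ((1 - r) * sqrt (2 * \<sigma>\<^sup>2 / (1 - r)))"
  proof -
    have "\<theta>\<^sup>2 - \<sigma>\<^sup>2 \<ge> 0" using \<sigma> \<theta> by (simp add: power_mono)
    then have "2 * (sigma_theta \<sigma> \<theta>)\<^sup>2 = 2 * \<sigma>\<^sup>2 / \<theta>\<^sup>2 * (\<theta>\<^sup>2 - \<sigma>\<^sup>2)"
      by (simp add: sigma_theta_def power_mult_distrib power_divide)
    also have "\<dots> = 2 * \<sigma>\<^sup>2 * (1 - r)"
      using \<theta>0 by (simp add: r_def diff_divide_distrib right_diff_distrib)
    also have "\<dots> = (1 - r)\<^sup>2 * (2 * \<sigma>\<^sup>2 / (1 - r))"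
      using r01 by (simp add: power2_eq_square)
    finally have "sqrt (2 * (sigma_theta \<sigma> \<theta>)\<^sup>2) = (1 - r) * sqrt (2 * \<sigma>\<^sup>2 / (1 - r))"
      using r01 by (simp only: real_sqrt_mult) simp
    then show ?thesis unfolding gaussian_law_def by (simp only:)
  qed
  have v: "sqrt (2 * \<sigma>\<^sup>2 / (1 - r)) > 0" using \<sigma> r01 by simp
  show ?thesis
    unfolding weak_conv_m_def weak_conv_def
  proof (intro allI impI)
    fix s
    have "(\<lambda>N. ?ch N s) \<longlonglongrightarrow> cdf (gauss (sqrt (2 * \<sigma>\<^sup>2 / (1 - r)))) (s / (1 - r))"
      by (rule LIMSEQ_prob_chain[OF \<sigma> \<theta> G r_def])
    also have "cdf (gauss (sqrt (2 * \<sigma>\<^sup>2 / (1 - r)))) (s / (1 - r)) = cdf (gaussian_law 0 (2 * (sigma_theta \<sigma> \<theta>)\<^sup>2)) s"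
      unfolding law by (rule cdf_gauss_scale[OF v]) (use r01 in simp)
    finally show "(\<lambda>N. cdf (distr (P N) borel (?f N)) s) \<longlonglongrightarrow> cdf (gaussian_law 0 (2 * (sigma_theta \<sigma> \<theta>)\<^sup>2)) s"
    proof (rule Lim_transform_eventually)
      show "\<forall>\<^sub>F N in sequentially. ?ch N s = cdf (distr (P N) borel (?f N)) s"
        \<comment> \<open>The identity is available for positive N only: at N = 0 there is no
          spectrum, and a single index does not affect the limit.\<close>
        using eventually_gt_at_top[of 0] by eventually_elim (simp only: cdf_eq)
    qed
  qed
qed

end
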